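(* Let $a\ge 1$, $b\ge 0$ be integers and let $\nu=NE^{\nu_1}NE^{\nu_2}\cdots NE^{\nu_a}$ be a lattice path from $(0,0)$ to $(b,a)$. The length-framed triangulation of $\mathcal{F}_{\mathrm{car}(\nu)}$ is a regular unimodular triangulation whose dual graph is (isomorphic, as an undirected graph, to) the Hasse diagram of the $\nu$-Tamari lattice $\mathrm{Tam}(\nu)$.
   Context: Lattice paths use north steps $N=(0,1)$ and east steps $E=(1,0)$. Here $\nu=NE^{\nu_1}\cdots NE^{\nu_a}$ with integers $\nu_i\ge 0$ and $\sum_i \nu_i=b$. A $\nu$-Dyck path is a lattice path from $(0,0)$ to $(b,a)$ that lies weakly above $\nu$. **Graph and polytope.** The $\nu$-caracol graph $\mathrm{car}(\nu)$ is the directed multigraph on the vertex set $\{1,\dots,a+3\}$, all edges $(i,j)$ directed from $i$ to $j$ with $i<j$, having exactly these edges: $\nu_i$ copies of $(1,i+2)$ for $i=1,\dots,a$; one edge $(i,a+3)$ for each $i=2,\dots,a+1$; one edge $(i,i+1)$ for each $i=1,\dots,a+2$. Write $n+1=a+3$ and let $m=2a+b+2$ be the number of edges. The flow polytope $\mathcal{F}_{\mathrm{car}(\nu)}\subset\mathbb{R}^m$ is the set of nonnegative tuples $(x_e)_e$ with $\sum_{e\in \mathrm{out}(1)}x_e=1$ and $\sum_{e\in\mathrm{out}(j)}x_e=\sum_{e\in\mathrm{in}(j)}x_e$ for $j=2,\dots,n$. Its dimension is $a+b$. A route is a directed path from $1$ to $n+1$; the vertices of $\mathcal{F}_{\mathrm{car}(\nu)}$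 are the indicator vectors of routes. **Framings and framed triangulations.** Inner vertices are $2,\dots,n$. A framing is a choice, at every inner vertex $i$, of linear orders $\prec_{\mathrm{in}(i)}$ and $\prec_{\mathrm{out}(i)}$ on the sets of incoming and outgoing edges at $i$. For distinct directed paths $P,Q$ from $1$ to $i$, let $j\le i$ be the smallest vertex after which $P$ and $Q$ coincide, and put $P\prec Q$ iff the edge of $P$ entering $j$ precedes the edge of $Q$ entering $j$ in $\prec_{\mathrm{in}(j)}$. For distinct directed paths $P,Q$ from $i$ to $n+1$, let $j\ge i$ be the largest vertex before which they coincide, and put $P\prec Q$ iff the edge of $P$ leaving $j$ precedes the edge of $Q$ leaving $j$ in $\prec_{\mathrm{out}(j)}$. For a route $R$ through $i$, $Ri$ and $iR$ denote the subpaths of $R$ ending, respectively beginning, at $i$. Routes $R,Q$ through $i$ are coherent at $i$ if $Ri,Qi$ are ordered the same as $iR,iQ$ (i.e. it is not the case that one of the pairs is strictly ordered one way and the other pair strictly ordered the opposite way; equal subpaths cause no conflict). Routes are coherent if they are coherent at every common inner vertex. A clique is a set of mutually coherent routes; for a maximal clique $C$, $\Delta_C$ is the convex hull of the vertices of the flow polytope corresponding to routes in $C$. The framed triangulation is the one with top-dimensional simplices $\{\Delta_C : C \text{ a maximal clique}\}$. **Length framing.** The copies of each multiedge are labelled $1,2,\dots$. The length of edge $(i,j)$ is $j-i$. In the length framing, at each inner vertex, both among incoming and among outgoing edges, longer edges precede shorter ones, and parallel edges with smaller labels precede those with larger labels. The length-framed triangulation is the framed triangulation for this framing. **Dual graph.**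 The dual graph of a triangulation has the top-dimensional simplices as vertices, with edges between simplices sharing a common facet. A triangulation by lattice simplices is unimodular if each top-dimensional simplex is unimodular with respect to the lattice $\mathbb{Z}^m\cap\mathrm{aff}(\mathcal{F}_{\mathrm{car}(\nu)})$; "regular" has its usual meaning. **$\nu$-Tamari lattice.** For a lattice point $p$ on a $\nu$-Dyck path $\mu$, $\mathrm{horiz}_\nu(p)$ is the maximum number of east steps that can be added to the right of $p$ without crossing $\nu$. A valley of $\mu$ is a lattice point $p$ at the end of an $E$ step that is immediately followed by an $N$ step. If $p$ is a valley of $\mu$, let $q$ be the first lattice point of $\mu$ after $p$ with $\mathrm{horiz}_\nu(q)=\mathrm{horiz}_\nu(p)$; the rotation of $\mu$ at $p$ is the $\nu$-Dyck path $\mu'$ obtained by switching the $E$ step preceding $p$ with the subpath of $\mu$ from $p$ to $q$. $\mathrm{Tam}(\nu)$ is the poset (a lattice) on the set of $\nu$-Dyck paths whose covering relations are $\mu\lessdot\mu'$ for all such rotations. *)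

theory Defs
  imports "HOL-Analysis.Analysis" "Graph_Theory.Digraph_Isomorphism"
begin

section \<open>Flow polytopes and framed triangulations\<close>

text \<open>
  In this section \<open>G\<close> is an acyclic multidigraph with source \<open>s\<close> and sink \<open>t\<close> whose set of arcs is
  a whole finite type \<open>'e\<close>, so that \<open>real ^ 'e\<close> is the space with one coordinate per arc.
\<close>

definition inner_verts :: "('v, 'e) pre_digraph \<Rightarrow> 'v \<Rightarrow> 'v \<Rightarrow> 'v set" where
  "inner_verts G s t = verts G - {s, t}"

definition flow_polytope :: "('v, 'e::finite) pre_digraph \<Rightarrow> 'v \<Rightarrow> 'v \<Rightarrow> (real ^ 'e) set" where
  "flow_polytope G s t =
     {x. (\<forall>e. 0 \<le> x $ e) \<and>
         (\<Sum>e\<in>out_arcs G s. x $ e) = 1 \<and>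
         (\<forall>v\<in>inner_verts G s t. (\<Sum>e\<in>out_arcs G v. x $ e) = (\<Sum>e\<in>in_arcs G v. x $ e))}"

definition routes :: "('v, 'e) pre_digraph \<Rightarrow> 'v \<Rightarrow> 'v \<Rightarrow> 'e list set" where
  "routes G s t = {R. pre_digraph.apath G s R t}"

definition route_vec :: "'e list \<Rightarrow> real ^ ('e::finite)" where
  "route_vec R = (\<chi> e. if e \<in> set R then 1 else 0)"

record ('v, 'e) framing =
  in_less :: "'v \<Rightarrow> 'e \<Rightarrow> 'e \<Rightarrow> bool"
  out_less :: "'v \<Rightarrow> 'e \<Rightarrow> 'e \<Rightarrow> bool"

definition strict_linear_on :: "'e set \<Rightarrow> ('e \<Rightarrow> 'e \<Rightarrow> bool) \<Rightarrow> bool" where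
  "strict_linear_on A r \<longleftrightarrow> irreflp_on A r \<and> transp_on A r \<and> totalp_on A r"

definition is_framing :: "('v, 'e) pre_digraph \<Rightarrow> 'v \<Rightarrow> 'v \<Rightarrow> ('v, 'e) framing \<Rightarrow> bool" where
  "is_framing G s t F \<longleftrightarrow>
     (\<forall>v\<in>inner_verts G s t.
        strict_linear_on (in_arcs G v) (in_less F v) \<and>
        strict_linear_on (out_arcs G v) (out_less F v))"

text \<open>
  The common part \<open>S\<close> is the longest common suffix (prefix) because \<open>e \<noteq> f\<close>; parallel arcs count as
  different, so \<open>e\<close> and \<open>f\<close> may have the same tail (head).
\<close>

definition path_in_less :: "('v, 'e) pre_digraph \<Rightarrow> ('v, 'e) framing \<Rightarrow> 'e list \<Rightarrow> 'e list \<Rightarrow> bool" where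
  "path_in_less G F P Q \<longleftrightarrow>
     (\<exists>P' e Q' f S. P = P' @ e # S \<and> Q = Q' @ f # S \<and> e \<noteq> f \<and> in_less F (head G e) e f)"

definition path_out_less :: "('v, 'e) pre_digraph \<Rightarrow> ('v, 'e) framing \<Rightarrow> 'e list \<Rightarrow> 'e list \<Rightarrow> bool" where
  "path_out_less G F P Q \<longleftrightarrow>
     (\<exists>S e P' f Q'. P = S @ e # P' \<and> Q = S @ f # Q' \<and> e \<noteq> f \<and> out_less F (tail G e) e f)"

text \<open>For a route \<open>R\<close> through an inner vertex \<open>v\<close>: the subpaths of \<open>R\<close> ending and beginning at \<open>v\<close>.\<close>

definition path_to :: "('v, 'e) pre_digraph \<Rightarrow> 'v \<Rightarrow> 'e list \<Rightarrow> 'e list" where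
  "path_to G v R = takeWhile (\<lambda>e. tail G e \<noteq> v) R"

definition path_from :: "('v, 'e) pre_digraph \<Rightarrow> 'v \<Rightarrow> 'e list \<Rightarrow> 'e list" where
  "path_from G v R = dropWhile (\<lambda>e. tail G e \<noteq> v) R"

definition coherent_at ::
    "('v, 'e) pre_digraph \<Rightarrow> ('v, 'e) framing \<Rightarrow> 'v \<Rightarrow> 'e list \<Rightarrow> 'e list \<Rightarrow> bool" where
  "coherent_at G F v R Q \<longleftrightarrow>
     \<not> (path_in_less G F (path_to G v R) (path_to G v Q) \<and>
        path_out_less G F (path_from G v Q) (path_from G v R)) \<and>
     \<not> (path_in_less G F (path_to G v Q) (path_to G v R) \<and>
        path_out_less G F (path_from G v R) (path_from G v Q))"

definition coherent ::
    "('v, 'e) pre_digraph \<Rightarrow> 'v \<Rightarrow> 'v \<Rightarrow> ('v, 'e) framing \<Rightarrow> 'e list \<Rightarrow> 'e list \<Rightarrow> bool" where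
  "coherent G s t F R Q \<longleftrightarrow>
     (\<forall>v\<in>inner_verts G s t.
        v \<in> set (pre_digraph.awalk_verts G s R) \<and> v \<in> set (pre_digraph.awalk_verts G s Q)
        \<longrightarrow> coherent_at G F v R Q)"

definition clique :: "('v, 'e) pre_digraph \<Rightarrow> 'v \<Rightarrow> 'v \<Rightarrow> ('v, 'e) framing \<Rightarrow> 'e list set \<Rightarrow> bool" where
  "clique G s t F C \<longleftrightarrow> C \<subseteq> routes G s t \<and> (\<forall>R\<in>C. \<forall>Q\<in>C. coherent G s t F R Q)"

definition maximal_clique ::
    "('v, 'e) pre_digraph \<Rightarrow> 'v \<Rightarrow> 'v \<Rightarrow> ('v, 'e) framing \<Rightarrow> 'e list set \<Rightarrow> bool" where
  "maximal_clique G s t F C \<longleftrightarrow>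
     clique G s t F C \<and> (\<forall>C'. clique G s t F C' \<and> C \<subseteq> C' \<longrightarrow> C' = C)"

definition framed_triangulation ::
    "('v, 'e::finite) pre_digraph \<Rightarrow> 'v \<Rightarrow> 'v \<Rightarrow> ('v, 'e) framing \<Rightarrow> (real ^ 'e) set set" where
  "framed_triangulation G s t F =
     {convex hull (route_vec ` C) | C. maximal_clique G s t F C}"


section \<open>Triangulations, given by their top-dimensional simplices\<close>

definition triangulation_of :: "'a::euclidean_space set \<Rightarrow> 'a set set \<Rightarrow> bool" where
  "triangulation_of P T \<longleftrightarrow> triangulation T \<and> \<Union> T = P \<and> (\<forall>S\<in>T. aff_dim P simplex S)"

text \<open>
  Lower faces of a polytope in \<open>'a \<times> real\<close>, where the second component is the height: the faces on
  which a linear functional with positive height coefficient (scaled to 1) is minimal.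
\<close>

definition lower_face :: "('a::euclidean_space \<times> real) set \<Rightarrow> ('a \<times> real) set \<Rightarrow> bool" where
  "lower_face L F \<longleftrightarrow>
     (\<exists>c. F = {z \<in> L. \<forall>w\<in>L. c \<bullet> fst z + snd z \<le> c \<bullet> fst w + snd w})"

definition regular_subdivision :: "'a::euclidean_space set \<Rightarrow> ('a \<Rightarrow> real) \<Rightarrow> 'a set set" where
  "regular_subdivision A \<omega> =
     {fst ` F | F. lower_face (convex hull ((\<lambda>v. (v, \<omega> v)) ` A)) F \<and> aff_dim (fst ` F) = aff_dim A}"

definition regular_triangulation :: "'a::euclidean_space set \<Rightarrow> 'a set set \<Rightarrow> bool" where
  "regular_triangulation P T \<longleftrightarrow>
     triangulation_of P T \<and> (\<exists>\<omega>. T = regular_subdivision {v. v extreme_point_of P} \<omega>)"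

text \<open>
  \<open>\<Lambda>\<close> is an affine lattice; the edge vectors at a vertex \<open>v\<^sub>0\<close> of a unimodular simplex form a
  \<open>\<int>\<close>-basis of the lattice \<open>\<Lambda> - v\<^sub>0\<close>.
\<close>

definition unimodular_simplex :: "'a::euclidean_space set \<Rightarrow> 'a set \<Rightarrow> bool" where
  "unimodular_simplex \<Lambda> S \<longleftrightarrow>
     (\<exists>C. \<not> affine_dependent C \<and> C \<subseteq> \<Lambda> \<and> S = convex hull C \<and>
        (\<exists>v\<^sub>0\<in>C. (\<lambda>x. x - v\<^sub>0) ` \<Lambda> =
           range (\<lambda>k :: 'a \<Rightarrow> int. \<Sum>v\<in>C - {v\<^sub>0}. of_int (k v) *\<^sub>R (v - v\<^sub>0))))"

definition integer_points :: "(real ^ 'n) set" where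
  "integer_points = {x. \<forall>i. x $ i \<in> \<int>}"

definition unimodular_triangulation :: "(real ^ 'n) set \<Rightarrow> (real ^ 'n) set set \<Rightarrow> bool" where
  "unimodular_triangulation P T \<longleftrightarrow>
     triangulation_of P T \<and> (\<forall>S\<in>T. unimodular_simplex (integer_points \<inter> affine hull P) S)"

definition dual_graph :: "'a::euclidean_space set set \<Rightarrow> 'a set pair_pre_digraph" where
  "dual_graph T =
     \<lparr> pverts = T,
       parcs = {(S, S'). S \<in> T \<and> S' \<in> T \<and> S \<noteq> S' \<and> (\<exists>F. F facet_of S \<and> F facet_of S')} \<rparr>"


section \<open>The caracol graph and its length framing\<close>

text \<open>
  An edge is a triple (tail, head, label); the label numbers the copies of a multiedge.
  The values \<open>\<nu> 1, \<dots>, \<nu> a\<close> are the only ones that matter.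
\<close>

type_synonym edge = "nat \<times> nat \<times> nat"

definition car_edges :: "nat \<Rightarrow> (nat \<Rightarrow> nat) \<Rightarrow> edge set" where
  "car_edges a \<nu> =
     {(1, i + 2, k) | i k. i \<in> {1..a} \<and> k \<in> {1..\<nu> i}} \<union>
     {(i, a + 3, 1) | i. i \<in> {2..a + 1}} \<union>
     {(i, i + 1, 1) | i. i \<in> {1..a + 2}}"

text \<open>
  The ambient space of the flow polytope has one coordinate per edge, so the edges are indexed by
  a finite type \<open>'e\<close> by means of a bijection \<open>\<epsilon>\<close> from \<open>'e\<close> to \<open>car_edges a \<nu>\<close>.
\<close>

definition caracol :: "nat \<Rightarrow> ('e \<Rightarrow> edge) \<Rightarrow> (nat, 'e) pre_digraph" where
  "caracol a \<epsilon> =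
     \<lparr> verts = {1..a + 3}, arcs = UNIV, tail = (\<lambda>e. fst (\<epsilon> e)), head = (\<lambda>e. fst (snd (\<epsilon> e))) \<rparr>"

definition edge_length :: "edge \<Rightarrow> nat" where
  "edge_length = (\<lambda>(i, j, k). j - i)"

definition edge_label :: "edge \<Rightarrow> nat" where
  "edge_label = (\<lambda>(i, j, k). k)"

text \<open>Two incoming (or two outgoing) edges of the same length at a vertex are parallel.\<close>

definition length_less :: "edge \<Rightarrow> edge \<Rightarrow> bool" where
  "length_less e f \<longleftrightarrow>
     edge_length e > edge_length f \<or> edge_length e = edge_length f \<and> edge_label e < edge_label f"

definition length_framing :: "('e \<Rightarrow> edge) \<Rightarrow> (nat, 'e) framing" where
  "length_framing \<epsilon> =
     \<lparr> in_less = (\<lambda>v e f. length_less (\<epsilon> e) (\<epsilon> f)), out_less = (\<lambda>v e f. length_less (\<epsilon> e) (\<epsilon> f)) \<rparr>"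

lemma is_framing_length_framing:
  assumes "bij_betw \<epsilon> UNIV (car_edges a \<nu>)"
  shows "is_framing (caracol a \<epsilon>) 1 (a + 3) (length_framing \<epsilon>)"
proof -
  have lt: "fst (\<epsilon> e) < fst (snd (\<epsilon> e))" for e
  proof -
    have "\<epsilon> e \<in> car_edges a \<nu>"
      using bij_betwE[OF assms] by blast
    then show ?thesis
      by (auto simp: car_edges_def)
  qed
  have inj: "inj \<epsilon>"
    using assms by (simp add: bij_betw_def)
  have eq: "e = f"
    if "edge_length (\<epsilon> e) = edge_length (\<epsilon> f)" "edge_label (\<epsilon> e) = edge_label (\<epsilon> f)"
      "fst (\<epsilon> e) = fst (\<epsilon> f) \<or> fst (snd (\<epsilon> e)) = fst (snd (\<epsilon> f))" for e f
  proof -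
    have "\<epsilon> e = \<epsilon> f"
      using that lt[of e] lt[of f]
      by (cases "\<epsilon> e"; cases "\<epsilon> f") (auto simp: edge_length_def edge_label_def)
    then show ?thesis using inj by (simp add: inj_eq)
  qed
  have tot: "length_less (\<epsilon> e) (\<epsilon> f) \<or> length_less (\<epsilon> f) (\<epsilon> e)"
    if "e \<noteq> f" "fst (\<epsilon> e) = fst (\<epsilon> f) \<or> fst (snd (\<epsilon> e)) = fst (snd (\<epsilon> f))" for e f
    using eq[of e f] that unfolding length_less_def by (meson linorder_neqE_nat)
  show ?thesis
    unfolding is_framing_def strict_linear_on_def length_framing_def
    by (auto simp: irreflp_on_def transp_on_def totalp_on_def in_arcs_def out_arcs_def caracol_def
        tot) (auto simp: length_less_def)
qed

definition car_flow_polytope :: "nat \<Rightarrow> ('e::finite \<Rightarrow> edge) \<Rightarrow> (real ^ 'e) set" where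
  "car_flow_polytope a \<epsilon> = flow_polytope (caracol a \<epsilon>) 1 (a + 3)"

definition length_framed_triangulation :: "nat \<Rightarrow> ('e::finite \<Rightarrow> edge) \<Rightarrow> (real ^ 'e) set set" where
  "length_framed_triangulation a \<epsilon> =
     framed_triangulation (caracol a \<epsilon>) 1 (a + 3) (length_framing \<epsilon>)"


section \<open>The Tamari lattice of a lattice path\<close>

datatype step = North | East

definition nu_path :: "nat \<Rightarrow> (nat \<Rightarrow> nat) \<Rightarrow> step list" where
  "nu_path a \<nu> = concat (map (\<lambda>i. North # replicate (\<nu> i) East) [1..<a + 1])"

definition endpoint :: "step list \<Rightarrow> nat \<times> nat" where
  "endpoint p = (count_list p East, count_list p North)"

definition points :: "step list \<Rightarrow> (nat \<times> nat) set" where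
  "points p = {endpoint (take k p) | k. k \<le> length p}"

definition point_above :: "step list \<Rightarrow> nat \<times> nat \<Rightarrow> bool" where
  "point_above p x \<longleftrightarrow> (\<exists>y\<in>points p. fst y = fst x \<and> snd y \<le> snd x)"

definition dyck_paths :: "step list \<Rightarrow> step list set" where
  "dyck_paths p = {m. endpoint m = endpoint p \<and> (\<forall>x\<in>points m. point_above p x)}"

definition horiz :: "step list \<Rightarrow> nat \<times> nat \<Rightarrow> nat" where
  "horiz p x = Max {h. point_above p (fst x + h, snd x)}"

text \<open>
  The valley is the endpoint of \<open>A @ [East]\<close>, and \<open>M\<close> is the subpath from there to the first later
  point with the same value of \<open>horiz\<close>.
\<close>

definition rotation :: "step list \<Rightarrow> step list \<Rightarrow> step list \<Rightarrow> bool" where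
  "rotation p m m' \<longleftrightarrow>
     m \<in> dyck_paths p \<and> m' \<in> dyck_paths p \<and>
     (\<exists>A M B. m = A @ [East] @ M @ B \<and> M \<noteq> [] \<and> hd M = North \<and>
        horiz p (endpoint (A @ [East] @ M)) = horiz p (endpoint (A @ [East])) \<and>
        (\<forall>k. 0 < k \<and> k < length M \<longrightarrow>
           horiz p (endpoint (A @ [East] @ take k M)) \<noteq> horiz p (endpoint (A @ [East]))) \<and>
        m' = A @ M @ [East] @ B)"

definition tamari_le :: "step list \<Rightarrow> step list \<Rightarrow> step list \<Rightarrow> bool" where
  "tamari_le p = (rotation p)\<^sup>*\<^sup>*"

definition hasse_diagram :: "'a set \<Rightarrow> ('a \<Rightarrow> 'a \<Rightarrow> bool) \<Rightarrow> 'a pair_pre_digraph" where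
  "hasse_diagram A le =
     \<lparr> pverts = A,
       parcs = {(x, y). x \<in> A \<and> y \<in> A \<and> le x y \<and> x \<noteq> y \<and>
                        (\<forall>z\<in>A. le x z \<and> le z y \<longrightarrow> z = x \<or> z = y)} \<rparr>"

definition tamari_hasse :: "step list \<Rightarrow> step list pair_pre_digraph" where
  "tamari_hasse p = hasse_diagram (dyck_paths p) (tamari_le p)"

end

theory Submission
  imports Defs
begin

text \<open>
  A route consists of an edge leaving the source, a stretch of the spine and an edge into the sink. Numbering
  the first edges by columns and the last ones by rows identifies routes with the lattice points weakly
  above \<open>\<nu>\<close> in the rectangle, and two routes are incoherent exactly if one point is strictly northeast
  of the other and the lower right corner of their rectangle also lies above \<open>\<nu>\<close>. The indicator
  vector of the route \<open>(x, y)\<close> has the form \<open>\<alpha> x + \<beta> y\<close>.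

  A nonnegative combination supported on a clique is determined by its row and column sums, and every flow has
  one, found greedily; this gives the triangulation. A clique always has a cell that is alone in its row or
  column, so integral row and column sums force integral coefficients, which gives unimodularity. Lifting
  \<open>(x, y)\<close> to height \<open>x y\<close> gives regularity, since exchanging a crossing pair for the two other corners
  of its rectangle strictly lowers the total height.

  Recording for each row of a maximal clique the number of its cells minus one gives a bijection to
  \<open>\<nu>\<close>-Dyck paths. Replacing one cell of a maximal clique by another one moves one east step to a
  different row, and these moves are exactly the rotations and their inverses.
\<close>

section \<open>Noncrossing sets of cells\<close>

text \<open>All the geometry runs through marginals. A combination of route vectors depends only on
  its column and row sums, because \<open>vec (x, y)\<close> splits into a column part and a row
  part, and these sums are coordinates of the resulting flow, namely those of the first and last
  edges. So each statement about simplices becomes one about nonnegative matrices on the cells with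
  given marginals and noncrossing support.

  On the combinatorial side the obstacle is that maximality quantifies over all larger sets. It is
  replaced by a count: reading the rows as operations on a stack shows that every maximal set has
  \<open>N a + a + 1\<close> cells, and sets of that size are recognised as maximal.

  Cliques and paths are compared through one number per row, the slack. Below the top row it is, for
  a clique, one less than the number of open columns, and for a path \<open>horiz\<close> at the
  last point of the row. Swaps and rotations both move an east step up to the first row where slack
  is back to at most its starting value. As the order is only generated by rotations, it must also
  be shown that no rotation is a composite of others; partial sums, which never increase, serve for
  this.\<close>

lemma sum_decrease_at:
  fixes f :: "nat \<Rightarrow> real"
  shows "(\<Sum>i\<le>m. (f(j := f j - t)) i) = (\<Sum>i\<le>m. f i) - (if j \<le> m then t else 0)"
proof -
  have "(f(j := f j - t)) i = f i - (if i = j then t else 0)" for i by simp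
  then show ?thesis by (simp add: sum_subtractf)
qed

text \<open>Upward closed subsets of a common set of numbers are nested, so their size determines
  them. This recovers a row of a maximal set from its number of cells.\<close>

lemma upward_closed_eq:
  fixes X Y A :: "nat set"
  assumes "finite X" "finite Y" "card X = card Y" "X \<subseteq> A" "Y \<subseteq> A"
    and "\<And>x z. x \<in> X \<Longrightarrow> z \<in> A \<Longrightarrow> x < z \<Longrightarrow> z \<in> X"
    and "\<And>x z. x \<in> Y \<Longrightarrow> z \<in> A \<Longrightarrow> x < z \<Longrightarrow> z \<in> Y"
  shows "X = Y"
proof -
  have "X \<subseteq> Y \<or> Y \<subseteq> X"
  proof (rule ccontr)
    assume "\<not> (X \<subseteq> Y \<or> Y \<subseteq> X)"
    then obtain x z where "x \<in> X" "x \<notin> Y" "z \<in> Y" "z \<notin> X" by blast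
    moreover from this have "x < z \<or> z < x" by (metis linorder_neqE_nat)
    ultimately show False using assms(4-7) by blast
  qed
  then show ?thesis using assms(1-3) by (metis card_subset_eq)
qed

text \<open>
  \<open>N y\<close> is the abscissa of the last point of \<open>\<nu>\<close> at height \<open>y\<close>, so the cells are the lattice points of
  the rectangle that lie weakly above \<open>\<nu>\<close>. Two cells cross if one is strictly northeast of the other and
  the lower right corner of the rectangle they span is a cell too.
\<close>

locale staircase =
  fixes a :: nat and N :: "nat \<Rightarrow> nat"
  assumes N_mono: "i \<le> j \<Longrightarrow> N i \<le> N j" and N_0: "N 0 = 0"
begin

definition cells :: "(nat \<times> nat) set" where
  "cells = {(x, y). y \<le> a \<and> x \<le> N y}"

definition noncrossing :: "(nat \<times> nat) set \<Rightarrow> bool" where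
  "noncrossing C \<longleftrightarrow> C \<subseteq> cells \<and>
     (\<forall>x y x' y'. (x, y) \<in> C \<and> (x', y') \<in> C \<and> x < x' \<and> y < y' \<longrightarrow> N y < x')"

definition maximal :: "(nat \<times> nat) set \<Rightarrow> bool" where
  "maximal C \<longleftrightarrow> noncrossing C \<and> (\<forall>D. noncrossing D \<and> C \<subseteq> D \<longrightarrow> D = C)"

lemma finite_cells: "finite cells"
proof -
  have "cells \<subseteq> {..N a} \<times> {..a}"
    using N_mono by (force simp: cells_def)
  then show ?thesis
    by (rule finite_subset) simp
qed

lemma cells_iff [simp]: "(x, y) \<in> cells \<longleftrightarrow> y \<le> a \<and> x \<le> N y"
  by (simp add: cells_def)

lemma noncrossing_cells: "noncrossing C \<Longrightarrow> (x, y) \<in> C \<Longrightarrow> y \<le> a \<and> x \<le> N y"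
  unfolding noncrossing_def cells_def by blast

lemma noncrossing_bounds: "noncrossing C \<Longrightarrow> (x, y) \<in> C \<Longrightarrow> y \<le> a \<and> x \<le> N a"
  using noncrossing_cells N_mono by (meson le_trans)

lemma noncrossingD:
  "noncrossing C \<Longrightarrow> (x, y) \<in> C \<Longrightarrow> (x', y') \<in> C \<Longrightarrow> x < x' \<Longrightarrow> y < y' \<Longrightarrow> N y < x'"
  unfolding noncrossing_def by blast

lemma noncrossing_subset: "noncrossing C \<Longrightarrow> D \<subseteq> C \<Longrightarrow> noncrossing D"
  unfolding noncrossing_def by blast

lemma noncrossing_finite: "noncrossing C \<Longrightarrow> finite C"
  using finite_cells finite_subset unfolding noncrossing_def by blast

lemma noncrossing_insert:
  assumes "noncrossing C" "y \<le> a" "x \<le> N y"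
    and "\<And>p q. (p, q) \<in> C \<Longrightarrow> p < x \<Longrightarrow> q < y \<Longrightarrow> x \<le> N q \<Longrightarrow> False"
    and "\<And>p q. (p, q) \<in> C \<Longrightarrow> x < p \<Longrightarrow> y < q \<Longrightarrow> p \<le> N y \<Longrightarrow> False"
  shows "noncrossing (insert (x, y) C)"
  unfolding noncrossing_def
proof (intro conjI allI impI)
  show "insert (x, y) C \<subseteq> cells"
    using assms(1-3) by (auto simp: noncrossing_def)
  fix p q p' q'
  assume *: "(p, q) \<in> insert (x, y) C \<and> (p', q') \<in> insert (x, y) C \<and> p < p' \<and> q < q'"
  show "N q < p'"
  proof (rule ccontr)
    assume "\<not> N q < p'"
    then show False
      using * assms(4)[of p q] assms(5)[of p' q'] noncrossingD[OF assms(1), of p q p' q'] by auto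
  qed
qed

lemma maximal_insertD:
  assumes "maximal C" "y \<le> a" "x \<le> N y"
    and "\<And>p q. (p, q) \<in> C \<Longrightarrow> p < x \<Longrightarrow> q < y \<Longrightarrow> x \<le> N q \<Longrightarrow> False"
    and "\<And>p q. (p, q) \<in> C \<Longrightarrow> x < p \<Longrightarrow> y < q \<Longrightarrow> p \<le> N y \<Longrightarrow> False"
  shows "(x, y) \<in> C"
proof -
  have "noncrossing (insert (x, y) C)"
    using assms by (intro noncrossing_insert) (auto simp: maximal_def)
  then show ?thesis
    using assms(1) unfolding maximal_def by blast
qed

text \<open>With cells as edges between columns and rows, C is a forest, and this is a leaf. In the
  lowest row either there is only one cell, or a cell with another one to its left is alone in its
  column, since a higher cell of that column would cross the left one.\<close>

lemma noncrossing_leaf: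
  assumes "noncrossing C" "C \<noteq> {}"
  obtains l where "l \<in> C" "(\<forall>p\<in>C. fst p = fst l \<longrightarrow> p = l) \<or> (\<forall>p\<in>C. snd p = snd l \<longrightarrow> p = l)"
proof -
  have fin: "finite C" using assms noncrossing_finite by blast
  define y0 where "y0 = Min (snd ` C)"
  have y0: "y0 \<in> snd ` C" "\<And>p. p \<in> C \<Longrightarrow> y0 \<le> snd p"
    using fin assms by (auto simp: y0_def)
  then obtain x0 where x0: "(x0, y0) \<in> C" by force
  show thesis
  proof (cases "\<forall>p\<in>C. snd p = y0 \<longrightarrow> p = (x0, y0)")
    case True
    then show thesis by (intro that[OF x0] disjI2) simp
  next
    case False
    then obtain x1 where x1: "(x1, y0) \<in> C" "x1 \<noteq> x0" by force
    obtain p q where pq: "(p, y0) \<in> C" "(q, y0) \<in> C" "p < q"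
      using x0 x1 by (metis linorder_neqE_nat)
    have "r = (q, y0)" if r: "r \<in> C" "fst r = q" for r
    proof (rule ccontr)
      assume "r \<noteq> (q, y0)"
      then obtain y where "(q, y) \<in> C" "y \<noteq> y0" using r by (metis prod.collapse)
      then have "(q, y) \<in> C" "y0 < y" using y0(2)[of "(q, y)"] by auto
      then have "N y0 < q" using noncrossingD assms(1) pq by blast
      moreover have "q \<le> N y0" using noncrossing_cells assms(1) pq(2) by blast
      ultimately show False by simp
    qed
    then show thesis by (intro that[OF pq(2)] disjI1) simp
  qed
qed

text \<open>The coefficient of a leaf is a full row or column sum, and deleting the leaf changes the
  other sums by elements of H. With H = {0} this gives independence of the vectors, with the
  integers unimodularity.\<close>

lemma marginals_subgroup:
  fixes c :: "nat \<times> nat \<Rightarrow> 'b::ab_group_add"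
  assumes "noncrossing C" "0 \<in> H" "\<And>r s. r \<in> H \<Longrightarrow> s \<in> H \<Longrightarrow> r - s \<in> H"
    and "\<And>x. (\<Sum>p\<in>{p\<in>C. fst p = x}. c p) \<in> H"
    and "\<And>y. (\<Sum>p\<in>{p\<in>C. snd p = y}. c p) \<in> H"
  shows "\<forall>p\<in>C. c p \<in> H"
proof -
  have "finite C" using assms(1) noncrossing_finite by blast
  then show ?thesis using assms
  proof (induction C rule: finite_psubset_induct)
    case (psubset C)
    show ?case
    proof (cases "C = {}")
      case False
      obtain l where l: "l \<in> C"
        "(\<forall>p\<in>C. fst p = fst l \<longrightarrow> p = l) \<or> (\<forall>p\<in>C. snd p = snd l \<longrightarrow> p = l)"
        using noncrossing_leaf psubset.prems(1) False by blast
      have "{p\<in>C. fst p = fst l} = {l} \<or> {p\<in>C. snd p = snd l} = {l}"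
        using l by blast
      then have cl: "c l \<in> H"
        using psubset.prems(4)[of "fst l"] psubset.prems(5)[of "snd l"] by auto
      have rem: "(\<Sum>p\<in>{p\<in>C - {l}. P p}. c p) \<in> H" if "(\<Sum>p\<in>{p\<in>C. P p}. c p) \<in> H" for P
      proof (cases "P l")
        case True
        then have "(\<Sum>p\<in>{p\<in>C - {l}. P p}. c p) = (\<Sum>p\<in>{p\<in>C. P p}. c p) - c l"
        proof -
          have "{p\<in>C - {l}. P p} = {p\<in>C. P p} - {l}" by auto
          then show ?thesis using True l(1) psubset.hyps by (simp add: sum_diff1)
        qed
        then show ?thesis using that cl psubset.prems(3) by simp
      next
        case False
        then have "{p\<in>C - {l}. P p} = {p\<in>C. P p}" by auto
        then show ?thesis using that by simp
      qed
      have "\<forall>p\<in>C - {l}. c p \<in> H"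
      proof (rule psubset.IH)
        show "noncrossing (C - {l})"
          using psubset.prems(1) by (rule noncrossing_subset) simp
      next
        show "C - {l} \<subset> C" using l(1) by blast
      next
        show "(\<Sum>p\<in>{p\<in>C - {l}. fst p = x}. c p) \<in> H" for x
          using rem[OF psubset.prems(4)] .
        show "(\<Sum>p\<in>{p\<in>C - {l}. snd p = y}. c p) \<in> H" for y
          using rem[OF psubset.prems(5)] .
      qed (use psubset.prems in blast)+
      then show ?thesis using cl by auto
    qed simp
  qed
qed

text \<open>
  At the lowest row and, in it, the rightmost column where two solutions differ, the one that is smaller
  there has mass further left in the same row and further up in the same column, and these cross.
\<close>

lemma noncrossing_marginals_unique:
  fixes f g :: "nat \<times> nat \<Rightarrow> real"
  assumes C: "noncrossing C" and D: "noncrossing D"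
    and f: "\<And>p. 0 \<le> f p" "\<And>p. p \<notin> C \<Longrightarrow> f p = 0"
    and g: "\<And>p. 0 \<le> g p" "\<And>p. p \<notin> D \<Longrightarrow> g p = 0"
    and cols: "\<And>x. x \<le> N a \<Longrightarrow> (\<Sum>y\<le>a. f (x, y)) = (\<Sum>y\<le>a. g (x, y))"
    and rows: "\<And>y. y \<le> a \<Longrightarrow> (\<Sum>x\<le>N a. f (x, y)) = (\<Sum>x\<le>N a. g (x, y))"
  shows "f = g"
proof -
  \<comment> \<open>General in all the data, so that it also applies with f and g exchanged,
    according to which one is larger at the extremal cell.\<close>
  have key: False
    if "noncrossing C" and "\<And>p. 0 \<le> f p" "\<And>p. p \<notin> C \<Longrightarrow> f p = 0"
      and "\<And>p. 0 \<le> g p" "\<And>p. p \<notin> D \<Longrightarrow> g p = 0"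
      and D: "noncrossing D"
      and cols: "\<And>x. x \<le> N a \<Longrightarrow> (\<Sum>y\<le>a. f (x, y)) = (\<Sum>y\<le>a. g (x, y))"
      and rows: "\<And>y. y \<le> a \<Longrightarrow> (\<Sum>x\<le>N a. f (x, y)) = (\<Sum>x\<le>N a. g (x, y))"
      and below: "\<And>x j. j < y \<Longrightarrow> f (x, j) = g (x, j)"
      and max: "\<And>x. x1 < x \<Longrightarrow> f (x, y) = g (x, y)"
      and gt: "f (x1, y) > g (x1, y)"
    for f g :: "nat \<times> nat \<Rightarrow> real" and C D x1 y
  proof -
    have "(x1, y) \<in> C" using that(3)[of "(x1, y)"] that(4)[of "(x1, y)"] gt by fastforce
    then have x1: "y \<le> a" "x1 \<le> N y" "x1 \<le> N a"
      using noncrossing_cells noncrossing_bounds that(1) by blast+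
    have "\<exists>x\<le>N a. f (x, y) < g (x, y)"
    proof (rule ccontr)
      assume "\<not> ?thesis"
      then have "\<forall>x\<in>{..N a}. g (x, y) \<le> f (x, y)" by (auto simp: not_less)
      then have "(\<Sum>x\<le>N a. g (x, y)) < (\<Sum>x\<le>N a. f (x, y))"
        using gt x1 by (intro sum_strict_mono_ex1 bexI[of _ x1]) auto
      then show False using rows x1 by simp
    qed
    then obtain x0 where x0: "f (x0, y) < g (x0, y)" by blast
    then have "x0 < x1" using max[of x0] gt by (cases x0 x1 rule: linorder_cases) auto
    have "\<exists>j\<le>a. f (x1, j) < g (x1, j)"
    proof (rule ccontr)
      assume "\<not> ?thesis"
      then have "\<forall>j\<in>{..a}. g (x1, j) \<le> f (x1, j)" by (auto simp: not_less)
      then have "(\<Sum>j\<le>a. g (x1, j)) < (\<Sum>j\<le>a. f (x1, j))"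
        using gt x1 by (intro sum_strict_mono_ex1 bexI[of _ y]) auto
      then show False using cols x1 by simp
    qed
    then obtain j where j: "f (x1, j) < g (x1, j)" by blast
    then have "y < j" using below[of j x1] gt by (cases j y rule: linorder_cases) auto
    have "(x0, y) \<in> D"
      using x0 that(2)[of "(x0, y)"] that(5)[of "(x0, y)"] by fastforce
    moreover have "(x1, j) \<in> D"
      using j that(2)[of "(x1, j)"] that(5)[of "(x1, j)"] by fastforce
    ultimately show False
      using noncrossingD[OF D _ _ \<open>x0 < x1\<close> \<open>y < j\<close>] x1 by simp
  qed
  have "\<forall>x. f (x, y) = g (x, y)" for y
  proof (induction y rule: less_induct)
    case (less y)
    show ?case
    proof (rule ccontr)
      assume ne: "\<not> (\<forall>x. f (x, y) = g (x, y))"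
      define A where "A = {x. f (x, y) \<noteq> g (x, y)}"
      have "A \<noteq> {}" using ne by (auto simp: A_def)
      have "x \<le> N a" if "x \<in> A" for x
      proof -
        have "(x, y) \<in> C \<or> (x, y) \<in> D"
          using that f(2)[of "(x, y)"] g(2)[of "(x, y)"] unfolding A_def by fastforce
        then show ?thesis
          using noncrossing_bounds[OF C, of x y] noncrossing_bounds[OF D, of x y] by blast
      qed
      then have "A \<subseteq> {..N a}" by auto
      then have "finite A" using finite_subset by blast
      define x1 where "x1 = Max A"
      have x1: "f (x1, y) \<noteq> g (x1, y)" "\<And>x. x1 < x \<Longrightarrow> f (x, y) = g (x, y)"
        using Max_in[OF \<open>finite A\<close> \<open>A \<noteq> {}\<close>] Max_ge[OF \<open>finite A\<close>] unfolding x1_def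
        by (auto simp: A_def not_le[symmetric])
      consider "f (x1, y) > g (x1, y)" | "g (x1, y) > f (x1, y)" using x1 by linarith
      then show False
      proof cases
        case 1
        show False by (rule key[of C f g D y x1]) (use C D f g cols rows x1(2) less 1 in \<open>simp_all\<close>)
      next
        case 2
        show False by (rule key[of D g f C y x1]) (use C D f g cols rows x1(2) less 2 in \<open>simp_all\<close>)
      qed
    qed
  qed
  then show ?thesis by (auto simp: fun_eq_iff)
qed


text \<open>
  Greedy choice: serve the rows from the bottom up, each one from the rightmost column available.
\<close>

lemma noncrossing_transport_exists:
  fixes u w :: "nat \<Rightarrow> real"
  assumes "\<And>x. 0 \<le> u x" "\<And>y. 0 \<le> w y"
    and "(\<Sum>x\<le>N a. u x) = (\<Sum>y\<le>a. w y)"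
    and "\<And>k. k \<le> a \<Longrightarrow> (\<Sum>y\<le>k. w y) \<le> (\<Sum>x\<le>N k. u x)"
  shows "\<exists>f. (\<forall>p. 0 \<le> f p) \<and> noncrossing {p. f p \<noteq> 0} \<and>
     (\<forall>x\<le>N a. (\<Sum>y\<le>a. f (x, y)) = u x) \<and> (\<forall>y\<le>a. (\<Sum>x\<le>N a. f (x, y)) = w y)"
  using assms
proof (induction "card {x\<in>{..N a}. u x \<noteq> 0} + card {y\<in>{..a}. w y \<noteq> 0}" arbitrary: u w rule: less_induct)
  case less
  show ?case
  proof (cases "\<forall>y\<le>a. w y = 0")
    case True
    then have "(\<Sum>x\<le>N a. u x) = 0" using less.prems(3) by simp
    then have "\<forall>x\<le>N a. u x = 0" using less.prems(1) by (simp add: sum_nonneg_eq_0_iff)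
    then show ?thesis using True by (intro exI[of _ "\<lambda>_. 0"]) (simp add: noncrossing_def)
  next
    case False
    define y0 where "y0 = (LEAST y. y \<le> a \<and> w y \<noteq> 0)"
    have y0: "y0 \<le> a" "w y0 \<noteq> 0"
      using LeastI_ex[of "\<lambda>y. y \<le> a \<and> w y \<noteq> 0"] False unfolding y0_def by auto
    have y0_min: "w y = 0" if "y < y0" for y
      using not_less_Least[of y "\<lambda>y. y \<le> a \<and> w y \<noteq> 0"] that y0(1) unfolding y0_def by auto
    have "w y0 > 0" using y0 less.prems(2)[of y0] by simp
    also have "w y0 \<le> (\<Sum>y\<le>y0. w y)"
      using less.prems(2) by (intro member_le_sum) auto
    also have "\<dots> \<le> (\<Sum>x\<le>N y0. u x)" using less.prems(4) y0(1) .
    finally have "\<exists>x\<in>{..N y0}. u x \<noteq> 0" by (metis less_irrefl sum.neutral)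
    define A where "A = {x\<in>{..N y0}. u x \<noteq> 0}"
    define x0 where "x0 = Max A"
    have A: "finite A" "A \<noteq> {}" using \<open>\<exists>x\<in>_. _\<close> by (auto simp: A_def)
    have x0: "x0 \<le> N y0" "u x0 \<noteq> 0"
      using Max_in[OF A] by (auto simp: x0_def A_def)
    have x0_max: "u x = 0" if "x0 < x" "x \<le> N y0" for x
    proof -
      have "x \<notin> A" using Max_ge[OF A(1), of x] that(1) by (auto simp: x0_def)
      then show ?thesis using that(2) by (simp add: A_def)
    qed
    have u0: "u x0 > 0" using x0 less.prems(1)[of x0] by simp
    have x0a: "x0 \<le> N a" using x0(1) N_mono[OF y0(1)] by simp
    \<comment> \<open>This uses up the column or the row, so the number of nonzero entries
      drops.\<close>
    define t where "t = min (u x0) (w y0)"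
    have t: "t > 0" "t \<le> u x0" "t \<le> w y0" using u0 \<open>w y0 > 0\<close> by (auto simp: t_def)
    define u' where "u' = u(x0 := u x0 - t)"
    define w' where "w' = w(y0 := w y0 - t)"
    have sub: "{x\<in>{..N a}. u' x \<noteq> 0} \<subseteq> {x\<in>{..N a}. u x \<noteq> 0}"
      "{y\<in>{..a}. w' y \<noteq> 0} \<subseteq> {y\<in>{..a}. w y \<noteq> 0}"
      using x0 y0 by (auto simp: u'_def w'_def)
    have "u' x0 = 0 \<or> w' y0 = 0" by (auto simp: u'_def w'_def t_def)
    then have "{x\<in>{..N a}. u' x \<noteq> 0} \<subset> {x\<in>{..N a}. u x \<noteq> 0} \<or>
        {y\<in>{..a}. w' y \<noteq> 0} \<subset> {y\<in>{..a}. w y \<noteq> 0}"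
      using sub x0 x0a y0 by blast
    then have "card {x\<in>{..N a}. u' x \<noteq> 0} < card {x\<in>{..N a}. u x \<noteq> 0} \<or>
        card {y\<in>{..a}. w' y \<noteq> 0} < card {y\<in>{..a}. w y \<noteq> 0}"
      by (auto intro: psubset_card_mono)
    moreover have "card {x\<in>{..N a}. u' x \<noteq> 0} \<le> card {x\<in>{..N a}. u x \<noteq> 0}"
        "card {y\<in>{..a}. w' y \<noteq> 0} \<le> card {y\<in>{..a}. w y \<noteq> 0}"
      using sub by (auto intro: card_mono)
    ultimately have dec: "card {x\<in>{..N a}. u' x \<noteq> 0} + card {y\<in>{..a}. w' y \<noteq> 0}
        < card {x\<in>{..N a}. u x \<noteq> 0} + card {y\<in>{..a}. w y \<noteq> 0}"
      by linarith
    have su: "(\<Sum>x\<le>m. u' x) = (\<Sum>x\<le>m. u x) - (if x0 \<le> m then t else 0)" for m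
      unfolding u'_def by (rule sum_decrease_at)
    have sw: "(\<Sum>x\<le>m. w' x) = (\<Sum>x\<le>m. w x) - (if y0 \<le> m then t else 0)" for m
      unfolding w'_def by (rule sum_decrease_at)
    have u'0: "0 \<le> u' x" for x using less.prems(1) t by (simp add: u'_def)
    have w'0: "0 \<le> w' x" for x using less.prems(2) t by (simp add: w'_def)
    have "\<exists>f. (\<forall>p. 0 \<le> f p) \<and> noncrossing {p. f p \<noteq> 0} \<and>
     (\<forall>x\<le>N a. (\<Sum>y\<le>a. f (x, y)) = u' x) \<and> (\<forall>y\<le>a. (\<Sum>x\<le>N a. f (x, y)) = w' y)"
    proof (rule less.hyps[OF dec u'0 w'0])
      show "(\<Sum>x\<le>N a. u' x) = (\<Sum>y\<le>a. w' y)"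
        using less.prems(3) x0a y0(1) by (simp add: su sw)
      fix k assume k: "k \<le> a"
      show "(\<Sum>y\<le>k. w' y) \<le> (\<Sum>x\<le>N k. u' x)"
      proof (cases "y0 \<le> k")
        case True
        then show ?thesis using less.prems(4)[OF k] t by (simp add: su sw)
      next
        case False
        then have "(\<Sum>y\<le>k. w' y) = 0" using y0_min by (simp add: w'_def)
        then show ?thesis using u'0 by (simp add: sum_nonneg)
      qed
    qed
    then obtain f where f: "\<And>p. 0 \<le> f p" "noncrossing {p. f p \<noteq> 0}"
      "\<And>x. x \<le> N a \<Longrightarrow> (\<Sum>y\<le>a. f (x, y)) = u' x" "\<And>y. y \<le> a \<Longrightarrow> (\<Sum>x\<le>N a. f (x, y)) = w' y"
      by blast
    define g where "g = f((x0, y0) := f (x0, y0) + t)"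
    \<comment> \<open>The rest of the transport uses only rows and columns with mass left. The rows
      below y0 have none, and neither have the columns after x0 up to N y0, so (x0, y0) crosses
      nothing.\<close>
    have pos: "u' p \<noteq> 0" "w' q \<noteq> 0" if "f (p, q) \<noteq> 0" for p q
    proof -
      have b: "q \<le> a" "p \<le> N a" using noncrossing_bounds[OF f(2)] that by auto
      have fp: "f (p, q) > 0" using f(1)[of "(p, q)"] that by simp
      have "f (p, q) \<le> (\<Sum>y\<le>a. f (p, y))"
        using b f(1) by (intro member_le_sum[of q _ "\<lambda>y. f (p, y)"]) auto
      then show "u' p \<noteq> 0" using f(3) b fp by simp
      have "f (p, q) \<le> (\<Sum>x\<le>N a. f (x, q))"
        using b f(1) by (intro member_le_sum[of p _ "\<lambda>x. f (x, q)"]) auto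
      then show "w' q \<noteq> 0" using f(4) b fp by simp
    qed
    have "noncrossing (insert (x0, y0) {p. f p \<noteq> 0})"
    proof (rule noncrossing_insert[OF f(2) y0(1) x0(1)])
      fix p q assume "(p, q) \<in> {p. f p \<noteq> 0}" "q < y0"
      then show False using pos(2)[of p q] y0_min by (simp add: w'_def)
    next
      fix p q assume "(p, q) \<in> {p. f p \<noteq> 0}" "x0 < p" "p \<le> N y0"
      then show False using pos(1)[of p q] x0_max by (simp add: u'_def)
    qed
    then have "noncrossing {p. g p \<noteq> 0}"
      by (rule noncrossing_subset) (auto simp: g_def split: if_splits)
    moreover have "\<forall>p. 0 \<le> g p" using f(1) t by (simp add: g_def)
    moreover have g: "g p = f p + (if p = (x0, y0) then t else 0)" for p by (simp add: g_def)
    have "(\<Sum>y\<le>a. g (x, y)) = u x" if "x \<le> N a" for x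
    proof -
      have "(\<Sum>y\<le>a. g (x, y)) = u' x + (\<Sum>y\<le>a. if y = y0 then (if x = x0 then t else 0) else 0)"
        unfolding g sum.distrib f(3)[OF that] by (intro arg_cong2[where f = plus] sum.cong) auto
      then show ?thesis using y0(1) by (simp add: u'_def)
    qed
    moreover have "(\<Sum>x\<le>N a. g (x, y)) = w y" if "y \<le> a" for y
    proof -
      have "(\<Sum>x\<le>N a. g (x, y)) = w' y + (\<Sum>x\<le>N a. if x = x0 then (if y = y0 then t else 0) else 0)"
        unfolding g sum.distrib f(4)[OF that] by (intro arg_cong2[where f = plus] sum.cong) auto
      then show ?thesis using x0a by (simp add: w'_def)
    qed
    ultimately show ?thesis by blast
  qed
qed

section \<open>Maximal noncrossing sets\<close>

lemma noncrossing_extend: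
  assumes "noncrossing C"
  obtains D where "maximal D" "C \<subseteq> D"
proof -
  let ?S = "{D. noncrossing D \<and> C \<subseteq> D}"
  have "finite ?S"
    by (rule finite_subset[of _ "Pow cells"]) (auto simp: noncrossing_def finite_cells)
  moreover have "C \<in> ?S" using assms by simp
  ultimately obtain D where D: "D \<in> ?S" "\<And>E. E \<in> ?S \<Longrightarrow> D \<subseteq> E \<Longrightarrow> D = E"
    using finite_has_maximal2[of ?S C] by (metis (no_types, lifting))
  have "E = D" if "noncrossing E" "D \<subseteq> E" for E
    using D(2)[of E] D(1) that by auto
  then have "maximal D" using D(1) by (simp add: maximal_def)
  then show thesis using that[of D] D(1) by simp
qed

lemma maximalD: "maximal C \<Longrightarrow> noncrossing C"
  by (simp add: maximal_def)

text \<open>Nothing lies to the left of column 0 or above row a, so this cell crosses no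
  other.\<close>

lemma maximal_corner:
  assumes "maximal C"
  shows "(0, a) \<in> C"
proof (rule maximal_insertD[OF assms])
  fix p q assume "(p, q) \<in> C" "a < q"
  then show False using noncrossing_cells maximalD[OF assms] leD by blast
qed auto

text \<open>A cell to the lower left crossing (x, y) would also cross (x, q), and
  \<open>right\<close> excludes one to the upper right. In the stack picture, the top column can be
  pulled down to row y.\<close>

lemma maximal_row_extend:
  assumes C: "maximal C" and "(x, q) \<in> C" "y < q" "x \<le> N y"
    and right: "\<And>p j. (p, j) \<in> C \<Longrightarrow> y < j \<Longrightarrow> p \<le> N y \<Longrightarrow> p \<le> x"
  shows "(x, y) \<in> C"
proof (rule maximal_insertD[OF C])
  note nc = maximalD[OF C]
  show "y \<le> a" using noncrossing_cells[OF nc assms(2)] assms(3) by simp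
  show "x \<le> N y" by fact
  fix p j assume "(p, j) \<in> C"
  then show "x < p \<Longrightarrow> y < j \<Longrightarrow> p \<le> N y \<Longrightarrow> False"
    using right by (meson leD)
  assume "p < x" "j < y" "x \<le> N j"
  then show False
    using noncrossingD[OF nc \<open>(p, j) \<in> C\<close> assms(2)] assms(3) by linarith
qed

text \<open>Mirror image of \<open>maximal_row_extend\<close>: a cell to the upper right crossing
  (x, y) would also cross (p, y), and \<open>below\<close> excludes one to the lower left.\<close>

lemma maximal_col_extend:
  assumes C: "maximal C" and "(p, y) \<in> C" "p < x" "x \<le> N y"
    and below: "\<And>q j. (q, j) \<in> C \<Longrightarrow> q < x \<Longrightarrow> x \<le> N j \<Longrightarrow> y \<le> j"
  shows "(x, y) \<in> C"
proof (rule maximal_insertD[OF C])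
  note nc = maximalD[OF C]
  show "y \<le> a" using noncrossing_cells[OF nc assms(2)] by simp
  show "x \<le> N y" by fact
  fix q j assume qj: "(q, j) \<in> C"
  then show "q < x \<Longrightarrow> j < y \<Longrightarrow> x \<le> N j \<Longrightarrow> False"
    using below by (meson leD)
  assume "x < q" "y < j" "q \<le> N y"
  then show False
    using noncrossingD[OF nc assms(2) qj] assms(3) by linarith
qed

text \<open>A cell to the left of column x in a row q with x \<le> N q forbids column x above q. If
  this happens in no row below j, then the lowest row from j on with a cell to the left of column x
  extends to the right as far as x.\<close>

lemma maximal_alive:
  assumes C: "maximal C" and "j \<le> a" "x \<le> N j"
    and alive: "\<And>p q. (p, q) \<in> C \<Longrightarrow> p < x \<Longrightarrow> x \<le> N q \<Longrightarrow> j \<le> q"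
  shows "\<exists>i\<ge>j. (x, i) \<in> C"
proof (cases "x = 0")
  case True
  then show ?thesis using maximal_corner[OF C] assms(2) by blast
next
  case False
  let ?P = "\<lambda>i. j \<le> i \<and> (\<exists>p<x. (p, i) \<in> C)"
  define i where "i = (LEAST i. ?P i)"
  have "?P a" using maximal_corner[OF C] False assms(2) by blast
  then have "?P i" unfolding i_def by (rule LeastI)
  then obtain p where p: "j \<le> i" "p < x" "(p, i) \<in> C" by blast
  have "(x, i) \<in> C"
  proof (rule maximal_col_extend[OF C p(3,2)])
    show "x \<le> N i" using assms(3) N_mono[OF p(1)] by simp
    fix q k assume "(q, k) \<in> C" "q < x" "x \<le> N k"
    moreover from this have "j \<le> k" using alive by blast
    ultimately show "i \<le> k" unfolding i_def by (blast intro: Least_le)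
  qed
  then show ?thesis using p(1) by blast
qed

text \<open>In the lowest row that column x reaches, no lower row can have closed it.\<close>

lemma maximal_col_nonempty:
  assumes "maximal C" "x \<le> N a"
  shows "\<exists>y. (x, y) \<in> C"
proof -
  let ?j = "LEAST j. x \<le> N j"
  have "?j \<le> a" "x \<le> N ?j"
    using assms(2) LeastI[of "\<lambda>j. x \<le> N j" a] Least_le[of "\<lambda>j. x \<le> N j" a] by auto
  then show ?thesis
    using maximal_alive[OF assms(1), of ?j x] Least_le[of "\<lambda>j. x \<le> N j"] by blast
qed

text \<open>
  Going up through the rows, the columns behave like a stack: row \<open>y\<close> pushes the columns that begin at
  height \<open>y\<close> and pops all its cells but the leftmost. The open columns are the contents of the stack
  after row \<open>y\<close>, and \<open>east_count\<close> is the number of columns popped.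
\<close>

definition open_cols :: "(nat \<times> nat) set \<Rightarrow> nat \<Rightarrow> nat set" where
  "open_cols C y = {x. x \<le> N y \<and> (\<exists>q>y. (x, q) \<in> C)}"

lemma finite_open_cols [simp]: "finite (open_cols C y)"
  unfolding open_cols_def by simp

lemma zero_open_cols: "maximal C \<Longrightarrow> y < a \<Longrightarrow> 0 \<in> open_cols C y"
  using maximal_corner by (auto simp: open_cols_def)

text \<open>The rightmost open column is not blocked in row y, so it has a cell there. In the top
  row no column is open and the corner cell takes over.\<close>

lemma maximal_row_nonempty:
  assumes C: "maximal C" and "y \<le> a"
  shows "\<exists>x. (x, y) \<in> C"
proof (cases "y = a")
  case True
  then show ?thesis using maximal_corner[OF C] by blast
next
  case False
  then have ne: "open_cols C y \<noteq> {}" using zero_open_cols[OF C, of y] assms(2) by auto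
  define x where "x = Max (open_cols C y)"
  have "x \<in> open_cols C y" unfolding x_def using ne by simp
  then obtain q where q: "x \<le> N y" "(x, q) \<in> C" "y < q" by (auto simp: open_cols_def)
  have "(x, y) \<in> C"
  proof (rule maximal_row_extend[OF C q(2,3,1)])
    fix p j assume "(p, j) \<in> C" "y < j" "p \<le> N y"
    then have "p \<in> open_cols C y" by (auto simp: open_cols_def)
    then show "p \<le> x" unfolding x_def by simp
  qed
  then show ?thesis by blast
qed

definition row :: "(nat \<times> nat) set \<Rightarrow> nat \<Rightarrow> nat set" where
  "row C y = {x. (x, y) \<in> C}"

lemma mem_row [simp]: "x \<in> row C y \<longleftrightarrow> (x, y) \<in> C"
  by (simp add: row_def)

definition left :: "(nat \<times> nat) set \<Rightarrow> nat \<Rightarrow> nat" where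
  "left C y = Min (row C y)"

lemma finite_row: "noncrossing C \<Longrightarrow> finite (row C y)"
  by (rule finite_subset[of _ "{..N y}"]) (use noncrossing_cells in auto)

lemma left_in: "maximal C \<Longrightarrow> y \<le> a \<Longrightarrow> (left C y, y) \<in> C"
  using Min_in[of "row C y"] finite_row[OF maximalD] maximal_row_nonempty
  unfolding left_def by (metis empty_iff mem_row)

lemma left_le: "noncrossing C \<Longrightarrow> (x, y) \<in> C \<Longrightarrow> left C y \<le> x"
  unfolding left_def using finite_row by (intro Min_le) auto

text \<open>A cell that closes column \<open>left C y\<close> by row y would lie to its left. In row
  y there is none by choice, and in a lower row it would cross (left C y, y). Together with
  \<open>open_cols_le_left\<close> this makes \<open>left C y\<close> the top of the stack after row
  y.\<close>

lemma left_open: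
  assumes C: "maximal C" and "y < a"
  shows "left C y \<in> open_cols C y"
proof -
  note nc = maximalD[OF C]
  have l: "(left C y, y) \<in> C" using left_in[OF C] assms(2) by simp
  then have ly: "left C y \<le> N y" using noncrossing_cells[OF nc] by blast
  have "\<exists>i\<ge>Suc y. (left C y, i) \<in> C"
  proof (rule maximal_alive[OF C])
    show "left C y \<le> N (Suc y)" using ly N_mono[of y "Suc y"] by simp
    fix p q assume pq: "(p, q) \<in> C" "p < left C y" "left C y \<le> N q"
    then have "q \<noteq> y" using left_le[OF nc, of p y] by auto
    moreover have "\<not> q < y" using noncrossingD[OF nc pq(1) l pq(2)] pq(3) by linarith
    ultimately show "Suc y \<le> q" by linarith
  qed (use assms(2) in simp)
  then show ?thesis using ly by (auto simp: open_cols_def Suc_le_eq)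
qed

lemma open_cols_le_row:
  assumes "noncrossing C" "(p, y) \<in> C" "x \<in> open_cols C y"
  shows "x \<le> p"
  using assms noncrossingD[OF assms(1,2)] unfolding open_cols_def by force

lemma open_cols_le_left: "maximal C \<Longrightarrow> y \<le> a \<Longrightarrow> x \<in> open_cols C y \<Longrightarrow> x \<le> left C y"
  using open_cols_le_row left_in maximalD by blast

definition east_count :: "(nat \<times> nat) set \<Rightarrow> nat \<Rightarrow> nat" where
  "east_count C y = card (row C y) - 1"

text \<open>A cell above (x, y) would leave x open and hence at most \<open>left C y\<close>, so
  only the leftmost column of the row can continue.\<close>

lemma row_minus_left:
  assumes C: "maximal C" and "y < a"
  shows "row C y - {left C y} = {x. (x, y) \<in> C \<and> (\<forall>q>y. (x, q) \<notin> C)}"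
proof -
  note nc = maximalD[OF C]
  have "\<exists>q>y. (left C y, q) \<in> C" using left_open[OF assms] by (auto simp: open_cols_def)
  moreover have "(x, q) \<notin> C" if "(x, y) \<in> C" "x \<noteq> left C y" "y < q" for x q
  proof
    assume "(x, q) \<in> C"
    then have "x \<in> open_cols C y"
      using that noncrossing_cells[OF nc that(1)] by (auto simp: open_cols_def)
    then show False
      using open_cols_le_left[OF C _, of y x] left_le[OF nc that(1)] assms(2) that(2) by simp
  qed
  ultimately show ?thesis by auto
qed

lemma card_row: "maximal C \<Longrightarrow> y \<le> a \<Longrightarrow> card (row C y) = Suc (east_count C y)"
  using maximal_row_nonempty[of C y] finite_row[OF maximalD, of C y]
  unfolding east_count_def by (metis One_nat_def Suc_pred card_gt_0_iff empty_iff mem_row)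

lemma open_cols_top [simp]: "noncrossing C \<Longrightarrow> open_cols C a = {}"
  using noncrossing_cells by (fastforce simp: open_cols_def)

text \<open>Every column up to N y is nonempty, so either it is still open after row y or its
  topmost cell lies in exactly one row i \<le> y.\<close>

lemma card_open_cols:
  assumes C: "maximal C" and "y \<le> a"
  shows "card (open_cols C y) + (\<Sum>i\<le>y. card {x. (x, i) \<in> C \<and> (\<forall>q>i. (x, q) \<notin> C)}) = Suc (N y)"
proof -
  note nc = maximalD[OF C]
  let ?T = "\<lambda>i. {x. (x, i) \<in> C \<and> (\<forall>q>i. (x, q) \<notin> C)}"
  have fin: "finite (?T i)" for i
    by (rule finite_subset[OF _ finite_row[OF nc, of i]]) auto
  have "{..N y} = open_cols C y \<union> (\<Union>i\<le>y. ?T i)"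
  proof (intro equalityI subsetI)
    fix x assume x: "x \<in> {..N y}"
    let ?K = "{i. (x, i) \<in> C}"
    have K: "finite ?K" "?K \<noteq> {}"
      using noncrossing_cells[OF nc] finite_subset[of ?K "{..a}"]
        maximal_col_nonempty[OF C, of x] x N_mono[OF assms(2)] by auto
    define i where "i = Max ?K"
    have "i \<in> ?K" unfolding i_def by (rule Max_in[OF K])
    then have i: "(x, i) \<in> C" by simp
    moreover have "q \<le> i" if "(x, q) \<in> C" for q
      unfolding i_def using K that by simp
    ultimately have "x \<in> ?T i" by (auto simp: not_le[symmetric])
    then show "x \<in> open_cols C y \<union> (\<Union>i\<le>y. ?T i)"
      using i x by (cases "i \<le> y") (auto simp: open_cols_def not_le)
  next
    fix x assume "x \<in> open_cols C y \<union> (\<Union>i\<le>y. ?T i)"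
    then show "x \<in> {..N y}"
      using noncrossing_cells[OF nc] N_mono by (fastforce simp: open_cols_def)
  qed
  then have "Suc (N y) = card (open_cols C y \<union> (\<Union>i\<le>y. ?T i))"
    by (metis card_atMost)
  also have "\<dots> = card (open_cols C y) + card (\<Union>i\<le>y. ?T i)"
    by (intro card_Un_disjoint) (auto simp: open_cols_def fin)
  also have "card (\<Union>i\<le>y. ?T i) = (\<Sum>i\<le>y. card (?T i))"
  proof (intro card_UN_disjoint ballI impI)
    fix i j :: nat assume "i \<noteq> j"
    then show "?T i \<inter> ?T j = {}" by (cases i j rule: linorder_cases) auto
  qed (use fin in auto)
  finally show ?thesis by simp
qed

lemma card_closed_cols:
  assumes C: "maximal C" and "i < a"
  shows "card {x. (x, i) \<in> C \<and> (\<forall>q>i. (x, q) \<notin> C)} = east_count C i"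
  unfolding row_minus_left[OF assms, symmetric] east_count_def
  using left_in[OF C, of i] assms(2) finite_row[OF maximalD[OF C]]
  by (subst card_Diff_singleton) auto

lemma card_open_cols_east_count:
  assumes C: "maximal C" and "y < a"
  shows "card (open_cols C y) + (\<Sum>i\<le>y. east_count C i) = Suc (N y)"
proof -
  have "(\<Sum>i\<le>y. card {x. (x, i) \<in> C \<and> (\<forall>q>i. (x, q) \<notin> C)}) = (\<Sum>i\<le>y. east_count C i)"
    using card_closed_cols[OF C] assms(2) by (intro sum.cong) auto
  then show ?thesis using card_open_cols[OF C, of y] assms(2) by simp
qed

text \<open>In the top row the leftmost cell ends its column too, so this row closes one column more
  than its \<open>east_count\<close>; this accounts for the \<open>Suc (N a)\<close>
  columns.\<close>

lemma sum_east_count: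
  assumes C: "maximal C"
  shows "(\<Sum>i\<le>a. east_count C i) = N a"
proof -
  note nc = maximalD[OF C]
  have "(x, q) \<notin> C" if "a < q" for x q
    using noncrossing_cells[OF nc, of x q] that by auto
  then have "{x. (x, a) \<in> C \<and> (\<forall>q>a. (x, q) \<notin> C)} = row C a" by auto
  then have "(\<Sum>i\<le>a. card {x. (x, i) \<in> C \<and> (\<forall>q>i. (x, q) \<notin> C)})
      = (\<Sum>i<a. east_count C i) + Suc (east_count C a)"
    using card_closed_cols[OF C] card_row[OF C, of a]
    by (simp add: lessThan_Suc_atMost[symmetric])
  also have "\<dots> = Suc (\<Sum>i\<le>a. east_count C i)"
    by (simp add: lessThan_Suc_atMost[symmetric])
  finally show ?thesis using card_open_cols[OF C, of a] nc by simp
qed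

lemma card_conv_rows:
  assumes "noncrossing C"
  shows "card C = (\<Sum>y\<le>a. card (row C y))"
proof -
  have "C = (\<lambda>(y, x). (x, y)) ` Sigma {..a} (row C)"
    using noncrossing_cells[OF assms] by force
  then have "card C = card (Sigma {..a} (row C))"
    by (metis (no_types, lifting) card_image inj_onI prod.case_eq_if prod.collapse prod.inject)
  then show ?thesis using finite_row[OF assms] by simp
qed

lemma card_maximal:
  assumes "maximal C"
  shows "card C = N a + a + 1"
proof -
  have "card C = (\<Sum>y\<le>a. Suc (east_count C y))"
    using card_conv_rows[OF maximalD[OF assms]] card_row[OF assms] by simp
  then show ?thesis using sum_east_count[OF assms] by (simp add: sum_Suc)
qed

text \<open>Turns maximality into counting. This is how stack sets, swapped sets and the supports of
  full-dimensional lower faces are seen to be maximal.\<close>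

lemma maximalI:
  assumes "noncrossing C" "N a + a + 1 \<le> card C"
  shows "maximal C"
proof -
  obtain D where D: "maximal D" "C \<subseteq> D" using noncrossing_extend[OF assms(1)] .
  have "finite D" using D noncrossing_finite maximalD by blast
  then have "C = D" using D card_maximal[OF D(1)] assms(2) by (simp add: card_seteq)
  then show ?thesis using D by simp
qed

text \<open>
  This is local convexity of the lifting \<open>(x, y) \<mapsto> x y\<close>. A cell outside \<open>C\<close> crosses a cell of \<open>C\<close> that
  can be chosen so that one of the two other corners of their rectangle lies in \<open>C\<close>; the remaining
  corner is further left or further up, which makes the induction work.
\<close>

lemma supermodular_potential:
  fixes f g :: "nat \<Rightarrow> real"
  assumes C: "maximal C"
    and eq: "\<And>x y. (x, y) \<in> C \<Longrightarrow> f x + g y = real x * real y"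
    and "y \<le> a" "x \<le> N y" "(x, y) \<notin> C"
  shows "f x + g y < real x * real y"
  using assms(3-5)
proof (induction "x + (a - y)" arbitrary: x y rule: less_induct)
  case less
  note nc = maximalD[OF C]
  \<comment> \<open>The potential has equal sums over both diagonals of the rectangle, while the
    product has the strictly larger sum over the diagonal through (x, y) and (p, q).\<close>
  have exch: "f x + g y < real x * real y"
    if "f x + g q \<le> real x * real q" "f p + g y \<le> real p * real y" "f p + g q = real p * real q"
      "(real p - real x) * (real q - real y) > 0" for p q
  proof -
    have "(real p - real x) * (real q - real y)
        = real p * real q - real p * real y - real x * real q + real x * real y"
      by (simp add: algebra_simps)
    then show ?thesis using that by linarith
  qed
  have le: "f x + g y \<le> real x * real y" if "y \<le> a" "x \<le> N y"
      "(x, y) \<in> C \<or> f x + g y < real x * real y" for x y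
    using that eq[of x y] by auto
  consider p q where "(p, q) \<in> C" "p < x" "q < y" "x \<le> N q"
    | p q where "(p, q) \<in> C" "x < p" "y < q" "p \<le> N y"
    using maximal_insertD[OF C less.prems(1,2)] less.prems(3) by blast
  then show ?case
  proof cases
    case 1
    let ?P = "\<lambda>q. q < y \<and> x \<le> N q \<and> (\<exists>p<x. (p, q) \<in> C)"
    \<comment> \<open>In the lowest such row the cell extends to the right, so the corner (x, q)
      lies in C and (p, y) is left to the induction.\<close>
    define q where "q = (LEAST q. ?P q)"
    have "?P q" unfolding q_def by (rule LeastI_ex) (use 1 in blast)
    then obtain p where p: "q < y" "x \<le> N q" "p < x" "(p, q) \<in> C" by blast
    have xq: "(x, q) \<in> C"
    proof (rule maximal_col_extend[OF C p(4,3,2)])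
      fix r j assume r: "(r, j) \<in> C" "r < x" "x \<le> N j"
      show "q \<le> j"
      proof (cases "j < y")
        case True
        then show ?thesis unfolding q_def using r by (blast intro: Least_le)
      qed (use p in simp)
    qed
    have py: "p \<le> N y" using p(3) less.prems(2) by simp
    have "(p, y) \<in> C \<or> f p + g y < real p * real y"
    proof -
      have "p + (a - y) < x + (a - y)" using p(3) by linarith
      from less.hyps[OF this less.prems(1) py] show ?thesis by blast
    qed
    then show ?thesis
      using le[OF less.prems(1) py] eq[OF xq] eq[OF p(4)] p
      by (intro exch[of q p]) (auto simp: mult_neg_neg)
  next
    case 2
    \<comment> \<open>The rightmost open column has a cell in row y, so the corner (p, y) lies in C
      and (x, q) is left to the induction.\<close>
    define p where "p = Max (open_cols C y)"
    have ne: "open_cols C y \<noteq> {}" using 2 by (auto simp: open_cols_def)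
    have "p \<in> open_cols C y" unfolding p_def using ne by simp
    then obtain q where q: "p \<le> N y" "(p, q) \<in> C" "y < q" by (auto simp: open_cols_def)
    have max: "r \<le> p" if "(r, j) \<in> C" "y < j" "r \<le> N y" for r j
      unfolding p_def using that by (intro Max_ge) (auto simp: open_cols_def)
    have py: "(p, y) \<in> C" by (rule maximal_row_extend[OF C q(2,3,1) max])
    have "x < p" using max[OF 2(1,3,4)] 2(2) by simp
    have q': "q \<le> a" using noncrossing_cells[OF nc q(2)] by simp
    have xq: "x \<le> N q" using less.prems(2) N_mono[of y q] q(3) by simp
    have "(x, q) \<in> C \<or> f x + g q < real x * real q"
    proof -
      have "x + (a - q) < x + (a - y)" using q(3) q' by linarith
      from less.hyps[OF this q' xq] show ?thesis by blast
    qed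
    then show ?thesis
      using le[OF q' xq] eq[OF py] eq[OF q(2)] \<open>x < p\<close> q
      by (intro exch[of q p]) auto
  qed
qed

section \<open>Row counts and rotations\<close>

definition psum :: "(nat \<Rightarrow> nat) \<Rightarrow> nat \<Rightarrow> nat" where
  "psum e y = (\<Sum>i\<le>y. e i)"

definition dyck_seq :: "(nat \<Rightarrow> nat) \<Rightarrow> bool" where
  "dyck_seq e \<longleftrightarrow> (\<forall>y\<le>a. psum e y \<le> N y) \<and> psum e a = N a \<and> (\<forall>i>a. e i = 0)"

definition slack :: "(nat \<Rightarrow> nat) \<Rightarrow> nat \<Rightarrow> nat" where
  "slack e y = N y - psum e y"

text \<open>The target \<open>y'\<close> is the first row above y at which slack is back to at most
  its value at y. Equality cannot be asked for: a path may reach the point with equal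
  \<open>horiz\<close> in the middle of row y'.\<close>

definition seq_rot :: "(nat \<Rightarrow> nat) \<Rightarrow> (nat \<Rightarrow> nat) \<Rightarrow> nat \<Rightarrow> nat \<Rightarrow> bool" where
  "seq_rot e e' y y' \<longleftrightarrow> y < y' \<and> y' \<le> a \<and> 0 < e y \<and> slack e y' \<le> slack e y \<and>
     (\<forall>i. y < i \<and> i < y' \<longrightarrow> slack e y < slack e i) \<and> e' = e(y := e y - 1, y' := Suc (e y'))"

text \<open>Column 0 stays open below the top row, so the stack is never empty there; this makes the
  truncated subtraction in \<open>slack\<close> exact.\<close>

lemma card_open_cols_slack:
  assumes "maximal C" "y < a"
  shows "card (open_cols C y) = Suc (slack (east_count C) y)"
    and "psum (east_count C) y \<le> N y"
proof -
  have "card (open_cols C y) \<noteq> 0"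
    using zero_open_cols[OF assms] by auto
  then show "card (open_cols C y) = Suc (slack (east_count C) y)"
    and "psum (east_count C) y \<le> N y"
    using card_open_cols_east_count[OF assms] unfolding slack_def psum_def by linarith+
qed

lemma dyck_seq_east_count:
  assumes C: "maximal C"
  shows "dyck_seq (east_count C)"
  unfolding dyck_seq_def
proof (intro conjI allI impI)
  fix i assume "a < i"
  then have "row C i = {}" using noncrossing_cells[OF maximalD[OF C]] by force
  then show "east_count C i = 0" by (simp add: east_count_def)
next
  fix y assume "y \<le> a"
  then show "psum (east_count C) y \<le> N y"
    using card_open_cols_slack(2)[OF C, of y] sum_east_count[OF C]
    by (cases "y = a") (auto simp: psum_def)
qed (use sum_east_count[OF C] in \<open>simp add: psum_def\<close>)

lemma row_upward:
  assumes C: "maximal C" and "(x, y) \<in> C" "x < z" "z \<le> N y"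
    and alive: "\<And>p q. (p, q) \<in> C \<Longrightarrow> p < z \<Longrightarrow> q < y \<Longrightarrow> N q < z"
  shows "(z, y) \<in> C"
  by (rule maximal_col_extend[OF C assms(2-4)]) (use alive in \<open>fastforce simp: not_less[symmetric]\<close>)

text \<open>The lower rows determine which columns are still available in row y (the set
  \<open>A\<close>), and in a maximal set the row is upward closed in \<open>A\<close>. Its size
  therefore fixes it, row by row from below.\<close>

lemma east_count_inj:
  assumes C: "maximal C" and D: "maximal D"
    and eq: "east_count C = east_count D"
  shows "C = D"
proof -
  have "row C y = row D y" if "y \<le> a" for y
    using that
  proof (induction y rule: less_induct)
    case (less y)
    define A where "A = {z. z \<le> N y \<and> (\<forall>p q. (p, q) \<in> C \<and> p < z \<and> q < y \<longrightarrow> N q < z)}"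
    have same: "(p, q) \<in> C \<longleftrightarrow> (p, q) \<in> D" if "q < y" for p q
      using less.IH[OF that] less.prems that by (auto simp: set_eq_iff)
    have AD: "A = {z. z \<le> N y \<and> (\<forall>p q. (p, q) \<in> D \<and> p < z \<and> q < y \<longrightarrow> N q < z)}"
      unfolding A_def using same by blast
    have aux: "row E y \<subseteq> B" "\<And>x z. x \<in> row E y \<Longrightarrow> z \<in> B \<Longrightarrow> x < z \<Longrightarrow> z \<in> row E y"
      if E: "maximal E"
        and B: "B = {z. z \<le> N y \<and> (\<forall>p q. (p, q) \<in> E \<and> p < z \<and> q < y \<longrightarrow> N q < z)}" for E B
    proof -
      note nc = maximalD[OF E]
      show "row E y \<subseteq> B"
        unfolding B using noncrossing_cells[OF nc] noncrossingD[OF nc] by auto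
      fix x z assume xz: "x \<in> row E y" "z \<in> B" "x < z"
      have "(z, y) \<in> E"
        by (rule row_upward[OF E _ xz(3)]) (use xz in \<open>auto simp: B\<close>)
      then show "z \<in> row E y" by simp
    qed
    show ?case
    proof (rule upward_closed_eq[where A = A])
      show "card (row C y) = card (row D y)"
        using card_row C D eq less.prems by simp
    qed (use finite_row maximalD C D aux[OF C A_def] aux[OF D AD] in blast)+
  qed
  then have "(x, y) \<in> C \<longleftrightarrow> (x, y) \<in> D" if "y \<le> a" for x y
    using that by (auto simp: set_eq_iff)
  moreover have "y \<le> a" if "(x, y) \<in> C \<or> (x, y) \<in> D" for x y
    using that noncrossing_cells maximalD C D by blast
  ultimately show ?thesis by auto
qed

section \<open>Reconstruction of a maximal set from its row counts\<close>

definition height :: "nat \<Rightarrow> nat" where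
  "height x = (LEAST y. x \<le> N y)"

lemma height_le_iff: "x \<le> N a \<Longrightarrow> height x \<le> y \<longleftrightarrow> x \<le> N y"
  unfolding height_def
  by (metis (mono_tags, lifting) LeastI Least_le N_mono order_trans)

text \<open>
  The inverse of \<open>east_count\<close>: \<open>position e x\<close> is the place in the stack at which column \<open>x\<close> is pushed,
  and a cell belongs to \<open>stack_set e\<close> if its column is still on the stack and is popped or on top
  after the pops of its row.
\<close>

definition position :: "(nat \<Rightarrow> nat) \<Rightarrow> nat \<Rightarrow> nat" where
  "position e x = x - (\<Sum>i<height x. e i)"

definition stack_set :: "(nat \<Rightarrow> nat) \<Rightarrow> (nat \<times> nat) set" where
  "stack_set e = {(x, y). y \<le> a \<and> x \<le> N y \<and> slack e y \<le> position e x \<and>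
      (\<forall>i. x \<le> N i \<and> i < y \<longrightarrow> position e x \<le> slack e i)}"

text \<open>Makes the truncated subtraction in \<open>position\<close> exact. The second part puts a
  new column above everything left on the stack by the row before it starts.\<close>

lemma psum_height_less:
  assumes "dyck_seq e" "x \<le> N a"
  shows "(\<Sum>i<height x. e i) \<le> x" and "0 < height x \<Longrightarrow> (\<Sum>i<height x. e i) \<le> N (height x - 1) \<and> N (height x - 1) < x"
proof -
  have *: "(\<Sum>i<height x. e i) \<le> N (height x - 1) \<and> N (height x - 1) < x" if pos: "0 < height x"
  proof -
    obtain k where k: "height x = Suc k" using pos gr0_implies_Suc by blast
    have "\<not> x \<le> N k" using height_le_iff[OF assms(2), of k] k by simp
    moreover have "k \<le> a" using height_le_iff[OF assms(2), of a] assms(2) k by simp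
    ultimately show ?thesis using assms(1) k unfolding dyck_seq_def psum_def
      by (simp add: lessThan_Suc_atMost)
  qed
  then show "(\<Sum>i<height x. e i) \<le> x" by (cases "height x = 0") auto
  show "(\<Sum>i<height x. e i) \<le> N (height x - 1) \<and> N (height x - 1) < x" if "0 < height x"
    using * that .
qed

text \<open>If the cells crossed, x' would survive row y on the stack, so
  \<open>position e x' \<le> slack e y \<le> position e x\<close>. But x was still on the stack when
  x' was pushed, so x' lies above it; the two cases are columns pushed in the same row and in
  different rows.\<close>

lemma noncrossing_stack_set:
  assumes e: "dyck_seq e"
  shows "noncrossing (stack_set e)"
  unfolding noncrossing_def
proof (intro conjI allI impI)
  show "stack_set e \<subseteq> cells" by (auto simp: stack_set_def)
  fix x y x' y'
  assume *: "(x, y) \<in> stack_set e \<and> (x', y') \<in> stack_set e \<and> x < x' \<and> y < y'"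
  show "N y < x'"
  proof (rule ccontr)
    assume "\<not> N y < x'"
    then have x': "x' \<le> N y" by simp
    have ya: "y \<le> a" "y' \<le> a" using * by (auto simp: stack_set_def)
    have xa: "x' \<le> N a" "x \<le> N a" using x' N_mono[OF ya(1)] * by auto
    have "position e x' \<le> slack e y" using * x' by (auto simp: stack_set_def)
    also have "\<dots> \<le> position e x" using * by (auto simp: stack_set_def)
    finally have le: "position e x' \<le> position e x" .
    have hle: "height x \<le> height x'"
      using height_le_iff xa * by (meson le_trans less_imp_le order_refl)
    show False
    proof (cases "height x = height x'")
      case True
      then have "position e x < position e x'"
        unfolding position_def using * psum_height_less(1)[OF e xa(2)]
        by (metis diff_less_mono)
      then show False using le by simp
    next
      case False
      define k where "k = height x' - 1"
      have k: "height x' = Suc k" "height x \<le> k" using False hle by (auto simp: k_def)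
      have "k < y" using k(1) height_le_iff[OF xa(1), of y] x' by simp
      moreover have "x \<le> N k" using k(2) height_le_iff[OF xa(2)] by simp
      ultimately have "position e x \<le> slack e k" using * by (auto simp: stack_set_def)
      also have "\<dots> < position e x'"
        using psum_height_less(2)[OF e xa(1)] k(1)
        unfolding slack_def position_def psum_def by (simp add: lessThan_Suc_atMost diff_less_mono)
      finally show False using le by simp
    qed
  qed
qed

text \<open>The occupant of place k was pushed in row j, the earliest row from which slack stays at
  least k until row y. So its number is k plus the number of columns popped below row j.\<close>

lemma stack_set_row:
  assumes e: "dyck_seq e" and y: "y \<le> a" and k: "slack e y \<le> k" "k \<le> slack e y + e y"
  shows "\<exists>x. (x, y) \<in> stack_set e \<and> position e x = k"
proof -
  have psum_le: "psum e i \<le> N i" if "i \<le> a" for i using e that by (simp add: dyck_seq_def)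
  let ?P = "\<lambda>j. j \<le> y \<and> (\<forall>i. j \<le> i \<and> i < y \<longrightarrow> k \<le> slack e i)"
  define j where "j = (LEAST j. ?P j)"
  have "?P j" unfolding j_def by (rule LeastI[of ?P y]) simp
  then have j: "j \<le> y" "\<And>i. j \<le> i \<Longrightarrow> i < y \<Longrightarrow> k \<le> slack e i" by auto
  have kj: "k \<le> slack e j + e j"
    using j(2)[of j] j(1) k(2) by (cases "j = y") auto
  define x where "x = k + (\<Sum>i<j. e i)"
  have e0: "e 0 = 0" using psum_le[of 0] N_0 by (simp add: psum_def)
  have "x \<le> N j \<and> (\<forall>i<j. N i < x)"
  proof (cases j)
    case 0
    then show ?thesis using kj e0 N_0 by (simp add: x_def slack_def)
  next
    case (Suc i)
    have "\<not> ?P i" using not_less_Least[of i ?P] Suc unfolding j_def by simp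
    then have "slack e i < k"
      using j Suc by (metis Suc_leD Suc_le_eq le_antisym not_less_eq_eq not_less)
    moreover have "psum e i \<le> N i" using psum_le Suc j(1) y by simp
    ultimately have "N i < x" using Suc by (simp add: x_def slack_def psum_def lessThan_Suc_atMost)
    then have "\<forall>i<j. N i < x" using N_mono Suc by (metis le_less_trans less_Suc_eq_le)
    moreover have "psum e j \<le> N j" using psum_le j(1) y by simp
    moreover have "psum e j = (\<Sum>i<j. e i) + e j"
      by (simp add: psum_def lessThan_Suc_atMost[symmetric])
    ultimately show ?thesis using kj by (simp add: x_def slack_def)
  qed
  then have x: "x \<le> N j" "\<And>i. i < j \<Longrightarrow> N i < x" by auto
  have h: "height x = j"
    unfolding height_def using x by (intro Least_equality) (auto simp: not_less[symmetric])
  have pos: "position e x = k" unfolding position_def h by (simp add: x_def)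
  have "(x, y) \<in> stack_set e"
    unfolding stack_set_def using y x(1) N_mono[OF j(1)] k(1) j(2) x(2) pos
    by (auto simp: not_less[symmetric])
  then show ?thesis using pos by blast
qed

text \<open>Row y has a cell for each stack place from \<open>slack e y\<close> to
  \<open>slack e y + e y\<close>. These lower bounds add up to \<open>N a + a + 1\<close>, which
  gives maximality and then equality in each row.\<close>

lemma east_count_stack_set:
  assumes e: "dyck_seq e"
  shows "maximal (stack_set e)" "east_count (stack_set e) = e"
proof -
  note nc = noncrossing_stack_set[OF e]
  have ge: "Suc (e y) \<le> card (row (stack_set e) y)" if "y \<le> a" for y
  proof -
    have "{slack e y..slack e y + e y} \<subseteq> position e ` row (stack_set e) y"
      using stack_set_row[OF e that] by fastforce
    then have "card {slack e y..slack e y + e y} \<le> card (row (stack_set e) y)"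
      using finite_row[OF nc] by (meson card_image_le card_mono finite_imageI order_trans)
    then show ?thesis by simp
  qed
  have "N a + a + 1 = (\<Sum>y\<le>a. Suc (e y))"
    using e by (simp add: dyck_seq_def psum_def sum_Suc)
  also have "\<dots> \<le> (\<Sum>y\<le>a. card (row (stack_set e) y))" using ge by (intro sum_mono) simp
  also have "\<dots> = card (stack_set e)" using card_conv_rows[OF nc] by simp
  finally show max: "maximal (stack_set e)" by (rule maximalI[OF nc])
  have le: "e y \<le> east_count (stack_set e) y" if "y \<le> a" for y
    using ge[OF that] by (simp add: east_count_def)
  have "e y = east_count (stack_set e) y" if "y \<le> a" for y
  proof (rule ccontr)
    assume "e y \<noteq> east_count (stack_set e) y"
    then have "(\<Sum>y\<le>a. e y) < (\<Sum>y\<le>a. east_count (stack_set e) y)"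
      using le that by (intro sum_strict_mono_ex1) (auto intro!: bexI[of _ y] simp: less_le)
    then show False using sum_east_count[OF max] e by (simp add: dyck_seq_def psum_def)
  qed
  moreover have "e y = east_count (stack_set e) y" if "a < y" for y
    using dyck_seq_east_count[OF max] e that by (simp add: dyck_seq_def)
  ultimately show "east_count (stack_set e) = e" by (metis ext not_less)
qed

lemma bij_betw_east_count: "bij_betw east_count {C. maximal C} {e. dyck_seq e}"
  unfolding bij_betw_def
proof
  show "inj_on east_count {C. maximal C}"
    using east_count_inj by (auto intro: inj_onI)
  show "east_count ` {C. maximal C} = {e. dyck_seq e}"
    using dyck_seq_east_count east_count_stack_set by (auto simp: image_iff) metis
qed

section \<open>Swaps\<close>

definition adjacent :: "(nat \<times> nat) set \<Rightarrow> (nat \<times> nat) set \<Rightarrow> bool" where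
  "adjacent C D \<longleftrightarrow> (\<exists>c d. c \<in> C \<and> d \<notin> C \<and> D = insert d (C - {c}))"

lemma adjacent_sym: "adjacent C D \<Longrightarrow> adjacent D C"
  unfolding adjacent_def
proof (elim exE conjE)
  fix c d assume "c \<in> C" "d \<notin> C" "D = insert d (C - {c})"
  then show "\<exists>c d. c \<in> D \<and> d \<notin> D \<and> C = insert d (D - {c})"
    by (intro exI[of _ d] exI[of _ c]) auto
qed

text \<open>Here y' is the next row in which column \<open>left C y\<close> has a cell. A column
  open after y' is at most \<open>left C y\<close>, so it was open after y already. Strictly
  between, every column open after y stays open, and \<open>left C i\<close> is an additional
  one.\<close>

lemma slack_above_row:
  assumes C: "maximal C" and up: "(left C y, y') \<in> C" "y < y'"
    and gap: "\<And>i. y < i \<Longrightarrow> i < y' \<Longrightarrow> (left C y, i) \<notin> C"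
  shows "slack (east_count C) y' \<le> slack (east_count C) y"
    and "\<And>i. y < i \<Longrightarrow> i < y' \<Longrightarrow> slack (east_count C) y < slack (east_count C) i"
proof -
  note nc = maximalD[OF C]
  have y': "y' \<le> a" using noncrossing_cells[OF nc up(1)] by simp
  have ya: "y < a" using y' up(2) by simp
  have l: "(left C y, y) \<in> C" using left_in[OF C] ya by simp
  have ly: "left C y \<le> N y" using noncrossing_cells[OF nc l] by simp
  show "slack (east_count C) y' \<le> slack (east_count C) y"
  proof (cases "y' = a")
    case True
    then show ?thesis using dyck_seq_east_count[OF C] by (simp add: slack_def dyck_seq_def)
  next
    case False
    have "open_cols C y' \<subseteq> open_cols C y"
    proof
      fix x assume x: "x \<in> open_cols C y'"
      then have "x \<le> left C y" using open_cols_le_row[OF nc up(1)] by simp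
      then show "x \<in> open_cols C y" using x ly up(2) by (simp add: open_cols_def) (meson le_trans less_trans)
    qed
    then have "card (open_cols C y') \<le> card (open_cols C y)" by (intro card_mono) auto
    then show ?thesis
      using card_open_cols_slack(1)[OF C] False y' ya by simp
  qed
  fix i assume i: "y < i" "i < y'"
  have "open_cols C y \<subseteq> open_cols C i"
  proof
    fix x assume x: "x \<in> open_cols C y"
    then obtain q where q: "x \<le> N y" "(x, q) \<in> C" "y < q" by (auto simp: open_cols_def)
    have xl: "x \<le> left C y" using open_cols_le_left[OF C _ x] ya by simp
    have xi: "x \<le> N i" using q(1) N_mono[of y i] i by simp
    show "x \<in> open_cols C i"
    proof (cases "i < q")
      case True
      then show ?thesis using q(2) xi by (auto simp: open_cols_def)
    next
      case False
      then have "x \<noteq> left C y" using gap[of q] q i by auto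
      then have "N q < left C y" using noncrossingD[OF nc q(2) up(1)] xl i False by simp
      then show ?thesis using ly N_mono[of y q] q(3) by simp
    qed
  qed
  moreover have "left C i \<in> open_cols C i" using left_open[OF C] i y' by simp
  moreover have "left C i \<notin> open_cols C y"
  proof
    assume "left C i \<in> open_cols C y"
    then have "left C i \<le> left C y" using open_cols_le_left[OF C] ya by simp
    moreover have "(left C i, i) \<in> C" using left_in[OF C] i y' by simp
    ultimately show False
      using gap[OF i] noncrossingD[OF nc \<open>(left C i, i) \<in> C\<close> up(1)] i ly N_mono[of y i]
      by (cases "left C i = left C y") auto
  qed
  ultimately have "card (open_cols C y) < card (open_cols C i)"
    by (intro psubset_card_mono) auto
  then show "slack (east_count C) y < slack (east_count C) i"
    using card_open_cols_slack(1)[OF C] i y' ya by simp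
qed

lemma seq_rot_swap:
  assumes C: "maximal C" and D: "maximal D"
    and swap: "D = insert (x', y') (C - {(left C y, y)})" "(x', y') \<notin> C"
    and up: "(left C y, y') \<in> C" "y < y'"
    and gap: "\<And>i. y < i \<Longrightarrow> i < y' \<Longrightarrow> (left C y, i) \<notin> C"
  shows "seq_rot (east_count C) (east_count D) y y'"
proof -
  note nc = maximalD[OF C]
  have y': "y' \<le> a" using noncrossing_cells[OF nc up(1)] by simp
  have ya: "y < a" using y' up(2) by simp
  have l: "(left C y, y) \<in> C" using left_in[OF C] ya by simp
  have rowy: "row D y = row C y - {left C y}" using swap up(2) by auto
  have rowy': "row D y' = insert x' (row C y')" using swap up(2) by auto
  have rowi: "row D i = row C i" if "i \<noteq> y" "i \<noteq> y'" for i using swap that by auto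
  have "card (row D y) = card (row C y) - 1"
    unfolding rowy using l by (intro card_Diff_singleton) auto
  then have cy: "east_count C y = Suc (east_count D y)"
    using card_row[OF C, of y] card_row[OF D, of y] ya by simp
  have "card (row D y') = Suc (card (row C y'))"
    unfolding rowy' using swap(2) finite_row[OF nc] by (intro card_insert_disjoint) auto
  then have cy': "east_count D y' = Suc (east_count C y')"
    using card_row[OF C, of y'] card_row[OF D, of y'] y' by simp
  have "east_count D = (east_count C)(y := east_count C y - 1, y' := Suc (east_count C y'))"
  proof
    fix i
    show "east_count D i = ((east_count C)(y := east_count C y - 1, y' := Suc (east_count C y'))) i"
      using cy cy' rowi[of i] up(2) by (auto simp: east_count_def)
  qed
  then show ?thesis
    unfolding seq_rot_def using cy y' up(2) slack_above_row[OF C up gap] by auto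
qed

text \<open>The exchanged cells cross, so up to symmetry the new one lies to the upper right. The
  upper left corner of their rectangle is in C, which makes (x, y) leftmost in its row, and the new
  cell leaves room for no cell of column x strictly between the two rows.\<close>

lemma adjacent_seq_rot:
  assumes C: "maximal C" and D: "maximal D" and "adjacent C D"
  shows "\<exists>y y'. seq_rot (east_count C) (east_count D) y y' \<or>
    seq_rot (east_count D) (east_count C) y y'"
proof -
  have wlog: "\<exists>y y'. seq_rot (east_count C) (east_count D) y y'"
    if C: "maximal C" and D: "maximal D"
      and c: "(x, y) \<in> C" and d: "(x', y') \<notin> C" and eq: "D = insert (x', y') (C - {(x, y)})"
      and lt: "x < x'" "y < y'" "x' \<le> N y" for C D x y x' y'
  proof -
    note ncC = maximalD[OF C] and ncD = maximalD[OF D]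
    have dD: "(x', y') \<in> D" using eq by simp
    have KD: "p \<in> C \<Longrightarrow> p \<noteq> (x, y) \<Longrightarrow> p \<in> D" for p using eq by simp
    have ya: "y \<le> a" "x \<le> N y" using noncrossing_cells[OF ncC c] by auto
    have y'a: "y' \<le> a" "x' \<le> N y'" using noncrossing_cells[OF ncD dD] by auto
    \<comment> \<open>A cell of C crossing this corner would cross (x, y) inside C or (x', y')
      inside D.\<close>
    have xy': "(x, y') \<in> C"
    proof (rule maximal_insertD[OF C y'a(1)])
      show "x \<le> N y'" using y'a lt by simp
      fix p q assume pq: "(p, q) \<in> C"
      show False if "p < x" "q < y'" "x \<le> N q"
      proof (cases "x' \<le> N q")
        case True
        then show False using noncrossingD[OF ncD KD[OF pq] dD] that lt by auto
      next
        case False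
        then have "q < y" using lt(3) N_mono[of y q] by (cases "q < y") auto
        then show False using noncrossingD[OF ncC pq c] that by auto
      qed
      show False if "x < p" "y' < q" "p \<le> N y'"
      proof (cases "p \<le> N y")
        case True
        then show False using noncrossingD[OF ncC c pq] that lt by auto
      next
        case False
        then have "x' < p" using lt(3) by simp
        then show False using noncrossingD[OF ncD dD KD[OF pq]] that lt by auto
      qed
    qed
    have x'y: "(x', y) \<in> C"
    proof (rule maximal_insertD[OF C ya(1) lt(3)])
      fix p q assume pq: "(p, q) \<in> C"
      show False if "p < x'" "q < y" "x' \<le> N q"
        using noncrossingD[OF ncD KD[OF pq] dD] that lt by auto
      show False if "x' < p" "y < q" "p \<le> N y"
        using noncrossingD[OF ncC c pq] that lt by auto
    qed
    have x: "left C y = x"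
    proof (rule antisym)
      show "left C y \<le> x" using left_le[OF ncC c] .
      show "x \<le> left C y"
      proof (rule ccontr)
        assume "\<not> x \<le> left C y"
        then show False using noncrossingD[OF ncC left_in[OF C ya(1)] xy'] lt ya by auto
      qed
    qed
    have gap: "(x, i) \<notin> C" if "y < i" "i < y'" for i
    proof
      assume xi: "(x, i) \<in> C"
      then show False
        using noncrossingD[OF ncD KD[OF xi] dD] that lt N_mono[of y i] by auto
    qed
    have "seq_rot (east_count C) (east_count D) y y'"
      by (rule seq_rot_swap[OF C D, where x' = x']) (use eq d xy' lt gap x in auto)
    then show ?thesis by blast
  qed
  obtain x y x' y' where cd: "(x, y) \<in> C" "(x', y') \<notin> C" "D = insert (x', y') (C - {(x, y)})"
    using assms(3) unfolding adjacent_def by (metis surj_pair)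
  have "(x', y') \<in> cells" using D cd(3) unfolding maximal_def noncrossing_def by blast
  then have y': "y' \<le> a" "x' \<le> N y'" by auto
  \<comment> \<open>C is maximal, so the new cell crosses a cell of C; that cell is missing from D,
    hence it is the removed one.\<close>
  obtain p q where pq: "(p, q) \<in> C" "p < x' \<and> q < y' \<and> x' \<le> N q \<or> x' < p \<and> y' < q \<and> p \<le> N y'"
    using maximal_insertD[OF C y'] cd(2) by blast
  have "(p, q) \<notin> D"
  proof
    assume pD: "(p, q) \<in> D"
    have "(x', y') \<in> D" using cd(3) by simp
    with pD show False
      using pq(2) noncrossingD[OF maximalD[OF D]] by (meson not_less)
  qed
  then have "(p, q) = (x, y)" using pq(1) cd(3) by blast
  then have "p = x" "q = y" by auto
  then consider "x < x'" "y < y'" "x' \<le> N y" | "x' < x" "y' < y" "x \<le> N y'" using pq(2) by blast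
  then show ?thesis
  proof cases
    case 1
    then show ?thesis using wlog[OF C D cd] by blast
  next
    case 2
    have "(x', y') \<in> D" "(x, y) \<notin> D" "C = insert (x, y) (D - {(x', y')})"
      using cd by auto
    then show ?thesis using wlog[OF D C _ _ _ 2] by blast
  qed
qed

lemma seq_rot_unique:
  assumes "seq_rot e e' y i" "seq_rot e e'' y j"
  shows "i = j"
proof (rule ccontr)
  assume "i \<noteq> j"
  then show False using assms unfolding seq_rot_def by (metis linorder_neqE_nat not_less)
qed

text \<open>The leftmost cell of row y gives way to a cell in the column of its right neighbour,
  placed in the next row where column \<open>left C y\<close> has a cell. The number of cells is
  unchanged, so the new set is maximal, and since row counts determine maximal sets it is D.\<close>

lemma seq_rot_adjacent:
  assumes C: "maximal C" and D: "maximal D"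
    and rot: "seq_rot (east_count C) (east_count D) y y'"
  shows "adjacent C D"
proof -
  note nc = maximalD[OF C]
  have ya: "y < a" and ey: "0 < east_count C y" using rot by (auto simp: seq_rot_def)
  define x where "x = left C y"
  have xC: "(x, y) \<in> C" unfolding x_def using left_in[OF C] ya by simp
  let ?P = "\<lambda>j. y < j \<and> (x, j) \<in> C"
  define j where "j = (LEAST j. ?P j)"
  have xo: "x \<le> N y" "\<exists>j. ?P j" using left_open[OF C ya] by (auto simp: open_cols_def x_def)
  have "?P j" unfolding j_def by (rule LeastI_ex[OF xo(2)])
  then have j: "y < j" "(x, j) \<in> C" by auto
  have gap: "(x, i) \<notin> C" if "y < i" "i < j" for i
    using not_less_Least[of i ?P] that unfolding j_def by blast
  have ja: "j \<le> a" using noncrossing_cells[OF nc j(2)] by simp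
  define R where "R = row C y - {x}"
  have "card R = east_count C y"
    unfolding R_def using card_row[OF C, of y] ya xC by (subst card_Diff_singleton) auto
  then have R: "finite R" "R \<noteq> {}" using ey by (metis card_gt_0_iff)+
  define x' where "x' = Min R"
  have "x' \<in> R" unfolding x'_def by (rule Min_in[OF R])
  then have x': "(x', y) \<in> C" "x' \<noteq> x" by (auto simp: R_def)
  have x'_min: "x' \<le> p" if "(p, y) \<in> C" "p \<noteq> x" for p
    unfolding x'_def using that R by (intro Min_le) (auto simp: R_def)
  have lt: "x < x'" using left_le[OF nc x'(1)] x'(2) by (simp add: x_def)
  have x'N: "x' \<le> N y" using noncrossing_cells[OF nc x'(1)] by simp
  have notin: "(x', j) \<notin> C" using noncrossingD[OF nc xC _ lt j(1)] x'N by auto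
  define E where "E = insert (x', j) (C - {(x, y)})"
  have "noncrossing E"
    unfolding E_def
  proof (rule noncrossing_insert)
    show "noncrossing (C - {(x, y)})" using nc by (rule noncrossing_subset) auto
    show "j \<le> a" by fact
    show "x' \<le> N j" using x'N N_mono[of y j] j(1) by simp
    fix p q assume "(p, q) \<in> C - {(x, y)}"
    then have pq: "(p, q) \<in> C" "(p, q) \<noteq> (x, y)" by auto
    show False if "p < x'" "q < j" "x' \<le> N q"
    proof (cases q y rule: linorder_cases)
      case less
      then show False using noncrossingD[OF nc pq(1) x'(1)] that by auto
    next
      case equal
      then show False using x'_min[of p] pq that by auto
    next
      case greater
      consider "p < x" | "p = x" | "x < p" by linarith
      then show False
      proof cases
        case 1
        then show False
          using noncrossingD[OF nc pq(1) j(2)] that xo(1) N_mono[of y q] greater by auto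
      next
        case 2
        then show False using gap[OF greater] pq that by auto
      next
        case 3
        then show False using noncrossingD[OF nc xC pq(1)] that x'N greater by auto
      qed
    qed
    show False if "x' < p" "j < q" "p \<le> N j"
      using noncrossingD[OF nc j(2) pq(1)] that lt by auto
  qed
  moreover have "card E = card C"
    unfolding E_def using notin xC noncrossing_finite[OF nc] card_gt_0_iff[of C]
    by (subst card_insert_disjoint) auto
  ultimately have E: "maximal E"
    using card_maximal[OF C] by (intro maximalI) auto
  have "seq_rot (east_count C) (east_count E) y j"
    by (rule seq_rot_swap[OF C E, where x' = x']) (use E_def notin j gap in \<open>auto simp: x_def\<close>)
  moreover from this have "j = y'" using seq_rot_unique rot by blast
  ultimately have "east_count E = east_count D" using rot by (simp add: seq_rot_def)
  then have "E = D" using east_count_inj E D by blast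
  then show ?thesis unfolding adjacent_def E_def using xC notin by blast
qed

section \<open>Rotations and partial sums: the generated order and its covers\<close>

lemma seq_rot_psum:
  assumes "seq_rot x y i j"
  shows "psum x k = psum y k + (if i \<le> k \<and> k < j then 1 else 0)"
proof -
  have "x t + (if t = j then 1 else 0) = y t + (if t = i then 1 else 0)" for t
    using assms by (auto simp: seq_rot_def)
  then have "(\<Sum>t\<le>k. x t + (if t = j then 1 else 0)) = (\<Sum>t\<le>k. y t + (if t = i then 1 else 0))"
    by simp
  moreover have "i < j" using assms by (simp add: seq_rot_def)
  ultimately show ?thesis by (auto simp: sum.distrib psum_def split: if_splits)
qed

lemma psum_inject: "(\<And>k. psum x k = psum y k) \<Longrightarrow> x = y"
proof
  fix k assume eq: "\<And>k. psum x k = psum y k"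
  show "x k = y k" using eq[of k] eq[of "k - 1"] by (cases k) (auto simp: psum_def)
qed

definition rotates :: "(nat \<Rightarrow> nat) \<Rightarrow> (nat \<Rightarrow> nat) \<Rightarrow> bool" where
  "rotates x y \<longleftrightarrow> (\<exists>i j. seq_rot x y i j)"

lemma rotates_psum_le: "rotates\<^sup>*\<^sup>* x y \<Longrightarrow> psum y k \<le> psum x k"
proof (induction rule: rtranclp_induct)
  case (step y z)
  then obtain i j where "seq_rot y z i j" by (auto simp: rotates_def)
  then show ?case using step.IH seq_rot_psum[of y z i j k] by simp
qed simp

lemma rotates_antisym: "rotates\<^sup>*\<^sup>* x y \<Longrightarrow> rotates\<^sup>*\<^sup>* y x \<Longrightarrow> x = y"
  by (intro psum_inject antisym rotates_psum_le)

lemma rotates_irrefl: "\<not> rotates x x"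
proof
  assume "rotates x x"
  then obtain i j where ij: "seq_rot x x i j" by (auto simp: rotates_def)
  then have "i < j" by (simp add: seq_rot_def)
  then show False using seq_rot_psum[OF ij, of i] by simp
qed

text \<open>
  A rotation lowers the partial sums by one on an interval \<open>{i..<j}\<close>. In a longer chain from \<open>x\<close> to \<open>y\<close> the
  rotation that acts at \<open>i\<close> would end before \<open>j\<close>, but the slack at \<open>i\<close> has not changed until then and
  the slack strictly between \<open>i\<close> and \<open>j\<close> exceeds it.
\<close>

lemma rotates_covering:
  assumes "rotates x y" "rotates\<^sup>*\<^sup>* x z" "rotates\<^sup>*\<^sup>* z y"
  shows "z = x \<or> z = y"
proof (rule ccontr)
  assume "\<not> (z = x \<or> z = y)"
  then have ne: "z \<noteq> x" "z \<noteq> y" by auto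
  obtain i j where ij: "seq_rot x y i j" using assms(1) by (auto simp: rotates_def)
  have lt: "i < j" using ij by (simp add: seq_rot_def)
  \<comment> \<open>A chain to y cannot pass through w once some partial sum has dropped while the
    one at i has not: the rotation that finally acts at i must cover all of \<open>{i..<j}\<close>,
    which leaves nothing to drop before it.\<close>
  have stuck: False
    if "rotates\<^sup>*\<^sup>* w y" "rotates\<^sup>*\<^sup>* x w" "psum w i = psum x i" "psum w k < psum x k" for w k
    using that
  proof (induction arbitrary: k rule: converse_rtranclp_induct)
    case base
    then show False using seq_rot_psum[OF ij, of i] lt by simp
  next
    case (step w w')
    obtain i' j' where ij': "seq_rot w w' i' j'" using step.hyps(1) by (auto simp: rotates_def)
    have lt': "i' < j'" using ij' by (simp add: seq_rot_def)
    have wx: "psum w k \<le> psum x k" for k using rotates_psum_le step.prems(1) by blast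
    have yw: "psum y k \<le> psum w' k" for k using rotates_psum_le step.hyps(2) by blast
    show False
    proof (cases "i' \<le> i \<and> i < j'")
      case True
      have "i' = i"
        using seq_rot_psum[OF ij', of i'] seq_rot_psum[OF ij, of i'] lt' True wx[of i'] yw[of i']
        by (auto split: if_splits)
      have "j' - 1 < j"
        using seq_rot_psum[OF ij', of "j' - 1"] seq_rot_psum[OF ij, of "j' - 1"] lt'
          wx[of "j' - 1"] yw[of "j' - 1"] by (auto split: if_splits)
      moreover have "\<not> j' < j"
      proof
        assume "j' < j"
        then have "slack x i < slack x j'" using ij lt' \<open>i' = i\<close> by (simp add: seq_rot_def)
        also have "\<dots> \<le> slack w j'" using wx[of j'] by (simp add: slack_def)
        also have "\<dots> \<le> slack w i" using ij' \<open>i' = i\<close> by (simp add: seq_rot_def)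
        also have "\<dots> = slack x i" using step.prems(2) by (simp add: slack_def)
        finally show False by simp
      qed
      ultimately have "j' = j" by simp
      \<comment> \<open>This rotation lowers exactly the sums in which y differs from x, and none of
        them may fall below its value in y.\<close>
      then have "psum x k \<le> psum w k"
        using seq_rot_psum[OF ij', of k] seq_rot_psum[OF ij, of k] \<open>i' = i\<close> yw[of k] by simp
      then show False using step.prems(3) by simp
    next
      case False
      have "rotates\<^sup>*\<^sup>* x w'" using step.prems(1) step.hyps(1) by simp
      moreover have "psum w' i = psum x i"
        using seq_rot_psum[OF ij', of i] False step.prems(2) by auto
      moreover have "psum w' k < psum x k"
        using seq_rot_psum[OF ij', of k] step.prems(3) by linarith
      ultimately show False by (rule step.IH)
    qed
  qed
  obtain z1 where z1: "rotates x z1" "rotates\<^sup>*\<^sup>* z1 z"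
    using assms(2) ne(1) by (metis converse_rtranclpE)
  obtain i1 j1 where ij1: "seq_rot x z1 i1 j1" using z1(1) by (auto simp: rotates_def)
  have lt1: "i1 < j1" using ij1 by (simp add: seq_rot_def)
  have z1y: "rotates\<^sup>*\<^sup>* z1 y" using z1(2) assms(3) by simp
  show False
  proof (cases "i1 = i")
    case True
    then have "j1 = j" using seq_rot_unique ij ij1 by blast
    then have "z1 = y" using True ij ij1 by (simp add: seq_rot_def)
    then show False using rotates_antisym z1(2) assms(3) ne(2) by blast
  next
    case False
    have d: "psum z1 i1 < psum x i1" using seq_rot_psum[OF ij1, of i1] lt1 by simp
    have "psum y i1 \<le> psum z1 i1" using rotates_psum_le z1y by blast
    then have "i < i1" using d seq_rot_psum[OF ij, of i1] False by (auto split: if_splits)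
    then have "psum z1 i = psum x i" using seq_rot_psum[OF ij1, of i] by simp
    then show False using stuck[OF z1y _ _ d] z1(1) by blast
  qed
qed

end

section \<open>Lattice paths\<close>

fun east_at :: "step list \<Rightarrow> nat \<Rightarrow> nat" where
  "east_at [] y = 0"
| "east_at (North # m) y = (case y of 0 \<Rightarrow> 0 | Suc k \<Rightarrow> east_at m k)"
| "east_at (East # m) y = (if y = 0 then 1 else 0) + east_at m y"

lemma east_at_append:
  "east_at (A @ B) y = east_at A y +
     (if count_list A North \<le> y then east_at B (y - count_list A North) else 0)"
  by (induction A y rule: east_at.induct) (auto split: nat.split)

lemma east_at_above: "count_list m North < y \<Longrightarrow> east_at m y = 0"
  by (induction m y rule: east_at.induct) (auto split: nat.split)

lemma sum_east_at: "(\<Sum>i\<le>count_list m North. east_at m i) = count_list m East"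
proof (induction m)
  case (Cons s m)
  then show ?case
  proof (cases s)
    case North
    then show ?thesis using Cons by (simp add: sum.atMost_Suc_shift del: sum.atMost_Suc)
  next
    case East
    then show ?thesis using Cons by (simp add: sum.distrib)
  qed
qed simp

lemma east_at_inject:
  "count_list m North = count_list m' North \<Longrightarrow> east_at m = east_at m' \<Longrightarrow> m = m'"
proof (induction m arbitrary: m')
  case Nil
  then show ?case
  proof (cases m')
    case (Cons s k)
    then show ?thesis using Nil fun_cong[OF Nil(2), of 0] by (cases s) auto
  qed simp
next
  case (Cons s m)
  show ?case
  proof (cases s)
    case North
    then obtain k where k: "m' = North # k"
      using Cons.prems(1) fun_cong[OF Cons.prems(2), of 0]
      by (cases m') (auto, metis (full_types) add_is_0 east_at.simps(3) one_neq_zero step.exhaust)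
    have "east_at m y = east_at k y" for y
      using fun_cong[OF Cons.prems(2), of "Suc y"] North k by simp
    then show ?thesis using Cons.IH[of k] Cons.prems(1) North k by auto
  next
    case East
    then obtain k where k: "m' = East # k"
      using fun_cong[OF Cons.prems(2), of 0]
      by (cases m' rule: list.exhaust) (auto, metis (full_types) east_at.simps(2) nat.case(1) nat.distinct(1) step.exhaust)
    have "east_at m y = east_at k y" for y
      using fun_cong[OF Cons.prems(2), of y] East k by simp
    then show ?thesis using Cons.IH[of k] Cons.prems(1) East k by auto
  qed
qed

lemma endpoint_Cons:
  "endpoint (North # m) = (fst (endpoint m), Suc (snd (endpoint m)))"
  "endpoint (East # m) = (Suc (fst (endpoint m)), snd (endpoint m))"
  by (auto simp: endpoint_def)

lemma points_Cons: "points (s # m) = insert (0, 0) ((\<lambda>q. endpoint (s # q)) ` {take k m | k. k \<le> length m})"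
proof -
  have "{take k (s # m) | k. k \<le> length (s # m)} = insert [] ((#) s ` {take k m | k. k \<le> length m})"
  proof (intro equalityI subsetI)
    fix q assume "q \<in> {take k (s # m) | k. k \<le> length (s # m)}"
    then obtain k where "q = take k (s # m)" "k \<le> length (s # m)" by blast
    then show "q \<in> insert [] ((#) s ` {take k m | k. k \<le> length m})"
      by (cases k) auto
  next
    fix q assume "q \<in> insert [] ((#) s ` {take k m | k. k \<le> length m})"
    then consider "q = []" | k where "q = s # take k m" "k \<le> length m" by blast
    then show "q \<in> {take k (s # m) | k. k \<le> length (s # m)}"
    proof cases
      case 1
      then show ?thesis by (auto intro!: exI[of _ 0])
    next
      case 2
      then show ?thesis by (auto intro!: exI[of _ "Suc k"])
    qed
  qed
  moreover have "points l = endpoint ` {take k l | k. k \<le> length l}" for l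
    by (auto simp: points_def)
  moreover have "endpoint [] = (0, 0)" by (simp add: endpoint_def)
  ultimately show ?thesis by (simp add: image_image)
qed

lemma mem_points_North: "(x, y) \<in> points (North # m) \<longleftrightarrow> x = 0 \<and> y = 0 \<or> 0 < y \<and> (x, y - 1) \<in> points m"
proof -
  have "points (North # m) = insert (0, 0) ((\<lambda>q. (fst q, Suc (snd q))) ` points m)"
    unfolding points_Cons by (auto simp: points_def endpoint_Cons image_iff)
  then show ?thesis by (cases y) (auto simp: image_iff intro: bexI[of _ "(x, y - 1)"])
qed

lemma mem_points_East: "(x, y) \<in> points (East # m) \<longleftrightarrow> x = 0 \<and> y = 0 \<or> 0 < x \<and> (x - 1, y) \<in> points m"
proof -
  have "points (East # m) = insert (0, 0) ((\<lambda>q. (Suc (fst q), snd q)) ` points m)"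
    unfolding points_Cons by (auto simp: points_def endpoint_Cons image_iff)
  then show ?thesis by (cases x) (auto simp: image_iff intro: bexI[of _ "(x - 1, y)"])
qed

lemma mem_points_iff:
  "(x, y) \<in> points m \<longleftrightarrow> y \<le> count_list m North \<and> (\<Sum>i<y. east_at m i) \<le> x \<and> x \<le> (\<Sum>i\<le>y. east_at m i)"
proof (induction m arbitrary: x y)
  case Nil
  then show ?case by (auto simp: points_def endpoint_def)
next
  case (Cons s m)
  show ?case
  proof (cases s)
    case North
    then show ?thesis
      by (cases y) (auto simp: mem_points_North Cons.IH sum.lessThan_Suc_shift sum.atMost_Suc_shift
          simp del: sum.lessThan_Suc sum.atMost_Suc)
  next
    case East
    then show ?thesis
      by (cases x; cases y) (auto simp: mem_points_East Cons.IH sum.distrib)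
  qed
qed

text \<open>The path p first reaches abscissa x in the lowest row whose partial sum is at least x.
  The \<open>min\<close> is there because p has no points above its last row.\<close>

lemma point_above_iff:
  "point_above p (x, y) \<longleftrightarrow> x \<le> (\<Sum>i\<le>min y (count_list p North). east_at p i)"
proof
  assume "point_above p (x, y)"
  then obtain j where j: "(x, j) \<in> points p" "j \<le> y" by (auto simp: point_above_def)
  then have "x \<le> (\<Sum>i\<le>j. east_at p i)" "j \<le> min y (count_list p North)" by (auto simp: mem_points_iff)
  then show "x \<le> (\<Sum>i\<le>min y (count_list p North). east_at p i)"
    by (meson atMost_subset_iff finite_atMost le_trans sum_mono2 zero_le)
next
  assume x: "x \<le> (\<Sum>i\<le>min y (count_list p North). east_at p i)"
  let ?P = "\<lambda>j. x \<le> (\<Sum>i\<le>j. east_at p i)"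
  define j where "j = (LEAST j. ?P j)"
  have "?P j" unfolding j_def by (rule LeastI[of ?P, OF x])
  moreover have "j \<le> min y (count_list p North)" unfolding j_def by (rule Least_le[of ?P, OF x])
  moreover have "(\<Sum>i<j. east_at p i) \<le> x"
  proof (cases j)
    case (Suc k)
    then have "\<not> ?P k" using not_less_Least[of k ?P] by (simp add: j_def)
    then show ?thesis using Suc by (simp add: lessThan_Suc_atMost)
  qed simp
  ultimately have "(x, j) \<in> points p" "j \<le> y" by (auto simp: mem_points_iff)
  then show "point_above p (x, y)" by (force simp: point_above_def)
qed

lemma horiz_eq:
  assumes "x \<le> (\<Sum>i\<le>min y (count_list p North). east_at p i)"
  shows "horiz p (x, y) = (\<Sum>i\<le>min y (count_list p North). east_at p i) - x"
proof -
  have "{h. point_above p (x + h, y)} = {..(\<Sum>i\<le>min y (count_list p North). east_at p i) - x}"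
    using assms by (auto simp: point_above_iff)
  then show ?thesis unfolding horiz_def by (simp add: Max_eq_iff)
qed

lemma count_list_append: "count_list (A @ B) s = count_list A s + count_list B s"
  by (induction A) auto

lemma nu_path_Suc: "nu_path (Suc n) e = nu_path n e @ North # replicate (e (Suc n)) East"
  by (simp add: nu_path_def)

lemma count_replicate_step: "count_list (replicate k s) t = (if s = t then k else 0)"
  by (induction k) auto

lemma count_nu_path: "count_list (nu_path n e) North = n"
  by (induction n) (auto simp: nu_path_Suc count_list_append count_replicate_step nu_path_def[of 0])

lemma east_at_replicate: "east_at (replicate k East) y = (if y = 0 then k else 0)"
  by (induction k) auto

lemma east_at_nu_path: "east_at (nu_path n e) y = (if 1 \<le> y \<and> y \<le> n then e y else 0)"
proof (induction n)
  case (Suc n)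
  then show ?case
    by (cases y "Suc n" rule: linorder_cases)
      (auto simp: nu_path_Suc east_at_append count_nu_path east_at_replicate split: nat.split)
qed (simp add: nu_path_def)

lemma sum_east_before_North:
  assumes "m = P @ North # Q"
  shows "count_list P East = (\<Sum>i\<le>count_list P North. east_at m i)"
  unfolding assms sum_east_at[symmetric] by (intro sum.cong) (auto simp: east_at_append)

lemma split_before_North:
  "i < count_list m North \<Longrightarrow> \<exists>P Q. m = P @ North # Q \<and> count_list P North = i"
proof (induction m arbitrary: i)
  case (Cons s m)
  show ?case
  proof (cases "s = North \<and> i = 0")
    case True
    then show ?thesis by (intro exI[of _ "[]"] exI[of _ m]) simp
  next
    case False
    define j where "j = (if s = North then i - 1 else i)"
    have "j < count_list m North" using Cons.prems False by (auto simp: j_def)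
    then obtain P Q where "m = P @ North # Q" "count_list P North = j" using Cons.IH by blast
    then show ?thesis using False
      by (intro exI[of _ "s # P"] exI[of _ Q]) (auto simp: j_def)
  qed
qed simp

lemma east_at_insert_East:
  "east_at (X @ [East] @ Y) t = east_at (X @ Y) t + (if t = count_list X North then 1 else 0)"
  by (auto simp: east_at_append)

section \<open>Dyck paths, rotations and the Hasse diagram in terms of row counts\<close>

locale nu_staircase =
  fixes a :: nat and \<nu> :: "nat \<Rightarrow> nat"
begin

definition N :: "nat \<Rightarrow> nat" where
  "N y = (\<Sum>i\<in>{1..y}. \<nu> i)"

sublocale staircase a N
  by unfold_locales (auto simp: N_def intro: sum_mono2)

abbreviation paths :: "step list set" where
  "paths \<equiv> dyck_paths (nu_path a \<nu>)"

abbreviation room :: "step list \<Rightarrow> nat" where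
  "room R \<equiv> horiz (nu_path a \<nu>) (endpoint R)"

lemma psum_nu_path: "(\<Sum>i\<le>y. east_at (nu_path a \<nu>) i) = N (min y a)"
proof -
  have "(\<Sum>i\<le>y. east_at (nu_path a \<nu>) i) = (\<Sum>i\<in>{1..min y a}. east_at (nu_path a \<nu>) i)"
    by (intro sum.mono_neutral_right) (auto simp: east_at_nu_path)
  then show ?thesis unfolding N_def by (simp add: east_at_nu_path)
qed

text \<open>Being weakly above \<nu> needs testing only at the last point of each row, whose
  abscissa is the partial sum of the row counts.\<close>

lemma mem_dyck_paths_iff:
  "m \<in> paths \<longleftrightarrow> count_list m North = a \<and> dyck_seq (east_at m)"
proof (cases "count_list m North = a")
  case True
  have E: "count_list (nu_path a \<nu>) East = N a"
    using psum_nu_path[of a] sum_east_at[of "nu_path a \<nu>"] by (simp add: count_nu_path)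
  have "(\<forall>q\<in>points m. point_above (nu_path a \<nu>) q) \<longleftrightarrow> (\<forall>y\<le>a. psum (east_at m) y \<le> N y)"
  proof safe
    fix y assume all: "\<forall>q\<in>points m. point_above (nu_path a \<nu>) q" and y: "y \<le> a"
    have "(psum (east_at m) y, y) \<in> points m"
      using y True by (auto simp: mem_points_iff psum_def intro: sum_mono2)
    then have "point_above (nu_path a \<nu>) (psum (east_at m) y, y)" using all by blast
    then show "psum (east_at m) y \<le> N y"
      using y by (simp add: point_above_iff count_nu_path psum_nu_path)
  next
    fix x y assume "\<forall>y\<le>a. psum (east_at m) y \<le> N y" "(x, y) \<in> points m"
    then show "point_above (nu_path a \<nu>) (x, y)"
      using True by (auto simp: mem_points_iff point_above_iff count_nu_path psum_nu_path psum_def min_def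
          dest: spec[of _ y])
  qed
  then show ?thesis
    using True E sum_east_at[of m] east_at_above[of m]
    by (auto simp: dyck_paths_def dyck_seq_def endpoint_def count_nu_path psum_def)
next
  case False
  then show ?thesis by (auto simp: dyck_paths_def endpoint_def count_nu_path)
qed

lemma dyck_paths_inject:
  assumes "m \<in> paths" "m' \<in> paths" "east_at m = east_at m'"
  shows "m = m'"
  using assms by (intro east_at_inject) (auto simp: mem_dyck_paths_iff)

text \<open>The preimage of e is \<open>nu_path a e\<close>. That path starts with a north step,
  which fits since e vanishes in row 0 because \<open>N 0 = 0\<close>.\<close>

lemma bij_betw_east_at: "bij_betw east_at paths {e. dyck_seq e}"
  unfolding bij_betw_def
proof (intro conjI equalityI subsetI)
  show "inj_on east_at paths"
    by (intro inj_onI dyck_paths_inject)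
  fix e assume e: "e \<in> {e. dyck_seq e}"
  then have "psum e 0 \<le> N 0" by (auto simp: dyck_seq_def)
  then have "e 0 = 0" by (simp add: psum_def N_def)
  then have "e i = east_at (nu_path a e) i" for i
    using e by (cases i) (auto simp: east_at_nu_path dyck_seq_def)
  then have "e = east_at (nu_path a e)" ..
  moreover from this have "nu_path a e \<in> paths"
    using e by (simp add: mem_dyck_paths_iff count_nu_path)
  ultimately show "e \<in> east_at ` paths" by blast
qed (auto simp: mem_dyck_paths_iff)

lemma horiz_prefix:
  assumes "m \<in> paths" "m = P @ Q"
  shows "count_list P North \<le> a" "count_list P East \<le> N (count_list P North)"
    and "room P = N (count_list P North) - count_list P East"
proof -
  show n: "count_list P North \<le> a"
    using assms by (auto simp: mem_dyck_paths_iff count_list_append)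
  have "endpoint P \<in> points m"
    unfolding points_def using assms(2) by (auto intro!: exI[of _ "length P"])
  then have "point_above (nu_path a \<nu>) (endpoint P)" using assms(1) by (auto simp: dyck_paths_def)
  then show "count_list P East \<le> N (count_list P North)"
    using n by (simp add: point_above_iff endpoint_def count_nu_path psum_nu_path)
  then show "room P = N (count_list P North) - count_list P East"
    using n unfolding endpoint_def by (subst horiz_eq) (auto simp: count_nu_path psum_nu_path)
qed

lemma slack_before_North:
  assumes "m \<in> paths" "m = P @ North # Q"
  shows "slack (east_at m) (count_list P North) = room P"
  using horiz_prefix(3)[OF assms] sum_east_before_North[OF assms(2)]
  by (simp add: slack_def psum_def)

lemma rotation_seq_rot:
  assumes m: "m \<in> paths" "m = A @ [East] @ M @ B" "M \<noteq> []" "hd M = North"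
    and eq: "room (A @ [East] @ M) = room (A @ [East])"
    and ne: "\<And>k. 0 < k \<Longrightarrow> k < length M \<Longrightarrow>
      room (A @ [East] @ take k M) \<noteq> room (A @ [East])"
  shows "seq_rot (east_at m) (east_at (A @ M @ [East] @ B)) (count_list A North) (count_list (A @ M) North)"
proof -
  let ?h = "\<lambda>P. room P"
  let ?P = "\<lambda>k. A @ [East] @ take k M"
  define y y' where "y = count_list A North" and "y' = count_list (A @ M) North"
  define s where "s = ?h (A @ [East])"
  obtain M' where M': "M = North # M'" using m(3,4) by (cases M) auto
  have lt: "y < y'" by (simp add: y_def y'_def count_list_append M')
  have pre: "m = ?P k @ drop k M @ B" for k
    using m(2) by (metis append.assoc append_take_drop_id)
  have h: "count_list (?P k) East \<le> N (count_list (?P k) North)"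
    "?h (?P k) = N (count_list (?P k) North) - count_list (?P k) East" for k
    using horiz_prefix(2,3)[OF m(1) pre] by blast+
  have s: "s = N y - Suc (count_list A East)" "Suc (count_list A East) \<le> N y"
    using h[of 0] by (simp_all add: s_def y_def count_list_append)
  \<comment> \<open>A step lowers \<open>horiz\<close> by at most one and the first step is north,
    so avoiding the value s means staying above it.\<close>
  have above: "s < ?h (?P k)" if "0 < k" "k < length M" for k
    using that
  proof (induction k)
    case (Suc k)
    have step: "take (Suc k) M = take k M @ [M ! k]"
      using Suc.prems by (simp add: take_Suc_conv_app_nth)
    have ge: "s \<le> ?h (?P k)"
      using Suc.IH Suc.prems by (cases "k = 0") (auto simp: s_def)
    have "s \<le> ?h (?P (Suc k))"
    proof (cases "M ! k")
      case North
      have "N (count_list (?P k) North) \<le> N (count_list (?P (Suc k)) North)"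
        by (rule N_mono) (simp add: step count_list_append)
      moreover have "count_list (?P (Suc k)) East = count_list (?P k) East"
        by (simp add: step count_list_append North)
      ultimately show ?thesis using ge unfolding h by linarith
    next
      case East
      then have "k \<noteq> 0" using M' by (auto intro: gr0I)
      then have "s < ?h (?P k)" using Suc by simp
      then show ?thesis unfolding h by (simp add: step count_list_append East)
    qed
    then show ?case using ne[OF Suc.prems] by (simp add: s_def)
  qed simp
  have sy: "slack (east_at m) y = s"
    using slack_before_North[OF m(1), of "A @ [East]" "M' @ B"] m(2) M'
    by (simp add: y_def s_def count_list_append)
  have gap: "s < slack (east_at m) i" if i: "y < i" "i < y'" for i
  proof -
    have "i - y < count_list M North" using i by (simp add: y_def y'_def count_list_append)
    then obtain X Y where XY: "M = X @ North # Y" "count_list X North = i - y"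
      using split_before_North by blast
    have "X \<noteq> []" using XY(2) i(1) by auto
    then have "s < ?h (A @ [East] @ X)" using above[of "length X"] XY(1) by simp
    also have "?h (A @ [East] @ X) = slack (east_at m) i"
      using slack_before_North[OF m(1), of "A @ [East] @ X" "Y @ B"] m(2) XY i(1)
      by (simp add: y_def count_list_append)
    finally show ?thesis .
  qed
  have y': "y' \<le> a" using horiz_prefix(1)[OF m(1) pre[of "length M"]] by (simp add: y'_def count_list_append)
  \<comment> \<open>Only an inequality, since B may continue with east steps in the same
    row.\<close>
  have end_le: "slack (east_at m) y' \<le> s"
  proof -
    have "endpoint (A @ [East] @ M) \<in> points m"
      unfolding points_def m(2) by (auto intro!: exI[of _ "length (A @ [East] @ M)"])
    then have "count_list (A @ [East] @ M) East \<le> psum (east_at m) y'"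
      by (simp add: endpoint_def mem_points_iff psum_def y'_def count_list_append)
    then have "slack (east_at m) y' \<le> N y' - count_list (A @ [East] @ M) East"
      by (simp add: slack_def)
    also have "\<dots> = s" using h(2)[of "length M"] eq by (simp add: s_def y'_def count_list_append)
    finally show ?thesis .
  qed
  have e1: "east_at m t = east_at (A @ M @ B) t + (if t = y then 1 else 0)" for t
    using east_at_insert_East[of A "M @ B" t] by (simp add: m(2) y_def)
  have e2: "east_at (A @ M @ [East] @ B) t = east_at (A @ M @ B) t + (if t = y' then 1 else 0)" for t
    using east_at_insert_East[of "A @ M" B t] by (simp add: y'_def)
  have "east_at (A @ M @ [East] @ B) = (east_at m)(y := east_at m y - 1, y' := Suc (east_at m y'))"
  proof
    fix t
    show "east_at (A @ M @ [East] @ B) t = ((east_at m)(y := east_at m y - 1, y' := Suc (east_at m y'))) t"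
      using lt e1[of t] e1[of y'] e1[of y] e2[of t] by auto
  qed
  then show ?thesis
    unfolding seq_rot_def y_def[symmetric] y'_def[symmetric]
    using lt y' gap end_le sy e1[of y] by auto
qed

text \<open>From right to left: row y has an east step, so the north step leaving the row is
  preceded by one, which gives A. The subpath M is cut off at the first point with the same
  \<open>horiz\<close>. As the target row of a rotation is determined by y, the result has the row
  counts of m'.\<close>

lemma rotation_iff_rotates:
  assumes "m \<in> paths" "m' \<in> paths"
  shows "rotation (nu_path a \<nu>) m m' \<longleftrightarrow> rotates (east_at m) (east_at m')"
proof
  assume "rotation (nu_path a \<nu>) m m'"
  then obtain A M B where *: "m = A @ [East] @ M @ B" "M \<noteq> []" "hd M = North"
    "room (A @ [East] @ M) = room (A @ [East])"
    "\<And>k. 0 < k \<Longrightarrow> k < length M \<Longrightarrow>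
      room (A @ [East] @ take k M) \<noteq> room (A @ [East])"
    "m' = A @ M @ [East] @ B"
    unfolding rotation_def by blast
  show "rotates (east_at m) (east_at m')"
    unfolding rotates_def using rotation_seq_rot[OF assms(1) *(1-5)] *(6) by blast
next
  assume "rotates (east_at m) (east_at m')"
  then obtain y y' where rot: "seq_rot (east_at m) (east_at m') y y'" by (auto simp: rotates_def)
  let ?e = "east_at m"
  have y: "y < y'" "y' \<le> a" "0 < ?e y" "slack ?e y' \<le> slack ?e y"
    "\<And>i. y < i \<Longrightarrow> i < y' \<Longrightarrow> slack ?e y < slack ?e i"
    using rot by (auto simp: seq_rot_def)
  have dy: "count_list m North = a" "dyck_seq ?e" using assms(1) by (auto simp: mem_dyck_paths_iff)
  have psum_le: "psum ?e i \<le> N i" if "i \<le> a" for i using dy(2) that by (simp add: dyck_seq_def)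
  obtain X Y where X: "m = X @ North # Y" "count_list X North = y"
    using split_before_North[of y m] y dy by auto
  have "X \<noteq> []"
    using X y(3) by auto
  \<comment> \<open>Otherwise row y would contain no east step.\<close>
  moreover have "last X \<noteq> North"
  proof
    assume "last X = North"
    then obtain X' where X': "X = X' @ [North]" using \<open>X \<noteq> []\<close> by (metis append_butlast_last_id)
    have "count_list X' East = psum ?e (count_list X' North)"
      using sum_east_before_North[of m X' "North # Y"] X(1) X' by (simp add: psum_def)
    moreover have "count_list X East = psum ?e (count_list X North)"
      using sum_east_before_North[OF X(1)] by (simp add: psum_def)
    ultimately have "?e (Suc (count_list X' North)) = 0"
      by (simp add: X' count_list_append psum_def)
    then show False using y(3) X(2) X' by (simp add: count_list_append)
  qed
  ultimately obtain A where A: "X = A @ [East]"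
    by (metis append_butlast_last_id step.exhaust)
  have yA: "y = count_list A North" using X(2) A by (simp add: count_list_append)
  define Z where "Z = North # Y"
  have mZ: "m = A @ [East] @ Z" using X A by (simp add: Z_def)
  define s where "s = slack ?e y"
  have hs: "room (A @ [East]) = s"
    using slack_before_North[OF assms(1) X(1)] A X(2) by (simp add: s_def)
  let ?Q = "\<lambda>k. 0 < k \<and> k \<le> length Z \<and> room (A @ [East] @ take k Z) = s"
  have "\<exists>k. ?Q k"
  proof -
    \<comment> \<open>The point of row y' with \<open>horiz\<close> equal to s. It lies on the path
      because slack is at least s in the row before y' and at most s in y'.\<close>
    define x where "x = N y' - s"
    have sN: "s \<le> N y'" using N_mono[of y y'] y(1) by (simp add: s_def slack_def)
    have lo: "(\<Sum>i<y'. ?e i) \<le> x"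
    proof -
      define k where "k = y' - 1"
      have k: "y' = Suc k" using y(1) by (simp add: k_def)
      have "s \<le> slack ?e k" using y(5)[of k] y(1) k by (cases "y = k") (auto simp: s_def)
      moreover have "psum ?e k \<le> N k" using psum_le k y(2) by simp
      ultimately have "psum ?e k \<le> N k - s" by (simp add: slack_def)
      also have "\<dots> \<le> x" using N_mono[of k y'] k by (simp add: x_def)
      finally show ?thesis by (simp add: k psum_def lessThan_Suc_atMost)
    qed
    have hi: "x \<le> (\<Sum>i\<le>y'. ?e i)"
      using y(4) psum_le[OF y(2)] by (simp add: x_def s_def slack_def psum_def)
    have "(x, y') \<in> points m" using lo hi y(2) dy(1) by (simp add: mem_points_iff)
    then obtain l where l: "l \<le> length m" "endpoint (take l m) = (x, y')" by (auto simp: points_def)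
    have "length (A @ [East]) < l"
    proof (rule ccontr)
      assume "\<not> ?thesis"
      moreover have "take l m = take l (A @ [East]) @ take (l - length (A @ [East])) Z"
        unfolding mZ by (metis append.assoc take_append)
      ultimately have "take l m = take l (A @ [East])" by simp
      then have "count_list (take l (A @ [East])) North = y'" using l(2) by (simp add: endpoint_def)
      moreover have "count_list (take l (A @ [East])) North \<le> count_list (A @ [East]) North"
        by (metis append_take_drop_id count_list_append le_add1)
      ultimately show False using y(1) by (simp add: yA count_list_append)
    qed
    then obtain k where k: "l = length (A @ [East]) + k" "0 < k" using less_imp_add_positive by blast
    have t: "take l m = A @ [East] @ take k Z" by (simp add: mZ k)
    have ml: "m = take l m @ drop l m" by simp
    have "room (take l m) = N y' - x"
      using horiz_prefix(3)[OF assms(1) ml] l(2) by (simp add: endpoint_def)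
    also have "\<dots> = s" using sN by (simp add: x_def)
    finally have "?Q k" using k l(1) t by (simp add: mZ)
    then show ?thesis ..
  qed
  define k where "k = (LEAST k. ?Q k)"
  have Qk: "?Q k" unfolding k_def by (rule LeastI_ex) fact
  have k_min: "\<not> ?Q i" if "i < k" for i using not_less_Least that unfolding k_def by blast
  define M B where "M = take k Z" and "B = drop k Z"
  have M: "m = A @ [East] @ M @ B" "M \<noteq> []" "hd M = North"
    using Qk by (auto simp: M_def B_def mZ) (auto simp: Z_def take_Cons')
  have h1: "room (A @ [East] @ M) = room (A @ [East])"
    using Qk hs by (simp add: M_def)
  have h2: "room (A @ [East] @ take i M) \<noteq> room (A @ [East])"
    if "0 < i" "i < length M" for i
  proof -
    have "length M = k" using Qk by (simp add: M_def)
    then have "i < k" "i \<le> length Z" "take i M = take i Z" using that Qk by (auto simp: M_def min_def)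
    then show ?thesis using k_min[of i] that(1) hs by auto
  qed
  have rot': "seq_rot ?e (east_at (A @ M @ [East] @ B)) y (count_list (A @ M) North)"
    using rotation_seq_rot[OF assms(1) M h1 h2] yA by simp
  then have "count_list (A @ M) North = y'" using seq_rot_unique[OF _ rot] by blast
  then have "east_at (A @ M @ [East] @ B) = east_at m'" using rot' rot by (simp add: seq_rot_def)
  moreover have "count_list (A @ M @ [East] @ B) North = count_list m' North"
    using dy(1) assms(2) M(1) by (simp add: mem_dyck_paths_iff count_list_append)
  ultimately have "m' = A @ M @ [East] @ B" using east_at_inject by metis
  then show "rotation (nu_path a \<nu>) m m'"
    unfolding rotation_def using assms M h1 h2 by blast
qed

lemma rotation_dyck_paths:
  "rotation p m m' \<Longrightarrow> m \<in> dyck_paths p \<and> m' \<in> dyck_paths p"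
  by (simp add: rotation_def)

lemma tamari_le_rotates:
  assumes "tamari_le (nu_path a \<nu>) m m'"
  shows "rotates\<^sup>*\<^sup>* (east_at m) (east_at m')"
  using assms unfolding tamari_le_def
proof (induction rule: rtranclp_induct)
  case (step y z)
  then have "rotates (east_at y) (east_at z)"
    using rotation_iff_rotates rotation_dyck_paths by blast
  then show ?case using step.IH by simp
qed simp

text \<open>A cover must be the first rotation of a chain realising it; conversely
  \<open>rotates_covering\<close> leaves nothing strictly between the two ends of a
  rotation.\<close>

lemma parcs_tamari_hasse:
  "parcs (tamari_hasse (nu_path a \<nu>)) = {(m, m'). rotation (nu_path a \<nu>) m m'}"
proof (intro equalityI subsetI)
  fix q assume "q \<in> parcs (tamari_hasse (nu_path a \<nu>))"
  then obtain m m' where q: "q = (m, m')" "tamari_le (nu_path a \<nu>) m m'" "m \<noteq> m'"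
    "\<And>z. z \<in> paths \<Longrightarrow> tamari_le (nu_path a \<nu>) m z \<Longrightarrow>
       tamari_le (nu_path a \<nu>) z m' \<Longrightarrow> z = m \<or> z = m'"
    by (auto simp: tamari_hasse_def hasse_diagram_def)
  obtain z where z: "rotation (nu_path a \<nu>) m z" "tamari_le (nu_path a \<nu>) z m'"
    using q(2,3) unfolding tamari_le_def by (metis converse_rtranclpE)
  have "tamari_le (nu_path a \<nu>) m z" using z(1) by (simp add: tamari_le_def)
  then have "z = m \<or> z = m'" using q(4) z rotation_dyck_paths by blast
  moreover have "z \<noteq> m"
    using z(1) rotation_iff_rotates rotation_dyck_paths rotates_irrefl by blast
  ultimately show "q \<in> {(m, m'). rotation (nu_path a \<nu>) m m'}" using z(1) q(1) by simp
next
  fix q assume "q \<in> {(m, m'). rotation (nu_path a \<nu>) m m'}"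
  then obtain m m' where q: "q = (m, m')" "rotation (nu_path a \<nu>) m m'" by blast
  have d: "m \<in> paths" "m' \<in> paths"
    using rotation_dyck_paths[OF q(2)] by auto
  have r: "rotates (east_at m) (east_at m')" using rotation_iff_rotates[OF d] q(2) by blast
  have "z = m \<or> z = m'" if "z \<in> paths" "tamari_le (nu_path a \<nu>) m z"
      "tamari_le (nu_path a \<nu>) z m'" for z
    using rotates_covering[OF r tamari_le_rotates[OF that(2)] tamari_le_rotates[OF that(3)]]
      dyck_paths_inject that(1) d by blast
  moreover have "m \<noteq> m'" using r rotates_irrefl by metis
  moreover have "tamari_le (nu_path a \<nu>) m m'" using q(2) by (simp add: tamari_le_def)
  ultimately show "q \<in> parcs (tamari_hasse (nu_path a \<nu>))"
    using d q(1) by (auto simp: tamari_hasse_def hasse_diagram_def)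
qed

end

section \<open>Triangulations from noncrossing sets\<close>

lemma minimizers_convex_hull:
  fixes A :: "'a::euclidean_space set"
  assumes "finite A" "A \<noteq> {}"
  shows "{z \<in> convex hull A. \<forall>w\<in>convex hull A. d \<bullet> z \<le> d \<bullet> w}
    = convex hull {z \<in> A. \<forall>w\<in>A. d \<bullet> z \<le> d \<bullet> w}"
proof -
  define m where "m = Min ((\<bullet>) d ` A)"
  have m_le: "m \<le> d \<bullet> z" if "z \<in> A" for z using assms that by (simp add: m_def)
  have "m \<in> (\<bullet>) d ` A" unfolding m_def using assms by (intro Min_in) auto
  then obtain z0 where z0: "z0 \<in> A" "d \<bullet> z0 = m" by auto
  have "convex hull A \<subseteq> {z. m \<le> d \<bullet> z}"
    using m_le convex_halfspace_ge[of m d] by (intro hull_minimal) (auto simp: inner_commute)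
  then have hull_le: "m \<le> d \<bullet> z" if "z \<in> convex hull A" for z using that by auto
  have L: "{z \<in> convex hull A. \<forall>w\<in>convex hull A. d \<bullet> z \<le> d \<bullet> w} = convex hull A \<inter> {z. d \<bullet> z = m}"
    using hull_le z0 hull_inc[of z0 A] by (auto intro!: antisym)
  have M: "{z \<in> A. \<forall>w\<in>A. d \<bullet> z \<le> d \<bullet> w} = {z \<in> A. d \<bullet> z = m}"
    using m_le z0 by (auto intro!: antisym)
  have "(convex hull A \<inter> {z. d \<bullet> z = m}) face_of convex hull A"
    using hull_le by (intro face_of_Int_supporting_hyperplane_ge) auto
  then obtain S where S: "S \<subseteq> A" "convex hull A \<inter> {z. d \<bullet> z = m} = convex hull S"
    using face_of_convex_hull_subset[of A] finite_imp_compact[OF assms(1)] by metis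
  have "S \<subseteq> {z \<in> A. d \<bullet> z = m}"
    using S hull_subset[of S convex] by auto
  then have "convex hull S \<subseteq> convex hull {z \<in> A. d \<bullet> z = m}" by (rule hull_mono)
  moreover have "convex hull {z \<in> A. d \<bullet> z = m} \<subseteq> convex hull A \<inter> {z. d \<bullet> z = m}"
    by (intro hull_minimal convex_Int convex_convex_hull convex_hyperplane)
      (auto intro: hull_inc)
  ultimately show ?thesis unfolding L M using S(2) by blast
qed

lemma integer_points_scale: "z \<in> integer_points \<Longrightarrow> of_int k *\<^sub>R z \<in> integer_points"
  by (auto simp: integer_points_def)

lemma integer_points_sum: "(\<And>i. i \<in> I \<Longrightarrow> f i \<in> integer_points) \<Longrightarrow> (\<Sum>i\<in>I. f i) \<in> integer_points"
  by (auto simp: integer_points_def intro!: Ints_sum)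

text \<open>What the geometry uses of the route vectors: the splitting into a column part and a row
  part, and integral functionals \<open>u x\<close> and \<open>w y\<close> that detect the column
  and the row. In the graph these are the coordinates of the first and the last edge of a
  route.\<close>

locale staircase_vectors = staircase a N for a :: nat and N :: "nat \<Rightarrow> nat" +
  fixes vec :: "nat \<times> nat \<Rightarrow> real ^ 'e::finite"
    and \<alpha> \<beta> u w :: "nat \<Rightarrow> real ^ 'e"
  assumes vec_eq: "(x, y) \<in> cells \<Longrightarrow> vec (x, y) = \<alpha> x + \<beta> y"
    and u_vec: "x \<le> N a \<Longrightarrow> (p, q) \<in> cells \<Longrightarrow> u x \<bullet> vec (p, q) = (if p = x then 1 else 0)"
    and w_vec: "y \<le> a \<Longrightarrow> (p, q) \<in> cells \<Longrightarrow> w y \<bullet> vec (p, q) = (if q = y then 1 else 0)"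
    and vec_int: "c \<in> cells \<Longrightarrow> vec c \<in> integer_points"
    and u_int: "x \<le> N a \<Longrightarrow> z \<in> integer_points \<Longrightarrow> u x \<bullet> z \<in> \<int>"
    and w_int: "y \<le> a \<Longrightarrow> z \<in> integer_points \<Longrightarrow> w y \<bullet> z \<in> \<int>"
begin

definition comb :: "(nat \<times> nat \<Rightarrow> real) \<Rightarrow> real ^ 'e" where
  "comb f = (\<Sum>p\<in>cells. f p *\<^sub>R vec p)"

abbreviation P :: "(real ^ 'e) set" where
  "P \<equiv> convex hull (vec ` cells)"

lemma cells_le: "(x, y) \<in> cells \<Longrightarrow> x \<le> N a"
  using N_mono[of y a] by auto

lemma sum_cells:
  fixes g :: "nat \<times> nat \<Rightarrow> 'b::comm_monoid_add"
  assumes "\<And>p. p \<notin> cells \<Longrightarrow> g p = 0"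
  shows "(\<Sum>p\<in>cells. g p) = (\<Sum>x\<le>N a. \<Sum>y\<le>a. g (x, y))"
proof -
  have "(\<Sum>p\<in>cells. g p) = (\<Sum>p\<in>{..N a} \<times> {..a}. g p)"
  proof (intro sum.mono_neutral_left)
    show "cells \<subseteq> {..N a} \<times> {..a}" using N_mono by (force simp: cells_def)
  qed (use assms in auto)
  then show ?thesis by (simp add: sum.cartesian_product)
qed

lemma u_comb:
  assumes "\<And>p. p \<notin> cells \<Longrightarrow> f p = 0" "x \<le> N a"
  shows "u x \<bullet> comb f = (\<Sum>y\<le>a. f (x, y))"
proof -
  have "u x \<bullet> comb f = (\<Sum>p\<in>cells. if fst p = x then f p else 0)"
    unfolding comb_def inner_sum_right
    by (intro sum.cong) (auto simp: u_vec[OF assms(2)] simp del: cells_iff)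
  also have "\<dots> = (\<Sum>x'\<le>N a. \<Sum>y\<le>a. if x' = x then f (x', y) else 0)"
    using assms(1) by (subst sum_cells) auto
  also have "\<dots> = (\<Sum>x'\<le>N a. if x' = x then (\<Sum>y\<le>a. f (x, y)) else 0)"
    by (intro sum.cong) auto
  finally show ?thesis using assms(2) by simp
qed

lemma w_comb:
  assumes "\<And>p. p \<notin> cells \<Longrightarrow> f p = 0" "y \<le> a"
  shows "w y \<bullet> comb f = (\<Sum>x\<le>N a. f (x, y))"
proof -
  have "w y \<bullet> comb f = (\<Sum>p\<in>cells. if snd p = y then f p else 0)"
    unfolding comb_def inner_sum_right
    by (intro sum.cong) (auto simp: w_vec[OF assms(2)] simp del: cells_iff)
  also have "\<dots> = (\<Sum>x\<le>N a. \<Sum>y'\<le>a. if y' = y then f (x, y') else 0)"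
    using assms(1) by (subst sum_cells) auto
  finally show ?thesis using assms(2) by simp
qed

text \<open>Since only the marginals matter, coefficients may be replaced by noncrossing ones with
  the same marginals.\<close>

lemma comb_marginals:
  assumes "\<And>p. p \<notin> cells \<Longrightarrow> f p = 0"
  shows "comb f = (\<Sum>x\<le>N a. (\<Sum>y\<le>a. f (x, y)) *\<^sub>R \<alpha> x) + (\<Sum>y\<le>a. (\<Sum>x\<le>N a. f (x, y)) *\<^sub>R \<beta> y)"
proof -
  have "comb f = (\<Sum>p\<in>cells. f p *\<^sub>R (\<alpha> (fst p) + \<beta> (snd p)))"
    unfolding comb_def by (intro sum.cong) (auto simp: vec_eq simp del: cells_iff)
  also have "\<dots> = (\<Sum>x\<le>N a. \<Sum>y\<le>a. f (x, y) *\<^sub>R (\<alpha> x + \<beta> y))"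
    using assms by (subst sum_cells) auto
  also have "\<dots> = (\<Sum>x\<le>N a. \<Sum>y\<le>a. f (x, y) *\<^sub>R \<alpha> x) + (\<Sum>x\<le>N a. \<Sum>y\<le>a. f (x, y) *\<^sub>R \<beta> y)"
    by (simp add: scaleR_add_right sum.distrib)
  also have "(\<Sum>x\<le>N a. \<Sum>y\<le>a. f (x, y) *\<^sub>R \<beta> y) = (\<Sum>y\<le>a. \<Sum>x\<le>N a. f (x, y) *\<^sub>R \<beta> y)"
    by (rule sum.swap)
  finally show ?thesis by (simp add: scaleR_sum_left)
qed

lemma inj_on_vec: "inj_on vec cells"
proof (rule inj_onI)
  fix p q assume pq: "p \<in> cells" "q \<in> cells" "vec p = vec q"
  obtain x y x' y' where eq: "p = (x, y)" "q = (x', y')" by fastforce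
  have c: "(x, y) \<in> cells" "(x', y') \<in> cells" "vec (x, y) = vec (x', y')" using pq eq by auto
  have b: "x \<le> N a" "y \<le> a" using c(1) cells_le by auto
  have "(1::real) = (if x' = x then 1 else 0)"
    using u_vec[OF b(1) c(1)] u_vec[OF b(1) c(2)] unfolding c(3) by simp
  moreover have "(1::real) = (if y' = y then 1 else 0)"
    using w_vec[OF b(2) c(1)] w_vec[OF b(2) c(2)] unfolding c(3) by simp
  ultimately show "p = q" unfolding eq by (metis zero_neq_one)
qed

lemma inj_on_vec_noncrossing: "noncrossing C \<Longrightarrow> inj_on vec C"
  using inj_on_vec inj_on_subset unfolding noncrossing_def by blast

lemma sum_column:
  assumes "C \<subseteq> cells" "x \<le> N a"
  shows "u x \<bullet> (\<Sum>p\<in>C. c p *\<^sub>R vec p) = (\<Sum>p\<in>{p\<in>C. fst p = x}. c p)"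
proof -
  have "u x \<bullet> (\<Sum>p\<in>C. c p *\<^sub>R vec p) = (\<Sum>p\<in>C. if fst p = x then c p else 0)"
    unfolding inner_sum_right
    by (intro sum.cong) (use assms(1) u_vec[OF assms(2)] in \<open>auto simp del: cells_iff\<close>)
  then show ?thesis
    using finite_subset[OF assms(1) finite_cells] by (simp add: sum.If_cases Int_def)
qed

lemma sum_row:
  assumes "C \<subseteq> cells" "y \<le> a"
  shows "w y \<bullet> (\<Sum>p\<in>C. c p *\<^sub>R vec p) = (\<Sum>p\<in>{p\<in>C. snd p = y}. c p)"
proof -
  have "w y \<bullet> (\<Sum>p\<in>C. c p *\<^sub>R vec p) = (\<Sum>p\<in>C. if snd p = y then c p else 0)"
    unfolding inner_sum_right
    by (intro sum.cong) (use assms(1) w_vec[OF assms(2)] in \<open>auto simp del: cells_iff\<close>)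
  then show ?thesis
    using finite_subset[OF assms(1) finite_cells] by (simp add: sum.If_cases Int_def)
qed

lemma noncrossing_coefficients:
  assumes C: "noncrossing C" and H: "0 \<in> H" "\<And>r s. r \<in> H \<Longrightarrow> s \<in> H \<Longrightarrow> r - s \<in> H"
    and "\<And>x. x \<le> N a \<Longrightarrow> u x \<bullet> (\<Sum>p\<in>C. c p *\<^sub>R vec p) \<in> H"
    and "\<And>y. y \<le> a \<Longrightarrow> w y \<bullet> (\<Sum>p\<in>C. c p *\<^sub>R vec p) \<in> H"
    and "p \<in> C"
  shows "c p \<in> H"
proof -
  have sub: "C \<subseteq> cells" using C by (simp add: noncrossing_def)
  have "(\<Sum>p\<in>{p\<in>C. fst p = x}. c p) \<in> H" for x
  proof (cases "x \<le> N a")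
    case True
    then show ?thesis using assms(4)[OF True] sum_column[OF sub True] by simp
  next
    case False
    then have "{p\<in>C. fst p = x} = {}" using noncrossing_bounds[OF C] by auto
    then show ?thesis using H(1) by (simp only: sum.empty)
  qed
  moreover have "(\<Sum>p\<in>{p\<in>C. snd p = y}. c p) \<in> H" for y
  proof (cases "y \<le> a")
    case True
    then show ?thesis using assms(5)[OF True] sum_row[OF sub True] by simp
  next
    case False
    then have "{p\<in>C. snd p = y} = {}" using noncrossing_bounds[OF C] by auto
    then show ?thesis using H(1) by (simp only: sum.empty)
  qed
  ultimately show ?thesis using marginals_subgroup[OF C H(1), of c] H(2) assms(6) by blast
qed

text \<open>Linear and not just affine independence, so that \<open>maximal_supported\<close> can
  prescribe a linear functional on these vectors.\<close>

lemma independent_vec: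
  assumes C: "noncrossing C"
  shows "independent (vec ` C)"
proof (rule independent_if_scalars_zero)
  show "finite (vec ` C)" using noncrossing_finite[OF C] by simp
  fix f v assume f: "(\<Sum>v\<in>vec ` C. f v *\<^sub>R v) = 0" "v \<in> vec ` C"
  then obtain p where p: "p \<in> C" "v = vec p" by auto
  have 0: "(\<Sum>p\<in>C. f (vec p) *\<^sub>R vec p) = 0"
    using f(1) by (simp add: sum.reindex[OF inj_on_vec_noncrossing[OF C]])
  have "f (vec p) \<in> {0}"
    by (rule noncrossing_coefficients[OF C, where c = "\<lambda>p. f (vec p)"]) (use p 0 in auto)
  then show "f v = 0" using p by simp
qed

lemma affine_independent_vec: "noncrossing C \<Longrightarrow> \<not> affine_dependent (vec ` C)"
  using independent_vec affine_dependent_imp_dependent by blast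

lemma card_vec: "noncrossing C \<Longrightarrow> card (vec ` C) = card C"
  using inj_on_vec_noncrossing card_image by blast

lemma in_hull_iff:
  assumes "C \<subseteq> cells"
  shows "z \<in> convex hull (vec ` C) \<longleftrightarrow>
    (\<exists>f. (\<forall>p. 0 \<le> f p) \<and> (\<forall>p. p \<notin> C \<longrightarrow> f p = 0) \<and> (\<Sum>p\<in>cells. f p) = 1 \<and> z = comb f)"
proof
  have fin: "finite C" using assms finite_cells finite_subset by blast
  have inj: "inj_on vec C" using inj_on_vec assms inj_on_subset by blast
  assume "z \<in> convex hull (vec ` C)"
  then obtain g where g: "\<forall>v\<in>vec ` C. 0 \<le> g v" "sum g (vec ` C) = 1" "(\<Sum>v\<in>vec ` C. g v *\<^sub>R v) = z"
    using fin by (auto simp: convex_hull_finite)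
  define f where "f p = (if p \<in> C then g (vec p) else 0)" for p
  have "(\<Sum>p\<in>cells. f p) = (\<Sum>p\<in>C. f p)"
    using assms finite_cells by (intro sum.mono_neutral_right) (auto simp: f_def)
  also have "\<dots> = 1" using g(2) by (simp add: sum.reindex[OF inj] f_def)
  finally have 1: "(\<Sum>p\<in>cells. f p) = 1" .
  have "comb f = (\<Sum>p\<in>C. f p *\<^sub>R vec p)"
    unfolding comb_def using assms finite_cells by (intro sum.mono_neutral_right) (auto simp: f_def)
  also have "\<dots> = z" using g(3) by (simp add: sum.reindex[OF inj] f_def)
  finally show "\<exists>f. (\<forall>p. 0 \<le> f p) \<and> (\<forall>p. p \<notin> C \<longrightarrow> f p = 0) \<and> (\<Sum>p\<in>cells. f p) = 1 \<and> z = comb f"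
    using 1 g(1) by (intro exI[of _ f]) (auto simp: f_def)
next
  have fin: "finite C" using assms finite_cells finite_subset by blast
  assume "\<exists>f. (\<forall>p. 0 \<le> f p) \<and> (\<forall>p. p \<notin> C \<longrightarrow> f p = 0) \<and> (\<Sum>p\<in>cells. f p) = 1 \<and> z = comb f"
  then obtain f where f: "\<forall>p. 0 \<le> f p" "\<forall>p. p \<notin> C \<longrightarrow> f p = 0" "(\<Sum>p\<in>cells. f p) = 1" "z = comb f"
    by blast
  have "(\<Sum>p\<in>C. f p) = 1"
    unfolding f(3)[symmetric] using f(2) assms finite_cells by (intro sum.mono_neutral_left) auto
  moreover have "z = (\<Sum>p\<in>C. f p *\<^sub>R vec p)"
    unfolding f(4) comb_def using f(2) assms finite_cells by (intro sum.mono_neutral_right) auto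
  ultimately show "z \<in> convex hull (vec ` C)"
    using f(1) by (simp only:) (rule convex_sum[OF fin convex_convex_hull], auto intro: hull_inc)
qed

lemma noncrossing_comb_unique:
  assumes C: "noncrossing C" and D: "noncrossing D"
    and f: "\<And>p. 0 \<le> f p" "\<And>p. p \<notin> C \<Longrightarrow> f p = 0"
    and g: "\<And>p. 0 \<le> g p" "\<And>p. p \<notin> D \<Longrightarrow> g p = 0"
    and eq: "comb f = comb g"
  shows "f = g"
proof -
  have f0: "f p = 0" if "p \<notin> cells" for p using that f(2) C unfolding noncrossing_def by blast
  have g0: "g p = 0" if "p \<notin> cells" for p using that g(2) D unfolding noncrossing_def by blast
  show ?thesis
  proof (rule noncrossing_marginals_unique[OF C D f g])
    fix x assume x: "x \<le> N a"
    show "(\<Sum>y\<le>a. f (x, y)) = (\<Sum>y\<le>a. g (x, y))"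
      using u_comb[of f, OF f0 x] u_comb[of g, OF g0 x] eq by simp
  next
    fix y assume y: "y \<le> a"
    show "(\<Sum>x\<le>N a. f (x, y)) = (\<Sum>x\<le>N a. g (x, y))"
      using w_comb[of f, OF f0 y] w_comb[of g, OF g0 y] eq by simp
  qed auto
qed

text \<open>Noncrossing combinations are unique, so a common point has the same coefficients in both
  hulls, and they are supported on the intersection.\<close>

lemma hull_Int:
  assumes C: "noncrossing C" and D: "noncrossing D"
  shows "convex hull (vec ` C) \<inter> convex hull (vec ` D) = convex hull (vec ` (C \<inter> D))"
proof
  have sub: "C \<subseteq> cells" "D \<subseteq> cells" "C \<inter> D \<subseteq> cells" using C D by (auto simp: noncrossing_def)
  show "convex hull (vec ` C) \<inter> convex hull (vec ` D) \<subseteq> convex hull (vec ` (C \<inter> D))"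
  proof
    fix z assume z: "z \<in> convex hull (vec ` C) \<inter> convex hull (vec ` D)"
    obtain f where f: "\<forall>p. 0 \<le> f p" "\<forall>p. p \<notin> C \<longrightarrow> f p = 0" "(\<Sum>p\<in>cells. f p) = 1" "z = comb f"
      using z in_hull_iff[OF sub(1)] by blast
    obtain g where g: "\<forall>p. 0 \<le> g p" "\<forall>p. p \<notin> D \<longrightarrow> g p = 0" "z = comb g"
      using z in_hull_iff[OF sub(2)] by blast
    have "f = g" by (rule noncrossing_comb_unique[OF C D]) (use f g in auto)
    then have "\<forall>p. p \<notin> C \<inter> D \<longrightarrow> f p = 0" using f(2) g(2) by auto
    then show "z \<in> convex hull (vec ` (C \<inter> D))" using in_hull_iff[OF sub(3)] f by blast
  qed
  show "convex hull (vec ` (C \<inter> D)) \<subseteq> convex hull (vec ` C) \<inter> convex hull (vec ` D)"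
    by (simp add: hull_mono image_mono)
qed

lemma vec_in_hull_iff:
  assumes C: "noncrossing C" and p: "p \<in> cells"
  shows "vec p \<in> convex hull (vec ` C) \<longleftrightarrow> p \<in> C"
proof
  assume v: "vec p \<in> convex hull (vec ` C)"
  have nc: "noncrossing {p}" using p by (auto simp: noncrossing_def)
  have "vec p \<in> convex hull (vec ` {p}) \<inter> convex hull (vec ` C)" using v by simp
  then have "convex hull (vec ` ({p} \<inter> C)) \<noteq> {}" unfolding hull_Int[OF nc C] by blast
  then show "p \<in> C" by auto
qed (auto intro: hull_inc)

lemma hull_eq_iff:
  assumes C: "noncrossing C" and D: "noncrossing D"
  shows "convex hull (vec ` C) = convex hull (vec ` D) \<longleftrightarrow> C = D"
proof
  assume eq: "convex hull (vec ` C) = convex hull (vec ` D)"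
  have "p \<in> C \<longleftrightarrow> p \<in> D" if "p \<in> cells" for p
    using vec_in_hull_iff[OF C that] vec_in_hull_iff[OF D that] eq by simp
  then show "C = D" using C D unfolding noncrossing_def by blast
qed simp

lemma comb_in_noncrossing_hull:
  assumes "\<And>p. 0 \<le> g p" "noncrossing {p. g p \<noteq> 0}" "(\<Sum>p\<in>cells. g p) = 1"
  shows "\<exists>C. maximal C \<and> comb g \<in> convex hull (vec ` C)"
proof -
  obtain C where C: "maximal C" "{p. g p \<noteq> 0} \<subseteq> C"
    using noncrossing_extend[OF assms(2)] .
  have "C \<subseteq> cells" using maximalD[OF C(1)] by (simp add: noncrossing_def)
  moreover have "\<forall>p. p \<notin> C \<longrightarrow> g p = 0" using C(2) by blast
  ultimately have "comb g \<in> convex hull (vec ` C)"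
    using in_hull_iff[of C "comb g"] assms(1,3) by blast
  then show ?thesis using C(1) by blast
qed

text \<open>The transport with the marginals of the given coefficients is feasible because these
  live on cells: rows up to k meet only columns up to N k.\<close>

lemma hull_covered:
  assumes "z \<in> P"
  shows "\<exists>C. maximal C \<and> z \<in> convex hull (vec ` C)"
proof -
  obtain f where f: "\<And>p. 0 \<le> f p" "\<And>p. p \<notin> cells \<Longrightarrow> f p = 0" "(\<Sum>p\<in>cells. f p) = 1" "z = comb f"
    using assms in_hull_iff[of cells z] by blast
  define U W where "U x = (\<Sum>y\<le>a. f (x, y))" and "W y = (\<Sum>x\<le>N a. f (x, y))" for x y
  have total: "(\<Sum>x\<le>N a. U x) = 1" using sum_cells[of f] f(2,3) by (simp add: U_def)
  have "\<exists>g. (\<forall>p. 0 \<le> g p) \<and> noncrossing {p. g p \<noteq> 0} \<and>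
     (\<forall>x\<le>N a. (\<Sum>y\<le>a. g (x, y)) = U x) \<and> (\<forall>y\<le>a. (\<Sum>x\<le>N a. g (x, y)) = W y)"
  proof (rule noncrossing_transport_exists)
    show "(\<Sum>x\<le>N a. U x) = (\<Sum>y\<le>a. W y)" unfolding U_def W_def by (rule sum.swap)
    fix k assume k: "k \<le> a"
    have "W y = (\<Sum>x\<le>N k. f (x, y))" if "y \<le> k" for y
      unfolding W_def
    proof (rule sum.mono_neutral_right)
      show "{..N k} \<subseteq> {..N a}" using N_mono[OF k] by auto
      show "\<forall>x\<in>{..N a} - {..N k}. f (x, y) = 0"
      proof
        fix x assume "x \<in> {..N a} - {..N k}"
        then have "(x, y) \<notin> cells" using N_mono[OF that] by auto
        then show "f (x, y) = 0" using f(2) by blast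
      qed
    qed simp
    then have "(\<Sum>y\<le>k. W y) = (\<Sum>y\<le>k. \<Sum>x\<le>N k. f (x, y))" by simp
    also have "\<dots> = (\<Sum>x\<le>N k. \<Sum>y\<le>k. f (x, y))" by (rule sum.swap)
    also have "\<dots> \<le> (\<Sum>x\<le>N k. U x)"
      unfolding U_def using k f(1) by (intro sum_mono sum_mono2) auto
    finally show "(\<Sum>y\<le>k. W y) \<le> (\<Sum>x\<le>N k. U x)" .
  qed (use f(1) in \<open>auto simp: U_def W_def intro: sum_nonneg\<close>)
  then obtain g where g: "\<And>p. 0 \<le> g p" "noncrossing {p. g p \<noteq> 0}"
     "\<And>x. x \<le> N a \<Longrightarrow> (\<Sum>y\<le>a. g (x, y)) = U x" "\<And>y. y \<le> a \<Longrightarrow> (\<Sum>x\<le>N a. g (x, y)) = W y"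
    by blast
  have g0: "g p = 0" if "p \<notin> cells" for p using g(2) that unfolding noncrossing_def by blast
  have "(\<Sum>p\<in>cells. g p) = 1" using total g(3) by (subst sum_cells[OF g0]) auto
  moreover have "comb g = z"
    unfolding f(4) by (subst (1 2) comb_marginals) (use f(2) g0 in \<open>simp_all add: g(3,4) U_def W_def\<close>)
  ultimately show ?thesis using comb_in_noncrossing_hull[OF g(1,2)] by simp
qed

section \<open>The triangulation, its dimension and its unimodularity\<close>

definition tri :: "(real ^ 'e) set set" where
  "tri = {convex hull (vec ` C) | C. maximal C}"

lemma aff_dim_hull:
  assumes "maximal C"
  shows "aff_dim (convex hull (vec ` C)) = int (N a + a)"
  using affine_independent_vec[OF maximalD[OF assms]] card_maximal[OF assms]
    card_vec[OF maximalD[OF assms]]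
  by (simp add: aff_dim_convex_hull affine_independent_iff_card)

lemma maximal_exists: "\<exists>C. maximal C"
  using noncrossing_extend[of "{}"] by (auto simp: noncrossing_def)

lemma hull_subset_P: "noncrossing C \<Longrightarrow> convex hull (vec ` C) \<subseteq> P"
  by (intro hull_mono image_mono) (simp add: noncrossing_def)

text \<open>The top row and column 0 have \<open>N a + a + 1\<close> cells together and span
  everything affinely, because
  \<open>vec (x, y) = vec (x, a) + vec (0, y) - vec (0, a)\<close>.\<close>

lemma aff_dim_P: "aff_dim P = int (N a + a)"
proof (rule antisym)
  define S where "S = (\<lambda>x. (x, a)) ` {..N a} \<union> (\<lambda>y. (0, y)) ` {..<a}"
  have "card S \<le> card ((\<lambda>x. (x, a)) ` {..N a}) + card ((\<lambda>y. (0::nat, y)) ` {..<a})"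
    unfolding S_def by (rule card_Un_le)
  also have "\<dots> \<le> N a + 1 + a"
    using card_image_le[of "{..N a}" "\<lambda>x. (x, a)"] card_image_le[of "{..<a}" "\<lambda>y. (0::nat, y)"] by simp
  finally have cS: "card S \<le> N a + 1 + a" .
  have top: "vec (x, a) \<in> affine hull (vec ` S)" if "x \<le> N a" for x
    using that by (intro hull_inc) (auto simp: S_def)
  have zero: "vec (0, y) \<in> affine hull (vec ` S)" if "y \<le> a" for y
    using that by (intro hull_inc) (cases "y = a"; auto simp: S_def)
  have "vec ` cells \<subseteq> affine hull (vec ` S)"
  proof clarify
    fix x y assume xy: "(x, y) \<in> cells"
    then have b: "x \<le> N a" "y \<le> a" using cells_le[of x y] by auto
    have "vec (x, y) = 1 *\<^sub>R vec (x, a) + 1 *\<^sub>R vec (0, y) + (- 1) *\<^sub>R vec (0, a)"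
      using b vec_eq[OF xy] by (simp add: vec_eq)
    also have "\<dots> \<in> affine hull (vec ` S)"
    proof -
      have "1 *\<^sub>R vec (x, a) + 1 *\<^sub>R (vec (0, y) - vec (0, a)) \<in> affine hull (vec ` S)"
        using mem_affine_3_minus[OF affine_affine_hull top[OF b(1)] zero[OF b(2)] zero[of a], of 1] by simp
      then show ?thesis by (simp add: algebra_simps)
    qed
    finally show "vec (x, y) \<in> affine hull (vec ` S)" .
  qed
  then have "aff_dim (vec ` cells) \<le> aff_dim (vec ` S)"
    by (metis aff_dim_affine_hull aff_dim_subset)
  also have "\<dots> \<le> int (card (vec ` S)) - 1"
    by (rule aff_dim_le_card) (simp add: S_def)
  also have "\<dots> \<le> int (card S) - 1" using card_image_le[of S vec] by (simp add: S_def)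
  finally show "aff_dim P \<le> int (N a + a)" using cS by (simp add: aff_dim_convex_hull)
next
  obtain C where "maximal C" using maximal_exists by blast
  then show "int (N a + a) \<le> aff_dim P"
    using aff_dim_hull aff_dim_subset[OF hull_subset_P] maximalD by metis
qed

lemma triangulation_of_tri: "triangulation_of P tri"
  unfolding triangulation_of_def triangulation_def
proof (intro conjI allI impI ballI)
  have "tri \<subseteq> (\<lambda>C. convex hull (vec ` C)) ` Pow cells"
    by (auto simp: tri_def maximal_def noncrossing_def)
  then show "finite tri" using finite_cells finite_subset by blast
  have simp_tri: "aff_dim P simplex S" if S: "S \<in> tri" for S
  proof -
    obtain C where C: "maximal C" "S = convex hull (vec ` C)" using S by (auto simp: tri_def)
    note nc = maximalD[OF C(1)]
    show ?thesis
      unfolding simplex_def aff_dim_P C(2)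
      using affine_independent_vec[OF nc] card_vec[OF nc] card_maximal[OF C(1)]
      by (intro exI[of _ "vec ` C"]) auto
  qed
  then show "\<exists>n. n simplex S" "aff_dim P simplex S" if "S \<in> tri" for S using that by blast+
  show "(S \<inter> S') face_of S" if S: "S \<in> tri \<and> S' \<in> tri" for S S'
  proof -
    obtain C D where CD: "maximal C" "S = convex hull (vec ` C)"
      "maximal D" "S' = convex hull (vec ` D)" using S by (auto simp: tri_def)
    note nc = maximalD[OF CD(1)] maximalD[OF CD(3)]
    show ?thesis
      unfolding CD(2,4) hull_Int[OF nc] face_of_convex_hull_affine_independent[OF affine_independent_vec[OF nc(1)]]
      by (intro exI[of _ "vec ` (C \<inter> D)"]) auto
  qed
  show "\<Union> tri = P"
  proof
    show "\<Union> tri \<subseteq> P" using hull_subset_P maximalD by (fastforce simp: tri_def)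
    show "P \<subseteq> \<Union> tri" using hull_covered by (fastforce simp: tri_def)
  qed
qed


lemma affine_hull_max:
  assumes C: "maximal C"
  shows "affine hull (vec ` C) = affine hull P"
proof -
  note nc = maximalD[OF C]
  have "vec ` C \<subseteq> P" using hull_subset_P[OF nc] hull_subset[of "vec ` C" convex] by blast
  moreover have "aff_dim (vec ` C) = aff_dim P"
    using aff_dim_hull[OF C] aff_dim_P by (simp add: aff_dim_convex_hull)
  ultimately have "affine hull (vec ` C) = affine hull P" using aff_dim_eq_full_gen by metis
  then show ?thesis .
qed

lemma unimodular_simplex_hull:
  assumes C: "maximal C"
  shows "unimodular_simplex (integer_points \<inter> affine hull P) (convex hull (vec ` C))"
proof -
  note nc = maximalD[OF C]
  have sub: "C \<subseteq> cells" using nc by (simp add: noncrossing_def)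
  define \<Lambda> V where "\<Lambda> = integer_points \<inter> affine hull P" and "V = vec ` C"
  have fin: "finite V" using noncrossing_finite[OF nc] by (simp add: V_def)
  have inj: "inj_on vec C" by (rule inj_on_vec_noncrossing[OF nc])
  have affV: "affine hull V = affine hull P" using affine_hull_max[OF C] by (simp add: V_def)
  have V\<Lambda>: "V \<subseteq> \<Lambda>"
    unfolding \<Lambda>_def affV[symmetric] using sub vec_int hull_subset[of V affine] by (auto simp: V_def simp del: cells_iff)
  obtain v0 where v0: "v0 \<in> V" using maximal_corner[OF C] by (auto simp: V_def)
  have "(\<lambda>x. x - v0) ` \<Lambda> = range (\<lambda>k :: real ^ 'e \<Rightarrow> int. \<Sum>v\<in>V - {v0}. of_int (k v) *\<^sub>R (v - v0))"
  proof (intro equalityI subsetI)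
    fix r assume "r \<in> (\<lambda>x. x - v0) ` \<Lambda>"
    then obtain z where z: "r = z - v0" "z \<in> integer_points" "z \<in> affine hull V"
      unfolding \<Lambda>_def affV[symmetric] by blast
    obtain c where c: "sum c V = 1" "(\<Sum>v\<in>V. c v *\<^sub>R v) = z"
      using z(3) by (auto simp: affine_hull_finite[OF fin])
    have zC: "(\<Sum>p\<in>C. c (vec p) *\<^sub>R vec p) = z"
      using c(2) unfolding V_def by (simp add: sum.reindex[OF inj])
    \<comment> \<open>The row and column sums of the coefficients are coordinates of z, hence
      integers.\<close>
    have "c v \<in> \<int>" if "v \<in> V" for v
    proof -
      obtain p where p: "p \<in> C" "v = vec p" using \<open>v \<in> V\<close> by (auto simp: V_def)
      have "c (vec p) \<in> \<int>"
        by (rule noncrossing_coefficients[OF nc, where c = "\<lambda>p. c (vec p)"])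
          (use p zC z(2) u_int w_int in auto)
      then show ?thesis using p by simp
    qed
    then have fl: "of_int \<lfloor>c v\<rfloor> = c v" if "v \<in> V" for v using that by (metis Ints_cases floor_of_int)
    have "r = (\<Sum>v\<in>V - {v0}. c v *\<^sub>R (v - v0))"
    proof -
      have "r = (\<Sum>v\<in>V. c v *\<^sub>R (v - v0))"
        unfolding z(1) c(2)[symmetric] scaleR_diff_right sum_subtractf
        by (simp add: scaleR_sum_left[symmetric] c(1))
      also have "\<dots> = (\<Sum>v\<in>V - {v0}. c v *\<^sub>R (v - v0))"
        using sum.remove[OF fin v0, of "\<lambda>v. c v *\<^sub>R (v - v0)"] by simp
      finally show ?thesis .
    qed
    also have "\<dots> = (\<Sum>v\<in>V - {v0}. of_int \<lfloor>c v\<rfloor> *\<^sub>R (v - v0))"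
      by (intro sum.cong refl) (simp only: Diff_iff fl)
    finally have "r = (\<Sum>v\<in>V - {v0}. of_int \<lfloor>c v\<rfloor> *\<^sub>R (v - v0))" .
    then show "r \<in> range (\<lambda>k :: real ^ 'e \<Rightarrow> int. \<Sum>v\<in>V - {v0}. of_int (k v) *\<^sub>R (v - v0))"
      by (intro image_eqI[of _ _ "\<lambda>v. \<lfloor>c v\<rfloor>"]) auto
  next
    fix r assume "r \<in> range (\<lambda>k :: real ^ 'e \<Rightarrow> int. \<Sum>v\<in>V - {v0}. of_int (k v) *\<^sub>R (v - v0))"
    then obtain k :: "real ^ 'e \<Rightarrow> int" where r: "r = (\<Sum>v\<in>V - {v0}. of_int (k v) *\<^sub>R (v - v0))" by blast
    have "subspace ((\<lambda>x. x - v0) ` (affine hull V))"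
      by (rule affine_diffs_subspace_subtract) (use v0 in \<open>auto intro: hull_inc\<close>)
    then have "r \<in> (\<lambda>x. x - v0) ` (affine hull V)"
      unfolding r by (intro subspace_sum subspace_scale) (auto intro: hull_inc)
    moreover have "r + v0 \<in> integer_points"
    proof -
      have vi: "v \<in> integer_points" if "v \<in> V" for v using V\<Lambda> that by (auto simp: \<Lambda>_def)
      have "v - v0 \<in> integer_points" if "v \<in> V" for v
        using vi[OF that] vi[OF v0] by (auto simp: integer_points_def)
      then have "r \<in> integer_points"
        unfolding r by (intro integer_points_sum integer_points_scale) auto
      then show ?thesis using vi[OF v0] by (auto simp: integer_points_def)
    qed
    ultimately show "r \<in> (\<lambda>x. x - v0) ` \<Lambda>"
      unfolding \<Lambda>_def affV[symmetric] by (auto simp: image_iff)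
  qed
  then show ?thesis
    unfolding unimodular_simplex_def \<Lambda>_def[symmetric] V_def[symmetric]
    using affine_independent_vec[OF nc] V\<Lambda> v0 by (auto simp: V_def[symmetric])
qed

lemma unimodular_triangulation_tri: "unimodular_triangulation P tri"
  using triangulation_of_tri unimodular_simplex_hull
  by (auto simp: unimodular_triangulation_def tri_def)

section \<open>Vertices and regularity\<close>

lemma extreme_points_P: "{v. v extreme_point_of P} = vec ` cells"
proof (rule extreme_points_of_convex_hull_eq)
  show "compact (vec ` cells)" using finite_cells by (simp add: finite_imp_compact)
  fix T assume T: "T \<subset> vec ` cells"
  then obtain v where "v \<in> vec ` cells" "v \<notin> T" by blast
  then obtain x y where xy: "(x, y) \<in> cells" "vec (x, y) \<notin> T" by fast
  then have b: "x \<le> N a" "y \<le> a" using cells_le by auto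
  \<comment> \<open>This functional is 2 at \<open>vec (x, y)\<close> and at most 1 at the other
    vertices, since a different cell shares at most one of column and row.\<close>
  have "T \<subseteq> {z. (u x + w y) \<bullet> z \<le> 1}"
  proof
    fix z assume z: "z \<in> T"
    then have "z \<in> vec ` cells" using T by blast
    then obtain p q where pq: "(p, q) \<in> cells" "z = vec (p, q)" by fast
    then have "(p, q) \<noteq> (x, y)" using z xy(2) by auto
    then show "z \<in> {z. (u x + w y) \<bullet> z \<le> 1}"
      using u_vec[OF b(1) pq(1)] w_vec[OF b(2) pq(1)] pq(2) by (auto simp: inner_add_left)
  qed
  then have "convex hull T \<subseteq> {z. (u x + w y) \<bullet> z \<le> 1}"
    by (intro hull_minimal convex_halfspace_le)
  moreover have "\<not> (u x + w y) \<bullet> vec (x, y) \<le> 1"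
    using u_vec[OF b(1) xy(1)] w_vec[OF b(2) xy(1)] by (simp add: inner_add_left)
  moreover have "vec (x, y) \<in> P" using xy(1) by (auto intro: hull_inc simp del: cells_iff)
  ultimately show "convex hull T \<noteq> P" by blast
qed

text \<open>Regularity asks for heights as a function of points, so column and row numbers are
  recovered by linear functionals and multiplied.\<close>

definition weight :: "real ^ 'e \<Rightarrow> real" where
  "weight z = (\<Sum>x\<le>N a. real x * (u x \<bullet> z)) * (\<Sum>y\<le>a. real y * (w y \<bullet> z))"

lemma weight_vec:
  assumes "(x, y) \<in> cells"
  shows "weight (vec (x, y)) = real x * real y"
proof -
  have b: "x \<le> N a" "y \<le> a" using assms cells_le by auto
  have "(\<Sum>x'\<le>N a. real x' * (u x' \<bullet> vec (x, y))) = (\<Sum>x'\<le>N a. if x' = x then real x else 0)"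
    using u_vec assms by (intro sum.cong) (auto simp del: cells_iff)
  moreover have "(\<Sum>y'\<le>a. real y' * (w y' \<bullet> vec (x, y))) = (\<Sum>y'\<le>a. if y' = y then real y else 0)"
    using w_vec assms by (intro sum.cong) (auto simp del: cells_iff)
  ultimately show ?thesis using b by (simp add: weight_def)
qed

abbreviation minimizers :: "real ^ 'e \<Rightarrow> (nat \<times> nat) set" where
  "minimizers c \<equiv> {p \<in> cells. \<forall>q\<in>cells. c \<bullet> vec p + weight (vec p) \<le> c \<bullet> vec q + weight (vec q)}"

lemma lower_face_iff:
  "lower_face (convex hull ((\<lambda>v. (v, weight v)) ` vec ` cells)) F \<longleftrightarrow>
    (\<exists>c. F = convex hull ((\<lambda>v. (v, weight v)) ` vec ` minimizers c))"
proof -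
  let ?L = "(\<lambda>v. (v, weight v)) ` vec ` cells"
  have "{z \<in> convex hull ?L. \<forall>w\<in>convex hull ?L. c \<bullet> fst z + snd z \<le> c \<bullet> fst w + snd w} =
      convex hull ((\<lambda>v. (v, weight v)) ` vec ` minimizers c)" for c
  proof -
    have "finite ?L" "?L \<noteq> {}" using finite_cells by (auto intro: exI[of _ 0] simp del: cells_iff simp: cells_def)
    from minimizers_convex_hull[OF this, of "(c, 1)"]
    have "{z \<in> convex hull ?L. \<forall>w\<in>convex hull ?L. c \<bullet> fst z + snd z \<le> c \<bullet> fst w + snd w} =
        convex hull {z \<in> ?L. \<forall>w\<in>?L. c \<bullet> fst z + snd z \<le> c \<bullet> fst w + snd w}"
      by (simp add: inner_prod_def)
    also have "{z \<in> ?L. \<forall>w\<in>?L. c \<bullet> fst z + snd z \<le> c \<bullet> fst w + snd w} = (\<lambda>v. (v, weight v)) ` vec ` minimizers c"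
      by (auto simp del: cells_iff)
    finally show ?thesis .
  qed
  then show ?thesis unfolding lower_face_def by simp
qed

lemma fst_lifted_hull: "fst ` (convex hull ((\<lambda>v. (v, weight v)) ` A)) = convex hull A"
  by (subst convex_hull_linear_image[OF linear_fst]) (simp add: image_image)

text \<open>By linear independence some functional cancels the heights on C. On all cells that
  functional splits into a column part and a row part, so \<open>supermodular_potential\<close>
  makes the total positive off C.\<close>

lemma maximal_supported:
  assumes C: "maximal C"
  shows "\<exists>c. minimizers c = C"
proof -
  note nc = maximalD[OF C]
  have sub: "C \<subseteq> cells" using nc by (simp add: noncrossing_def)
  obtain g :: "real ^ 'e \<Rightarrow> real" where g: "linear g" "\<forall>v\<in>vec ` C. g v = - weight v"
    using linear_independent_extend[OF independent_vec[OF nc], of "\<lambda>v. - weight v"] by blast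
  define c where "c = adjoint g 1"
  have c: "c \<bullet> z = g z" for z using adjoint_works[OF g(1), of z 1] by (simp add: c_def inner_commute)
  have 0: "c \<bullet> vec p + weight (vec p) = 0" if "p \<in> C" for p using that g(2) c by simp
  have pos: "0 < c \<bullet> vec p + weight (vec p)" if "p \<in> cells" "p \<notin> C" for p
  proof -
    obtain x y where p: "p = (x, y)" by fastforce
    have "- (c \<bullet> \<alpha> x) + - (c \<bullet> \<beta> y) < real x * real y"
    proof (rule supermodular_potential[OF C])
      fix x' y' assume xy: "(x', y') \<in> C"
      then have cell: "(x', y') \<in> cells" using sub by blast
      show "- (c \<bullet> \<alpha> x') + - (c \<bullet> \<beta> y') = real x' * real y'"
        using 0[OF xy] weight_vec[OF cell] vec_eq[OF cell] by (simp add: inner_add_right)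
    qed (use that p in auto)
    moreover have "(x, y) \<in> cells" using that(1) p by blast
    ultimately show ?thesis
      using weight_vec[of x y] vec_eq[of x y] p by (simp add: inner_add_right)
  qed
  have ge: "0 \<le> c \<bullet> vec p + weight (vec p)" if "p \<in> cells" for p
    using 0[of p] pos[OF that] by (cases "p \<in> C") auto
  have "minimizers c = C"
  proof (intro equalityI subsetI)
    fix p assume "p \<in> minimizers c"
    then have p: "p \<in> cells" "c \<bullet> vec p + weight (vec p) \<le> c \<bullet> vec (0, a) + weight (vec (0, a))"
      by (auto simp: cells_def)
    then have "c \<bullet> vec p + weight (vec p) \<le> 0" using 0[OF maximal_corner[OF C]] by simp
    then show "p \<in> C" using pos[OF p(1)] by fastforce
  next
    fix p assume "p \<in> C"
    then show "p \<in> minimizers c"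
      using 0 ge sub by auto
  qed
  then show ?thesis by blast
qed

lemma noncrossing_minimizers:
  "noncrossing (minimizers c)"
proof -
  let ?M = "minimizers c"
  have "N y < x'" if M: "(x, y) \<in> ?M" "(x', y') \<in> ?M" and lt: "x < x'" "y < y'" for x y x' y'
  proof (rule ccontr)
    assume "\<not> N y < x'"
    then have cells: "(x, y) \<in> cells" "(x', y') \<in> cells" "(x', y) \<in> cells" "(x, y') \<in> cells"
      using M lt N_mono[of y y'] by auto
    have v: "c \<bullet> vec (p, q) + weight (vec (p, q)) = c \<bullet> \<alpha> p + c \<bullet> \<beta> q + real p * real q"
      if "(p, q) \<in> cells" for p q
      using that vec_eq weight_vec by (simp add: inner_add_right)
    have "c \<bullet> vec (x, y) + weight (vec (x, y)) \<le> c \<bullet> vec (x', y) + weight (vec (x', y))"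
      "c \<bullet> vec (x', y') + weight (vec (x', y')) \<le> c \<bullet> vec (x, y') + weight (vec (x, y'))"
      using M cells by blast+
    then have "real x * real y + real x' * real y' \<le> real x' * real y + real x * real y'"
      using cells v by simp
    moreover have "0 < (real x' - real x) * (real y' - real y)" using lt by simp
    moreover have "(real x' - real x) * (real y' - real y)
        = real x * real y + real x' * real y' - (real x' * real y + real x * real y')"
      by (simp add: algebra_simps)
    ultimately show False by linarith
  qed
  then show ?thesis unfolding noncrossing_def by blast
qed

text \<open>A lower face of full dimension is spanned by a noncrossing set with one element more
  than the dimension, and sets of that size are maximal. The other inclusion is
  \<open>maximal_supported\<close>.\<close>

lemma regular_triangulation_tri: "regular_triangulation P tri"
  unfolding regular_triangulation_def extreme_points_P
proof (intro conjI exI[of _ weight] triangulation_of_tri equalityI subsetI)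
  have dim: "aff_dim (vec ` cells) = int (N a + a)" using aff_dim_P by (simp add: aff_dim_convex_hull)
  fix S assume "S \<in> tri"
  then obtain C where C: "maximal C" "S = convex hull (vec ` C)" by (auto simp: tri_def)
  let ?F = "convex hull ((\<lambda>v. (v, weight v)) ` vec ` C)"
  have "lower_face (convex hull ((\<lambda>v. (v, weight v)) ` vec ` cells)) ?F"
  proof -
    obtain c where c: "minimizers c = C"
      using maximal_supported[OF C(1)] by blast
    show ?thesis unfolding lower_face_iff by (rule exI[of _ c]) (simp only: c)
  qed
  moreover have "fst ` ?F = S" unfolding fst_lifted_hull C(2) ..
  ultimately show "S \<in> regular_subdivision (vec ` cells) weight"
    using aff_dim_hull[OF C(1)] C(2) dim unfolding regular_subdivision_def by force
next
  have dim: "aff_dim (vec ` cells) = int (N a + a)" using aff_dim_P by (simp add: aff_dim_convex_hull)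
  fix S assume "S \<in> regular_subdivision (vec ` cells) weight"
  then obtain F where F: "S = fst ` F" "aff_dim S = int (N a + a)"
    "lower_face (convex hull ((\<lambda>v. (v, weight v)) ` vec ` cells)) F"
    unfolding regular_subdivision_def dim by blast
  obtain c where c: "F = convex hull ((\<lambda>v. (v, weight v)) ` vec ` minimizers c)"
    using F(3) unfolding lower_face_iff by blast
  define M where "M = minimizers c"
  have nc: "noncrossing M" unfolding M_def by (rule noncrossing_minimizers)
  have S: "S = convex hull (vec ` M)" unfolding F(1) c fst_lifted_hull M_def ..
  have "int (card M) = int (N a + a) + 1"
    using F(2) affine_independent_vec[OF nc] card_vec[OF nc]
    unfolding S by (simp add: aff_dim_convex_hull affine_independent_iff_card)
  then have "maximal M" by (intro maximalI[OF nc]) linarith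
  then show "S \<in> tri" unfolding tri_def S by blast
qed

section \<open>Common facets and swaps\<close>

lemma common_facet_iff:
  assumes C: "maximal C" and D: "maximal D"
  shows "convex hull (vec ` C) \<noteq> convex hull (vec ` D) \<and>
      (\<exists>F. F facet_of (convex hull (vec ` C)) \<and> F facet_of (convex hull (vec ` D))) \<longleftrightarrow> adjacent C D"
proof -
  note ncC = maximalD[OF C] and ncD = maximalD[OF D]
  have facet: "F facet_of (convex hull (vec ` E)) \<longleftrightarrow> F \<noteq> {} \<and> (\<exists>p\<in>E. F = convex hull (vec ` (E - {p})))"
    if "noncrossing E" for E F
    unfolding facet_of_convex_hull_affine_independent[OF affine_independent_vec[OF that]]
    using inj_on_image_set_diff[OF inj_on_vec_noncrossing[OF that], of E] by auto
  show ?thesis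
    unfolding hull_eq_iff[OF ncC ncD] facet[OF ncC] facet[OF ncD]
  proof
    assume "C \<noteq> D \<and> (\<exists>F. (F \<noteq> {} \<and> (\<exists>p\<in>C. F = convex hull (vec ` (C - {p})))) \<and>
       F \<noteq> {} \<and> (\<exists>p\<in>D. F = convex hull (vec ` (D - {p}))))"
    then obtain F p q where F: "C \<noteq> D" "p \<in> C" "q \<in> D"
      "F = convex hull (vec ` (C - {p}))" "F = convex hull (vec ` (D - {q}))" by blast
    then have pq: "C \<noteq> D" "p \<in> C" "q \<in> D"
      "convex hull (vec ` (C - {p})) = convex hull (vec ` (D - {q}))" by simp_all
    have "C - {p} = D - {q}"
      using pq(4) unfolding hull_eq_iff[OF noncrossing_subset[OF ncC Diff_subset] noncrossing_subset[OF ncD Diff_subset]] .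
    then have "q \<notin> C" "D = insert q (C - {p})" using pq(1-3) by blast+
    then show "adjacent C D" unfolding adjacent_def using pq(2) by blast
  next
    assume "adjacent C D"
    then obtain p q where pq: "p \<in> C" "q \<notin> C" "D = insert q (C - {p})" by (auto simp: adjacent_def)
    have eq: "D - {q} = C - {p}" using pq by blast
    \<comment> \<open>The corner lies in both maximal sets, hence in their common part; so the
      common face is nonempty, as a facet must be.\<close>
    have "(0, a) \<in> C - {p}"
      using maximal_corner[OF C] maximal_corner[OF D] pq by blast
    then have "convex hull (vec ` (C - {p})) \<noteq> {}" by auto
    moreover have "C \<noteq> D" "q \<in> D" using pq by blast+
    ultimately show "C \<noteq> D \<and> (\<exists>F. (F \<noteq> {} \<and> (\<exists>p\<in>C. F = convex hull (vec ` (C - {p})))) \<and>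
       F \<noteq> {} \<and> (\<exists>p\<in>D. F = convex hull (vec ` (D - {p}))))"
      by (intro conjI exI[of _ "convex hull (vec ` (C - {p}))"] bexI[OF _ pq(1)] bexI[of _ q]) (simp_all add: eq)
  qed
qed

end

section \<open>The caracol graph\<close>

text \<open>Two lists diverge at only one place, so the existential in \<open>path_out_less\<close>
  has at most one pair of edges as witness; asymmetry of the path order follows.\<close>

lemma common_prefix_unique:
  "S @ e # P = S' @ e' # P' \<Longrightarrow> S @ f # Q = S' @ f' # Q' \<Longrightarrow> e \<noteq> f \<Longrightarrow> e' \<noteq> f' \<Longrightarrow>
    e = e' \<and> f = f'"
proof (induction S arbitrary: S')
  case Nil
  then show ?case by (cases S') auto
next
  case (Cons s S)
  then show ?case by (cases S') auto
qed

lemma common_suffix_unique: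
  assumes "P @ e # S = P' @ e' # S'" "Q @ f # S = Q' @ f' # S'" "e \<noteq> f" "e' \<noteq> f'"
  shows "e = e' \<and> f = f'"
  using common_prefix_unique[of "rev S" e "rev P" "rev S'" e' "rev P'" f "rev Q" f' "rev Q'"]
    arg_cong[OF assms(1), of rev] arg_cong[OF assms(2), of rev] assms(3,4) by simp

lemma length_less_asym: "length_less e f \<Longrightarrow> \<not> length_less f e"
  by (auto simp: length_less_def)

lemma path_in_less_asym:
  assumes "path_in_less G (length_framing \<epsilon>) P Q"
  shows "\<not> path_in_less G (length_framing \<epsilon>) Q P"
proof
  assume "path_in_less G (length_framing \<epsilon>) Q P"
  then obtain P' e Q' f S where 1: "Q = P' @ e # S" "P = Q' @ f # S" "e \<noteq> f" "length_less (\<epsilon> e) (\<epsilon> f)"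
    by (auto simp: path_in_less_def length_framing_def)
  obtain P2 e2 Q2 f2 S2 where 2: "P = P2 @ e2 # S2" "Q = Q2 @ f2 # S2" "e2 \<noteq> f2" "length_less (\<epsilon> e2) (\<epsilon> f2)"
    using assms by (auto simp: path_in_less_def length_framing_def)
  have "e = f2 \<and> f = e2"
    using common_suffix_unique[of P' e S Q2 f2 S2 Q' f P2 e2] 1 2 by auto
  then show False using 1(4) 2(4) length_less_asym by blast
qed

lemma path_out_less_asym:
  assumes "path_out_less G (length_framing \<epsilon>) P Q"
  shows "\<not> path_out_less G (length_framing \<epsilon>) Q P"
proof
  assume "path_out_less G (length_framing \<epsilon>) Q P"
  then obtain P' e Q' f S where 1: "Q = S @ e # P'" "P = S @ f # Q'" "e \<noteq> f" "length_less (\<epsilon> e) (\<epsilon> f)"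
    by (auto simp: path_out_less_def length_framing_def)
  obtain P2 e2 Q2 f2 S2 where 2: "P = S2 @ e2 # P2" "Q = S2 @ f2 # Q2" "e2 \<noteq> f2" "length_less (\<epsilon> e2) (\<epsilon> f2)"
    using assms by (auto simp: path_out_less_def length_framing_def)
  have "e = f2 \<and> f = e2"
    using common_prefix_unique[of S e P' S2 f2 Q2 f Q' e2 P2] 1 2 by auto
  then show False using 1(4) 2(4) length_less_asym by blast
qed

lemma path_in_less_irrefl: "\<not> path_in_less G F P P"
  by (auto simp: path_in_less_def)

lemma path_out_less_irrefl: "\<not> path_out_less G F P P"
  by (auto simp: path_out_less_def)

locale caracol_graph = nu_staircase a \<nu> for a :: nat and \<nu> :: "nat \<Rightarrow> nat" +
  fixes \<epsilon> :: "'e::finite \<Rightarrow> edge"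
  assumes bij: "bij_betw \<epsilon> UNIV (car_edges a \<nu>)"
begin

declare One_nat_def [simp del] add_2_eq_Suc [simp del] add_2_eq_Suc' [simp del]

abbreviation G :: "(nat, 'e) pre_digraph" where
  "G \<equiv> caracol a \<epsilon>"

definition arc :: "edge \<Rightarrow> 'e" where
  "arc = inv \<epsilon>"

text \<open>
  The edges into the inner vertices from the source are numbered by columns. Within a multiedge the labels
  decrease as the column increases, so that of two routes the one with the larger column precedes the
  other in the incoming order at every common inner vertex.
\<close>

definition entry :: "nat \<Rightarrow> edge" where
  "entry x = (1, height x + 2, N (height x) + 1 - x)"

definition spine :: "nat \<Rightarrow> edge" where
  "spine k = (k + 2, k + 3, 1)"

definition exit :: "nat \<Rightarrow> edge" where
  "exit y = (y + 2, a + 3, 1)"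

lemma arc_eps [simp]: "arc (\<epsilon> e) = e"
  using bij by (simp add: arc_def bij_betw_def)

lemma eps_arc: "e \<in> car_edges a \<nu> \<Longrightarrow> \<epsilon> (arc e) = e"
  using bij by (simp add: arc_def bij_betw_inv_into_right)

lemma height_le: "x \<le> N a \<Longrightarrow> height x \<le> a"
  using height_le_iff by blast

lemma le_N_height: "x \<le> N a \<Longrightarrow> x \<le> N (height x)"
  using height_le_iff by blast

lemma height_eq:
  assumes "x \<le> N i" "\<And>j. j < i \<Longrightarrow> N j < x"
  shows "height x = i"
  unfolding height_def using assms by (intro Least_equality) (auto simp: not_less[symmetric])

lemma N_Suc: "N (Suc k) = N k + \<nu> (Suc k)"
  by (simp add: N_def)

text \<open>The numbering leaves only a spine edges: (1, 2) counts as \<open>entry 0\<close> and (a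
  + 2, a + 3) as \<open>exit a\<close>. For i \<ge> 1, a column x with N (i - 1) < x \<le> N i is
  the copy N i + 1 - x of (1, i + 2).\<close>

lemma car_edges_eq: "car_edges a \<nu> = entry ` {..N a} \<union> spine ` {..<a} \<union> exit ` {..a}"
proof (intro equalityI subsetI)
  fix e assume "e \<in> car_edges a \<nu>"
  then consider i k where "e = (1, i + 2, k)" "i \<in> {1..a}" "k \<in> {1..\<nu> i}"
    | i where "e = (i, a + 3, 1)" "i \<in> {2..a + 1}"
    | i where "e = (i, i + 1, 1)" "i \<in> {1..a + 2}" unfolding car_edges_def by blast
  then show "e \<in> entry ` {..N a} \<union> spine ` {..<a} \<union> exit ` {..a}"
  proof cases
    case 1
    obtain j where j: "i = Suc j" using 1(2) by (cases i) auto
    define x where "x = N i + 1 - k"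
    have x: "N j < x" "x \<le> N i" using 1(3) N_Suc[of j] j by (auto simp: x_def)
    have "height x = i"
    proof (rule height_eq[OF x(2)])
      fix j' assume "j' < i"
      then show "N j' < x" using N_mono[of j' j] x(1) j by simp
    qed
    moreover have "N i + 1 - x = k" using 1(3) N_Suc[of j] j by (auto simp: x_def)
    ultimately have "e = entry x" using 1(1) by (simp add: entry_def)
    moreover have "x \<le> N a" using x(2) N_mono[of i a] 1(2) by simp
    ultimately show ?thesis by blast
  next
    case 2
    then have "e = exit (i - 2)" "i - 2 \<le> a" by (auto simp: exit_def)
    then show ?thesis by blast
  next
    case 3
    consider "i = 1" | "i = a + 2" | "2 \<le> i" "i \<le> a + 1" using 3(2) by fastforce
    then show ?thesis
    proof cases
      case 1
      have "height 0 = 0" by (rule height_eq) auto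
      then have "e = entry 0" using 3(1) 1 N_0 by (simp add: entry_def)
      then show ?thesis by blast
    next
      case 2
      then have "e = exit a" using 3(1) by (simp add: exit_def)
      then show ?thesis by blast
    next
      case 3
      then have "e = spine (i - 2)" "i - 2 < a" using \<open>e = _\<close> by (auto simp: spine_def)
      then show ?thesis by blast
    qed
  qed
next
  fix e assume "e \<in> entry ` {..N a} \<union> spine ` {..<a} \<union> exit ` {..a}"
  then consider x where "x \<le> N a" "e = entry x" | k where "k < a" "e = spine k"
    | y where "y \<le> a" "e = exit y" by blast
  then show "e \<in> car_edges a \<nu>"
  proof cases
    case 1
    show ?thesis
    proof (cases "height x")
      case 0
      then have "x = 0" using le_N_height[OF 1(1)] N_0 by simp
      then show ?thesis using 1(2) 0 N_0 by (auto simp: entry_def car_edges_def)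
    next
      case (Suc j)
      have "\<not> x \<le> N j" using height_le_iff[OF 1(1), of j] Suc by simp
      then have "N (height x) + 1 - x \<in> {1..\<nu> (height x)}"
        using le_N_height[OF 1(1)] N_Suc[of j] Suc by auto
      moreover have "height x \<in> {1..a}" using height_le[OF 1(1)] Suc by simp
      ultimately show ?thesis unfolding 1(2) entry_def car_edges_def by blast
    qed
  next
    case 2
    then show ?thesis unfolding spine_def car_edges_def by auto
  next
    case 3
    then show ?thesis by (cases "y = a") (auto simp: exit_def car_edges_def)
  qed
qed

lemma edges_in [simp]:
  "x \<le> N a \<Longrightarrow> entry x \<in> car_edges a \<nu>"
  "k < a \<Longrightarrow> spine k \<in> car_edges a \<nu>"
  "y \<le> a \<Longrightarrow> exit y \<in> car_edges a \<nu>"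
  by (auto simp: car_edges_eq)

lemma entry_inject: "x \<le> N a \<Longrightarrow> x' \<le> N a \<Longrightarrow> entry x = entry x' \<longleftrightarrow> x = x'"
  using le_N_height[of x] le_N_height[of x'] by (auto simp: entry_def)

lemma edges_inject [simp]:
  "spine k = spine k' \<longleftrightarrow> k = k'" "exit y = exit y' \<longleftrightarrow> y = y'"
  "entry x \<noteq> spine k" "spine k \<noteq> entry x" "entry x \<noteq> exit y" "exit y \<noteq> entry x"
  by (auto simp: entry_def spine_def exit_def)

lemma spine_exit [simp]: "k < a \<Longrightarrow> spine k \<noteq> exit y" "k < a \<Longrightarrow> exit y \<noteq> spine k"
  by (auto simp: spine_def exit_def)

lemma arc_cases [case_names entry spine exit]:
  obtains x where "x \<le> N a" "e = arc (entry x)" | k where "k < a" "e = arc (spine k)"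
    | y where "y \<le> a" "e = arc (exit y)"
proof -
  have "\<epsilon> e \<in> car_edges a \<nu>" using bij bij_betwE by blast
  then show thesis using that arc_eps[of e] unfolding car_edges_eq by fastforce
qed

lemma tail_arc: "e \<in> car_edges a \<nu> \<Longrightarrow> tail G (arc e) = fst e"
  and head_arc: "e \<in> car_edges a \<nu> \<Longrightarrow> head G (arc e) = fst (snd e)"
  by (simp_all add: caracol_def eps_arc)

lemma tail_head_arc [simp]:
  "x \<le> N a \<Longrightarrow> tail G (arc (entry x)) = 1" "x \<le> N a \<Longrightarrow> head G (arc (entry x)) = height x + 2"
  "k < a \<Longrightarrow> tail G (arc (spine k)) = k + 2" "k < a \<Longrightarrow> head G (arc (spine k)) = k + 3"
  "y \<le> a \<Longrightarrow> tail G (arc (exit y)) = y + 2" "y \<le> a \<Longrightarrow> head G (arc (exit y)) = a + 3"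
  by (simp_all add: tail_arc head_arc) (simp_all add: entry_def spine_def exit_def)

lemma arcs_G [simp]: "arcs G = UNIV" and verts_G [simp]: "verts G = {1..a + 3}"
  by (simp_all add: caracol_def)

lemma arc_inject: "e \<in> car_edges a \<nu> \<Longrightarrow> f \<in> car_edges a \<nu> \<Longrightarrow> arc e = arc f \<longleftrightarrow> e = f"
  by (metis eps_arc)

section \<open>Routes as cells\<close>

definition edge_list :: "nat \<times> nat \<Rightarrow> edge list" where
  "edge_list p = entry (fst p) # map spine [height (fst p)..<snd p] @ [exit (snd p)]"

definition route :: "nat \<times> nat \<Rightarrow> 'e list" where
  "route p = map arc (edge_list p)"

lemma cells_height:
  assumes "(x, y) \<in> cells"
  shows "x \<le> N a" "y \<le> a" "height x \<le> y" "x \<le> N y"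
  using assms N_mono[of y a] height_le_iff[of x y] by auto

lemma set_edge_list:
  assumes "(x, y) \<in> cells"
  shows "set (edge_list (x, y)) \<subseteq> car_edges a \<nu>"
  using cells_height[OF assms] by (auto simp: edge_list_def)

lemma wf_G: "wf_digraph G"
proof
  fix e assume "e \<in> arcs G"
  show "tail G e \<in> verts G" "head G e \<in> verts G"
    by (cases e rule: arc_cases; use height_le in force)+
qed

interpretation G: wf_digraph G by (rule wf_G)

lemma awalk_spine:
  "k \<le> y \<Longrightarrow> y \<le> a \<Longrightarrow> G.awalk (k + 2) (map arc (map spine [k..<y] @ [exit y])) (a + 3)"
proof (induction "y - k" arbitrary: k)
  case 0
  then show ?case by (simp add: G.awalk_simps)
next
  case (Suc n)
  then have k: "k < y" "k < a" by simp_all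
  then have eq: "map arc (map spine [k..<y] @ [exit y]) = arc (spine k) # map arc (map spine [Suc k..<y] @ [exit y])"
    by (simp add: upt_conv_Cons)
  have "G.awalk (Suc k + 2) (map arc (map spine [Suc k..<y] @ [exit y])) (a + 3)"
    using Suc by (intro Suc.hyps(1)) auto
  moreover have "head G (arc (spine k)) = Suc k + 2" using k by simp
  ultimately have "G.awalk (head G (arc (spine k))) (map arc (map spine [Suc k..<y] @ [exit y])) (a + 3)"
    by (simp only:)
  then show ?case unfolding eq G.awalk_Cons_iff using k by (intro conjI) simp_all
qed

lemma awalk_from_spine:
  assumes "G.awalk (k + 2) R (a + 3)" "k \<le> a"
  shows "\<exists>y. k \<le> y \<and> y \<le> a \<and> R = map arc (map spine [k..<y] @ [exit y])"
  using assms
proof (induction R arbitrary: k)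
  case Nil
  then show ?case by (simp add: G.awalk_simps)
next
  case (Cons e R)
  then have e: "tail G e = k + 2" "G.awalk (head G e) R (a + 3)" by (auto simp: G.awalk_simps)
  show ?case
  proof (cases e rule: arc_cases)
    case (entry x)
    then show ?thesis using e(1) by simp
  next
    case (spine j)
    then have j: "j = k" using e(1) by simp
    have "head G e = Suc k + 2" using spine j by simp
    then have "G.awalk (Suc k + 2) R (a + 3)" using e(2) by simp
    moreover have "Suc k \<le> a" using spine j by simp
    ultimately obtain y where y: "Suc k \<le> y" "y \<le> a" "R = map arc (map spine [Suc k..<y] @ [exit y])"
      using Cons.IH by blast
    moreover from y(1) have "[k..<y] = k # [Suc k..<y]" by (simp add: upt_conv_Cons)
    ultimately show ?thesis using spine j by (intro exI[of _ y]) auto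
  next
    case (exit y)
    then have y: "y = k" using e(1) by simp
    have R: "G.awalk (a + 3) R (a + 3)"
      using e(2) exit by simp
    have "R = []"
    proof (cases R)
      case (Cons f R')
      then have "tail G f = a + 3" using R by (auto simp: G.awalk_simps)
      then show ?thesis
        by (cases f rule: arc_cases) auto
    qed
    then show ?thesis using exit y Cons.prems(2) by (intro exI[of _ k]) auto
  qed
qed

text \<open>All arcs increase the vertex number, so a walk never repeats a vertex and the routes are
  simply the walks from source to sink.\<close>

lemma awalk_verts_increasing:
  "G.awalk v R t \<Longrightarrow> distinct (G.awalk_verts v R) \<and> (\<forall>i\<in>set (G.awalk_verts v R). v \<le> i)"
proof (induction R arbitrary: v)
  case (Cons e R)
  then have e: "tail G e = v" "G.awalk (head G e) R t" by (auto simp: G.awalk_simps)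
  have "tail G e < head G e"
    by (cases e rule: arc_cases) auto
  then show ?case using Cons.IH[OF e(2)] e(1) by fastforce
qed simp

lemma routes_eq: "routes G 1 (a + 3) = route ` cells"
proof (intro equalityI subsetI)
  fix R assume "R \<in> routes G 1 (a + 3)"
  then have R: "G.awalk 1 R (a + 3)" by (simp add: routes_def G.apath_def)
  show "R \<in> route ` cells"
  proof (cases R)
    case Nil
    then show ?thesis using R by (simp add: G.awalk_simps)
  next
    case (Cons e R')
    then have e: "tail G e = 1" "G.awalk (head G e) R' (a + 3)" using R by (auto simp: G.awalk_simps)
    show ?thesis
    proof (cases e rule: arc_cases)
      case (entry x)
      then have "G.awalk (height x + 2) R' (a + 3)"
        using e(2) by simp
      then obtain y where y: "height x \<le> y" "y \<le> a" "R' = map arc (map spine [height x..<y] @ [exit y])"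
        using awalk_from_spine height_le[OF entry(1)] by blast
      then have "(x, y) \<in> cells" using height_le_iff[OF entry(1)] by simp
      moreover have "R = route (x, y)" using Cons entry y by (simp add: route_def edge_list_def)
      ultimately show ?thesis by blast
    next
      case (spine k)
      then show ?thesis using e(1) by simp
    next
      case (exit y)
      then show ?thesis using e(1) by simp
    qed
  qed
next
  fix R assume "R \<in> route ` cells"
  then obtain x y where xy: "(x, y) \<in> cells" "R = route (x, y)" by auto
  note b = cells_height[OF xy(1)]
  have "G.awalk 1 R (a + 3)"
    using awalk_spine[OF b(3,2)] b(1)
    unfolding xy(2) route_def edge_list_def fst_conv snd_conv list.map(2) G.awalk_Cons_iff by simp
  then show "R \<in> routes G 1 (a + 3)"
    using awalk_verts_increasing by (auto simp: routes_def G.apath_def)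
qed

section \<open>Coherence as noncrossing\<close>

lemma edge_list_split:
  assumes "height x \<le> k" "k \<le> y"
  shows "edge_list (x, y) = (entry x # map spine [height x..<k]) @ (map spine [k..<y] @ [exit y])"
proof -
  have "[height x..<y] = [height x..<k] @ [k..<y]"
    using upt_add_eq_append[OF assms(1), of "y - k"] assms(2) by simp
  then show ?thesis by (simp add: edge_list_def)
qed

lemma path_to_from:
  assumes c: "(x, y) \<in> cells" and k: "height x \<le> k" "k \<le> y"
  shows "path_to G (k + 2) (route (x, y)) = map arc (entry x # map spine [height x..<k])"
    and "path_from G (k + 2) (route (x, y)) = map arc (map spine [k..<y] @ [exit y])"
proof -
  note b = cells_height[OF c]
  let ?A = "map arc (entry x # map spine [height x..<k])" and ?B = "map arc (map spine [k..<y] @ [exit y])"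
  have R: "route (x, y) = ?A @ ?B" unfolding route_def edge_list_split[OF k] by simp
  have A: "tail G e \<noteq> k + 2" if "e \<in> set ?A" for e
    using that b k by auto
  have B: "?B \<noteq> []" "tail G (hd ?B) = k + 2"
  proof -
    show "tail G (hd ?B) = k + 2"
    proof (cases "k = y")
      case True
      then show ?thesis using b by simp
    next
      case False
      then have "[k..<y] = k # [Suc k..<y]" using k by (simp add: upt_conv_Cons)
      then show ?thesis using b k False by simp
    qed
  qed simp
  obtain e B' where eB: "?B = e # B'" "tail G e = k + 2" using B by (cases ?B) auto
  show "path_to G (k + 2) (route (x, y)) = ?A"
    unfolding path_to_def R eB(1) using A eB(2) by (subst takeWhile_append2) auto
  show "path_from G (k + 2) (route (x, y)) = ?B"
    unfolding path_from_def R eB(1) using A eB(2) by (subst dropWhile_append2) auto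
qed

text \<open>The paths meet for good at vertex \<open>height x + 2\<close>. For equal heights two
  parallel edges are compared by label, which decreases in the column; otherwise the path of x'
  arrives by a spine edge of length 1, and the edge from the source is longer.\<close>

lemma path_in_less_entry:
  assumes "x' < x" "x \<le> N k" "k \<le> a"
  shows "path_in_less G (length_framing \<epsilon>)
    (map arc (entry x # map spine [height x..<k])) (map arc (entry x' # map spine [height x'..<k]))"
proof -
  have b: "x \<le> N a" "x' \<le> N a" using assms N_mono[of k a] by auto
  have hk: "height x \<le> k" using height_le_iff[OF b(1)] assms(2) by blast
  have hh: "height x' \<le> height x"
    using height_le_iff[OF b(2)] le_N_height[OF b(1)] assms(1) by simp
  let ?S = "map arc (map spine [height x..<k])"
  show ?thesis
  proof (cases "height x' = height x")
    case True
    have "length_less (entry x) (entry x')"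
      using assms(1) le_N_height[OF b(1)] True
      by (simp add: length_less_def edge_length_def edge_label_def entry_def)
    then show ?thesis
      unfolding path_in_less_def length_framing_def
      using b assms(1) True by (intro exI[of _ "[]"] exI[of _ "arc (entry x)"] exI[of _ "arc (entry x')"] exI[of _ ?S])
        (auto simp: eps_arc arc_inject entry_inject)
  next
    case False
    define h where "h = height x - 1"
    have h: "height x = Suc h" "height x' \<le> h" "h < a" using False hh hk assms(3) by (auto simp: h_def)
    have split: "[height x'..<k] = [height x'..<h] @ h # [height x..<k]"
      using upt_add_eq_append[OF h(2), of "k - h"] h(1) hk by (simp add: upt_conv_Cons)
    have "length_less (entry x) (spine h)"
      using h(1) by (simp add: length_less_def edge_length_def entry_def spine_def)
    then show ?thesis
      unfolding path_in_less_def length_framing_def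
      using b h(3) by (intro exI[of _ "[]"] exI[of _ "arc (entry x)"]
          exI[of _ "map arc (entry x' # map spine [height x'..<h])"] exI[of _ "arc (spine h)"] exI[of _ ?S])
        (auto simp: eps_arc arc_inject split)
  qed
qed

text \<open>The paths separate at vertex y + 2, where y < a makes the edge into the sink longer than
  the spine edge.\<close>

lemma path_out_less_exit:
  assumes "k \<le> y" "y < y'" "y' \<le> a"
  shows "path_out_less G (length_framing \<epsilon>)
    (map arc (map spine [k..<y] @ [exit y])) (map arc (map spine [k..<y'] @ [exit y']))"
proof -
  have split: "[k..<y'] = [k..<y] @ y # [Suc y..<y']"
    using upt_add_eq_append[OF assms(1), of "y' - y"] assms(2) by (simp add: upt_conv_Cons)
  have "1 < a + 3 - (y + 2)" using assms by linarith
  then have "length_less (exit y) (spine y)"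
    by (simp add: length_less_def edge_length_def exit_def spine_def)
  then show ?thesis
    unfolding path_out_less_def length_framing_def
    using assms by (intro exI[of _ "map arc (map spine [k..<y])"] exI[of _ "arc (exit y)"] exI[of _ "[]"]
        exI[of _ "arc (spine y)"] exI[of _ "map arc (map spine [Suc y..<y'] @ [exit y'])"])
      (auto simp: eps_arc arc_inject split)
qed

text \<open>At a common vertex the incoming order reverses the order of the columns while the
  outgoing order follows that of the rows.\<close>

lemma coherent_at_iff:
  assumes c: "(x, y) \<in> cells" "(x', y') \<in> cells" and k: "x \<le> N k" "x' \<le> N k" "k \<le> y" "k \<le> y'"
  shows "coherent_at G (length_framing \<epsilon>) (k + 2) (route (x, y)) (route (x', y')) \<longleftrightarrow>
    \<not> (x < x' \<and> y < y') \<and> \<not> (x' < x \<and> y' < y)"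
proof -
  note b = cells_height[OF c(1)] and b' = cells_height[OF c(2)]
  have h: "height x \<le> k" "height x' \<le> k"
    using height_le_iff[OF b(1)] height_le_iff[OF b'(1)] k by auto
  let ?I = "path_in_less G (length_framing \<epsilon>)" and ?O = "path_out_less G (length_framing \<epsilon>)"
  let ?A = "\<lambda>x. map arc (entry x # map spine [height x..<k])" and ?B = "\<lambda>y. map arc (map spine [k..<y] @ [exit y])"
  have ka: "k \<le> a" using k b by simp
  have "?I (?A x) (?A x') \<longleftrightarrow> x' < x" "?I (?A x') (?A x) \<longleftrightarrow> x < x'"
    using path_in_less_entry[OF _ _ ka] k path_in_less_asym path_in_less_irrefl
    by (metis linorder_neqE_nat)+
  moreover have "?O (?B y) (?B y') \<longleftrightarrow> y < y'" "?O (?B y') (?B y) \<longleftrightarrow> y' < y"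
    using path_out_less_exit[of k] k b b' path_out_less_asym path_out_less_irrefl
    by (metis linorder_neqE_nat)+
  ultimately show ?thesis
    unfolding coherent_at_def path_to_from[OF c(1) h(1) k(3)] path_to_from[OF c(2) h(2) k(4)] by blast
qed

lemma route_verts:
  assumes c: "(x, y) \<in> cells" and v: "v \<in> inner_verts G 1 (a + 3)"
  shows "v \<in> set (G.awalk_verts 1 (route (x, y))) \<longleftrightarrow> (\<exists>k. v = k + 2 \<and> height x \<le> k \<and> k \<le> y)"
proof -
  note b = cells_height[OF c]
  have "v \<noteq> 1" "v \<noteq> a + 3" using v by (auto simp: inner_verts_def)
  moreover have "set (G.awalk_verts 1 (route (x, y))) = insert 1 (insert (a + 3) ((\<lambda>k. k + 2) ` {height x..y}))"
  proof -
    have "route (x, y) \<noteq> []" by (simp add: route_def edge_list_def)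
    moreover have "last (route (x, y)) = arc (exit y)" by (simp add: route_def edge_list_def)
    moreover have "head G (arc (exit y)) = a + 3" using b by simp
    moreover have "map (tail G) (route (x, y)) = 1 # map (\<lambda>k. k + 2) [height x..<y] @ [y + 2]"
      using b by (simp add: route_def edge_list_def)
    moreover have "{height x..y} = insert y {height x..<y}" using b by auto
    ultimately show ?thesis by (auto simp: G.awalk_verts_conv)
  qed
  ultimately show ?thesis by (auto intro!: exI[of _ "v - 2"])
qed

text \<open>The condition is the same at every common inner vertex, so only the existence of one
  matters. The best candidate is where the first of the two routes leaves the spine; it is common if
  the other column has started by then.\<close>

lemma coherent_iff:
  assumes c: "(x, y) \<in> cells" "(x', y') \<in> cells"
  shows "coherent G 1 (a + 3) (length_framing \<epsilon>) (route (x, y)) (route (x', y')) \<longleftrightarrow>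
    \<not> (x < x' \<and> y < y' \<and> x' \<le> N y) \<and> \<not> (x' < x \<and> y' < y \<and> x \<le> N y')" (is "?L \<longleftrightarrow> ?R")
proof -
  note b = cells_height[OF c(1)] and b' = cells_height[OF c(2)]
  have inner: "k + 2 \<in> inner_verts G 1 (a + 3)" if "k \<le> a" for k
    using that by (auto simp: inner_verts_def caracol_def)
  have "?L \<longleftrightarrow> (\<forall>k. x \<le> N k \<and> x' \<le> N k \<and> k \<le> y \<and> k \<le> y' \<longrightarrow>
      \<not> (x < x' \<and> y < y') \<and> \<not> (x' < x \<and> y' < y))" (is "_ \<longleftrightarrow> ?M")
  proof
    assume L: ?L
    show ?M
    proof (intro allI impI)
      fix k assume k: "x \<le> N k \<and> x' \<le> N k \<and> k \<le> y \<and> k \<le> y'"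
      have v: "k + 2 \<in> inner_verts G 1 (a + 3)" using inner k b by simp
      have "k + 2 \<in> set (G.awalk_verts 1 (route (x, y)))" "k + 2 \<in> set (G.awalk_verts 1 (route (x', y')))"
        unfolding route_verts[OF c(1) v] route_verts[OF c(2) v]
        using k height_le_iff[OF b(1)] height_le_iff[OF b'(1)] by auto
      then have "coherent_at G (length_framing \<epsilon>) (k + 2) (route (x, y)) (route (x', y'))"
        using L v unfolding coherent_def by blast
      then show "\<not> (x < x' \<and> y < y') \<and> \<not> (x' < x \<and> y' < y)" using coherent_at_iff[OF c] k by simp
    qed
  next
    assume M: ?M
    show ?L
      unfolding coherent_def
    proof (intro ballI impI)
      fix v assume v: "v \<in> inner_verts G 1 (a + 3)"
        and "v \<in> set (G.awalk_verts 1 (route (x, y))) \<and> v \<in> set (G.awalk_verts 1 (route (x', y')))"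
      then obtain k where k: "v = k + 2" "height x \<le> k" "k \<le> y" "height x' \<le> k" "k \<le> y'"
        by (auto simp: route_verts[OF c(1) v] route_verts[OF c(2) v])
      then have "x \<le> N k" "x' \<le> N k"
        using height_le_iff[OF b(1)] height_le_iff[OF b'(1)] by auto
      then show "coherent_at G (length_framing \<epsilon>) v (route (x, y)) (route (x', y'))"
        using M coherent_at_iff[OF c, of k] k(1,3,5) by blast
    qed
  qed
  also have "\<dots> \<longleftrightarrow> ?R"
  proof
    assume M: ?M
    show ?R using M[rule_format, of y] M[rule_format, of y'] b b' by auto
  next
    assume R: ?R
    show ?M
    proof (intro allI impI)
      fix k assume k: "x \<le> N k \<and> x' \<le> N k \<and> k \<le> y \<and> k \<le> y'"
      then have "x' \<le> N y" "x \<le> N y'" using N_mono[of k y] N_mono[of k y'] by auto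
      then show "\<not> (x < x' \<and> y < y') \<and> \<not> (x' < x \<and> y' < y)" using R by blast
    qed
  qed
  finally show ?thesis .
qed

lemma inj_on_route: "inj_on route cells"
proof (rule inj_onI)
  fix p q assume pq: "p \<in> cells" "q \<in> cells" "route p = route q"
  obtain x y x' y' where eq: "p = (x, y)" "q = (x', y')" by fastforce
  have c: "x \<le> N a" "x' \<le> N a" "y \<le> a" "y' \<le> a" using pq eq cells_height by blast+
  have "hd (route p) = hd (route q)" "last (route p) = last (route q)" using pq(3) by auto
  then have "arc (entry x) = arc (entry x')" "arc (exit y) = arc (exit y')"
    by (auto simp: route_def edge_list_def eq)
  then show "p = q" using c by (simp add: arc_inject entry_inject eq)
qed

lemma clique_iff:
  assumes "D \<subseteq> cells"
  shows "clique G 1 (a + 3) (length_framing \<epsilon>) (route ` D) \<longleftrightarrow> noncrossing D"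
proof -
  have "clique G 1 (a + 3) (length_framing \<epsilon>) (route ` D) \<longleftrightarrow>
      (\<forall>p\<in>D. \<forall>q\<in>D. coherent G 1 (a + 3) (length_framing \<epsilon>) (route p) (route q))"
    using assms unfolding clique_def routes_eq by blast
  also have "\<dots> \<longleftrightarrow> (\<forall>x y x' y'. (x, y) \<in> D \<and> (x', y') \<in> D \<longrightarrow>
      \<not> (x < x' \<and> y < y' \<and> x' \<le> N y) \<and> \<not> (x' < x \<and> y' < y \<and> x \<le> N y'))"
    using coherent_iff assms by (auto simp del: cells_iff) blast+
  also have "\<dots> \<longleftrightarrow> noncrossing D"
  proof
    assume L: "\<forall>x y x' y'. (x, y) \<in> D \<and> (x', y') \<in> D \<longrightarrow>
      \<not> (x < x' \<and> y < y' \<and> x' \<le> N y) \<and> \<not> (x' < x \<and> y' < y \<and> x \<le> N y')"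
    show "noncrossing D"
      unfolding noncrossing_def
    proof (intro conjI allI impI assms)
      fix x y x' y' assume "(x, y) \<in> D \<and> (x', y') \<in> D \<and> x < x' \<and> y < y'"
      then have "\<not> x' \<le> N y" using L by blast
      then show "N y < x'" by simp
    qed
  next
    assume "noncrossing D"
    then show "\<forall>x y x' y'. (x, y) \<in> D \<and> (x', y') \<in> D \<longrightarrow>
      \<not> (x < x' \<and> y < y' \<and> x' \<le> N y) \<and> \<not> (x' < x \<and> y' < y \<and> x \<le> N y')"
      using noncrossingD leD by blast
  qed
  finally show ?thesis .
qed

lemma clique_imageD:
  assumes "clique G 1 (a + 3) (length_framing \<epsilon>) C"
  obtains D where "D \<subseteq> cells" "C = route ` D"
proof -
  have "C \<subseteq> route ` cells" using assms by (simp add: clique_def routes_eq)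
  then show thesis using that by (metis subset_imageE)
qed

lemma maximal_clique_iff:
  assumes D: "D \<subseteq> cells"
  shows "maximal_clique G 1 (a + 3) (length_framing \<epsilon>) (route ` D) \<longleftrightarrow> maximal D"
proof
  assume m: "maximal_clique G 1 (a + 3) (length_framing \<epsilon>) (route ` D)"
  show "maximal D"
    unfolding maximal_def
  proof (intro conjI allI impI)
    show "noncrossing D" using m clique_iff[OF D] by (simp add: maximal_clique_def)
    fix E assume E: "noncrossing E \<and> D \<subseteq> E"
    then have "E \<subseteq> cells" by (simp add: noncrossing_def)
    then have "clique G 1 (a + 3) (length_framing \<epsilon>) (route ` E)" using clique_iff E by blast
    then have "route ` E = route ` D" using m E unfolding maximal_clique_def by blast
    then show "E = D" using inj_on_image_eq_iff[OF inj_on_route \<open>E \<subseteq> cells\<close> D] by blast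
  qed
next
  assume m: "maximal D"
  show "maximal_clique G 1 (a + 3) (length_framing \<epsilon>) (route ` D)"
    unfolding maximal_clique_def
  proof (intro conjI allI impI)
    show "clique G 1 (a + 3) (length_framing \<epsilon>) (route ` D)"
      using m clique_iff[OF D] by (simp add: maximal_def)
    fix C assume C: "clique G 1 (a + 3) (length_framing \<epsilon>) C \<and> route ` D \<subseteq> C"
    obtain E where E: "E \<subseteq> cells" "C = route ` E" using clique_imageD C by blast
    have "noncrossing E" using clique_iff[OF E(1)] C E(2) by blast
    moreover have "D \<subseteq> E"
      using C E inj_on_image_subset_iff[OF inj_on_route D E(1)] by blast
    ultimately show "C = route ` D" using m E(2) by (auto simp: maximal_def)
  qed
qed

section \<open>Route vectors\<close>

definition vec :: "nat \<times> nat \<Rightarrow> real ^ 'e" where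
  "vec p = route_vec (route p)"

lemma framed_triangulation_eq:
  "length_framed_triangulation a \<epsilon> = {convex hull (vec ` D) | D. maximal D}"
  unfolding length_framed_triangulation_def framed_triangulation_def
proof (intro equalityI subsetI)
  fix S assume "S \<in> {convex hull (route_vec ` C) | C. maximal_clique G 1 (a + 3) (length_framing \<epsilon>) C}"
  then obtain C where C: "maximal_clique G 1 (a + 3) (length_framing \<epsilon>) C" "S = convex hull (route_vec ` C)" by blast
  obtain D where D: "D \<subseteq> cells" "C = route ` D"
    using C(1) clique_imageD unfolding maximal_clique_def by blast
  have "S = convex hull (vec ` D)" using C(2) D(2) by (simp add: image_image vec_def)
  then show "S \<in> {convex hull (vec ` D) | D. maximal D}"
    using maximal_clique_iff[OF D(1)] C(1) D(2) by blast
next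
  fix S assume "S \<in> {convex hull (vec ` D) | D. maximal D}"
  then obtain D where D: "maximal D" "S = convex hull (vec ` D)" by blast
  have sub: "D \<subseteq> cells" using D(1) by (simp add: maximal_def noncrossing_def)
  have "S = convex hull (route_vec ` route ` D)" using D(2) by (simp add: image_image vec_def)
  then show "S \<in> {convex hull (route_vec ` C) | C. maximal_clique G 1 (a + 3) (length_framing \<epsilon>) C}"
    using maximal_clique_iff[OF sub] D(1) by blast
qed

text \<open>The column part follows the spine to its very end, whatever the row; the row part
  \<beta> y cancels the spine from row y on, whence its entries -1.\<close>

definition \<alpha> :: "nat \<Rightarrow> real ^ 'e" where
  "\<alpha> x = (\<chi> e. if e = arc (entry x) \<or> (\<exists>k<a. e = arc (spine k) \<and> x \<le> N k) then 1 else 0)"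

definition \<beta> :: "nat \<Rightarrow> real ^ 'e" where
  "\<beta> y = (\<chi> e. if e = arc (exit y) then 1 else if \<exists>k<a. e = arc (spine k) \<and> y \<le> k then - 1 else 0)"

lemma vec_nth:
  assumes c: "(x, y) \<in> cells" and e: "e \<in> car_edges a \<nu>"
  shows "vec (x, y) $ arc e = (if e \<in> set (edge_list (x, y)) then 1 else 0)"
proof -
  have "arc e \<in> set (route (x, y)) \<longleftrightarrow> e \<in> set (edge_list (x, y))"
    unfolding route_def set_map using set_edge_list[OF c] e arc_inject by blast
  then show ?thesis by (simp add: vec_def route_vec_def)
qed

lemma vec_entry:
  assumes "(x, y) \<in> cells" "z \<le> N a"
  shows "vec (x, y) $ arc (entry z) = (if x = z then 1 else 0)"
  using vec_nth[OF assms(1), of "entry z"] cells_height[OF assms(1)] assms(2)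
  by (auto simp: edge_list_def entry_inject)

lemma vec_exit:
  assumes "(x, y) \<in> cells" "z \<le> a"
  shows "vec (x, y) $ arc (exit z) = (if y = z then 1 else 0)"
  using vec_nth[OF assms(1), of "exit z"] cells_height[OF assms(1)] assms(2)
  by (auto simp: edge_list_def)

lemma vec_spine:
  assumes "(x, y) \<in> cells" "k < a"
  shows "vec (x, y) $ arc (spine k) = (if x \<le> N k \<and> k < y then 1 else 0)"
  using vec_nth[OF assms(1), of "spine k"] cells_height[OF assms(1)] assms(2) height_le_iff[of x k]
  by (auto simp: edge_list_def)

sublocale staircase_vectors a N vec \<alpha> \<beta> "\<lambda>x. axis (arc (entry x)) 1" "\<lambda>y. axis (arc (exit y)) 1"
proof unfold_locales
  fix x y assume c: "(x, y) \<in> cells"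
  note b = cells_height[OF c]
  show "vec (x, y) = \<alpha> x + \<beta> y"
    unfolding vec_eq_iff
  proof
    fix e
    show "vec (x, y) $ e = (\<alpha> x + \<beta> y) $ e"
    proof (cases e rule: arc_cases)
      case (entry z)
      then show ?thesis using b by (auto simp: vec_entry[OF c] \<alpha>_def \<beta>_def arc_inject entry_inject)
    next
      case (spine k)
      then show ?thesis using b N_mono[of y k] by (auto simp: vec_spine[OF c] \<alpha>_def \<beta>_def arc_inject)
    next
      case (exit z)
      then show ?thesis using b by (auto simp: vec_exit[OF c] \<alpha>_def \<beta>_def arc_inject)
    qed
  qed
next
  fix c show "vec c \<in> integer_points" by (simp add: integer_points_def vec_def route_vec_def)
qed (simp_all add: inner_axis' vec_entry vec_exit integer_points_def del: cells_iff)

section \<open>The flow polytope as the hull of the route vectors\<close>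

lemma out_arcs_source: "out_arcs G 1 = arc ` entry ` {..N a}"
proof -
  have "tail G e = 1 \<longleftrightarrow> e \<in> arc ` entry ` {..N a}" for e
    by (cases e rule: arc_cases) (auto simp: arc_inject image_iff entry_inject)
  then show ?thesis by (auto simp: out_arcs_def caracol_def)
qed

lemma out_arcs_inner:
  assumes "k \<le> a"
  shows "out_arcs G (k + 2) = (if k < a then {arc (exit k), arc (spine k)} else {arc (exit k)})"
proof -
  have "tail G e = k + 2 \<longleftrightarrow> e = arc (exit k) \<or> k < a \<and> e = arc (spine k)" for e
  proof (cases e rule: arc_cases)
    case (entry x)
    then have "tail G e = 1" by simp
    then show ?thesis using entry assms by (auto simp: arc_inject)
  next
    case (spine j)
    then have "tail G e = j + 2" by simp
    then show ?thesis using spine assms by (auto simp: arc_inject)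
  next
    case (exit y)
    then have "tail G e = y + 2" by simp
    then show ?thesis using exit assms by (auto simp: arc_inject)
  qed
  then show ?thesis by (auto simp: out_arcs_def caracol_def)
qed

lemma in_arcs_inner:
  assumes "k \<le> a"
  shows "in_arcs G (k + 2) = arc ` entry ` {x. x \<le> N a \<and> height x = k} \<union> (if 0 < k then {arc (spine (k - 1))} else {})"
proof -
  have "head G e = k + 2 \<longleftrightarrow> e \<in> arc ` entry ` {x. x \<le> N a \<and> height x = k} \<or> 0 < k \<and> e = arc (spine (k - 1))" for e
  proof (cases e rule: arc_cases)
    case (entry x)
    then have "head G e = height x + 2" by simp
    then show ?thesis using entry assms by (auto simp: arc_inject entry_inject image_iff)
  next
    case (spine j)
    then have "head G e = j + 3" by simp
    then show ?thesis using spine assms by (auto simp: arc_inject image_iff)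
  next
    case (exit y)
    then have "head G e = a + 3" by simp
    then show ?thesis using exit assms by (auto simp: arc_inject image_iff)
  qed
  then show ?thesis by (auto simp: in_arcs_def caracol_def)
qed

lemma sum_entries:
  assumes "A \<subseteq> {..N a}"
  shows "(\<Sum>e\<in>arc ` entry ` A. z $ e) = (\<Sum>x\<in>A. z $ arc (entry x))"
proof -
  have "inj_on (\<lambda>x. arc (entry x)) A"
    using assms by (intro inj_onI) (auto simp: arc_inject entry_inject subset_iff)
  then show ?thesis by (simp add: image_image sum.reindex)
qed

lemma flow_conservation_iff:
  assumes "k \<le> a"
  shows "(\<Sum>e\<in>out_arcs G (k + 2). z $ e) = (\<Sum>e\<in>in_arcs G (k + 2). z $ e) \<longleftrightarrow>
    z $ arc (exit k) + (if k < a then z $ arc (spine k) else 0) =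
    (\<Sum>x | x \<le> N a \<and> height x = k. z $ arc (entry x)) + (if 0 < k then z $ arc (spine (k - 1)) else 0)"
proof -
  have "(\<Sum>e\<in>out_arcs G (k + 2). z $ e) = z $ arc (exit k) + (if k < a then z $ arc (spine k) else 0)"
    unfolding out_arcs_inner[OF assms] by (auto simp: arc_inject)
  moreover have "(\<Sum>e\<in>in_arcs G (k + 2). z $ e) =
      (\<Sum>x | x \<le> N a \<and> height x = k. z $ arc (entry x)) + (if 0 < k then z $ arc (spine (k - 1)) else 0)"
    unfolding in_arcs_inner[OF assms] using assms
    by (subst sum.union_disjoint) (auto simp: arc_inject sum_entries subset_iff)
  ultimately show ?thesis by simp
qed

text \<open>Conservation summed over the vertices 2, ..., k + 2 is the equation of a cut: flow
  enters through the columns up to N k and leaves through the exits up to k and the spine edge k,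
  which exists only for k < a.\<close>

lemma car_flow_polytope_iff:
  "z \<in> car_flow_polytope a \<epsilon> \<longleftrightarrow> (\<forall>e. 0 \<le> z $ e) \<and> (\<Sum>x\<le>N a. z $ arc (entry x)) = 1 \<and>
    (\<forall>k\<le>a. (\<Sum>y\<le>k. z $ arc (exit y)) + (if k < a then z $ arc (spine k) else 0) = (\<Sum>x\<le>N k. z $ arc (entry x)))"
proof -
  have verts: "inner_verts G 1 (a + 3) = (\<lambda>k. k + 2) ` {..a}"
  proof (intro equalityI subsetI)
    fix v assume "v \<in> inner_verts G 1 (a + 3)"
    then have "v = (v - 2) + 2" "v - 2 \<le> a" by (auto simp: inner_verts_def caracol_def)
    then show "v \<in> (\<lambda>k. k + 2) ` {..a}" by blast
  qed (auto simp: inner_verts_def caracol_def)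
  let ?E = "\<lambda>k. \<Sum>x | x \<le> N a \<and> height x = k. z $ arc (entry x)"
  let ?S = "\<lambda>k. if k < a then z $ arc (spine k) else 0"
  let ?local = "\<lambda>k. z $ arc (exit k) + ?S k = ?E k + (if 0 < k then z $ arc (spine (k - 1)) else 0)"
  let ?cum = "\<lambda>k. (\<Sum>y\<le>k. z $ arc (exit y)) + ?S k = (\<Sum>x\<le>N k. z $ arc (entry x))"
  have E0: "?E 0 = (\<Sum>x\<le>N 0. z $ arc (entry x))"
  proof -
    have "{x. x \<le> N a \<and> height x = 0} = {..N 0}"
      using height_le_iff[of _ 0] N_mono[of 0 a] by auto
    then show ?thesis by simp
  qed
  have E_Suc: "(\<Sum>x\<le>N (Suc k). z $ arc (entry x)) = (\<Sum>x\<le>N k. z $ arc (entry x)) + ?E (Suc k)" if "Suc k \<le> a" for k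
  proof -
    have "{..N (Suc k)} = {..N k} \<union> {x. x \<le> N a \<and> height x = Suc k}"
    proof (intro equalityI subsetI)
      fix x assume "x \<in> {..N (Suc k)}"
      then have "x \<le> N a" "height x \<le> Suc k"
        using N_mono[OF that] height_le_iff[of x "Suc k"] by auto
      then show "x \<in> {..N k} \<union> {x. x \<le> N a \<and> height x = Suc k}"
        using height_le_iff[of x k] by auto
    qed (use N_mono[of k "Suc k"] le_N_height in fastforce)
    moreover have "{..N k} \<inter> {x. x \<le> N a \<and> height x = Suc k} = {}"
      using height_le_iff[of _ k] by fastforce
    ultimately show ?thesis by (simp add: sum.union_disjoint)
  qed
  have step: "?cum (Suc k) \<longleftrightarrow> ?local (Suc k)" if "?cum k" "Suc k \<le> a" for k
    using that(1) E_Suc[OF that(2)] that(2) by auto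
  have zero: "?cum 0 \<longleftrightarrow> ?local 0" using E0 by simp
  have "(\<forall>k\<le>a. ?local k) \<longleftrightarrow> (\<forall>k\<le>a. ?cum k)"
  proof
    assume l: "\<forall>k\<le>a. ?local k"
    have "?cum k" if "k \<le> a" for k
      using that
    proof (induction k)
      case 0
      show ?case unfolding zero using l by blast
    next
      case (Suc k)
      then have "?cum k" by simp
      show ?case unfolding step[OF \<open>?cum k\<close> Suc.prems] using l Suc.prems by blast
    qed
    then show "\<forall>k\<le>a. ?cum k" by blast
  next
    assume c: "\<forall>k\<le>a. ?cum k"
    show "\<forall>k\<le>a. ?local k"
    proof (intro allI impI)
      fix k assume k: "k \<le> a"
      show "?local k"
      proof (cases k)
        case 0
        then show ?thesis using zero c k by blast
      next
        case (Suc j)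
        have "?cum j" "?cum (Suc j)" using c[rule_format, of j] c[rule_format, of "Suc j"] k Suc by auto
        then show ?thesis using step[of j] k Suc by blast
      qed
    qed
  qed
  moreover have "z \<in> car_flow_polytope a \<epsilon> \<longleftrightarrow> (\<forall>e. 0 \<le> z $ e) \<and> (\<Sum>x\<le>N a. z $ arc (entry x)) = 1 \<and> (\<forall>k\<le>a. ?local k)"
    unfolding car_flow_polytope_def flow_polytope_def verts out_arcs_source
    using flow_conservation_iff[of _ z] by (auto simp: sum_entries simp del: One_nat_def)
  ultimately show ?thesis by simp
qed

lemma convex_car_flow_polytope: "convex (car_flow_polytope a \<epsilon>)"
  unfolding convex_def
proof (intro ballI allI impI)
  fix v w and s t :: real
  assume v: "v \<in> car_flow_polytope a \<epsilon>" and w: "w \<in> car_flow_polytope a \<epsilon>" and st: "0 \<le> s" "0 \<le> t" "s + t = 1"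
  let ?z = "s *\<^sub>R v + t *\<^sub>R w"
  have sums: "(\<Sum>i\<in>I. ?z $ f i) = s * (\<Sum>i\<in>I. v $ f i) + t * (\<Sum>i\<in>I. w $ f i)" for I :: "nat set" and f
    by (simp add: sum.distrib sum_distrib_left)
  have "(\<Sum>y\<le>k. ?z $ arc (exit y)) + (if k < a then ?z $ arc (spine k) else 0) = (\<Sum>x\<le>N k. ?z $ arc (entry x))"
    if "k \<le> a" for k
  proof -
    have "(\<Sum>x\<le>N k. ?z $ arc (entry x))
      = s * ((\<Sum>y\<le>k. v $ arc (exit y)) + (if k < a then v $ arc (spine k) else 0))
        + t * ((\<Sum>y\<le>k. w $ arc (exit y)) + (if k < a then w $ arc (spine k) else 0))"
      unfolding sums using v w that by (simp add: car_flow_polytope_iff)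
    then show ?thesis unfolding sums by (simp add: algebra_simps)
  qed
  moreover have "(\<Sum>x\<le>N a. ?z $ arc (entry x)) = 1"
    unfolding sums using v w st by (simp add: car_flow_polytope_iff)
  moreover have "\<forall>e. 0 \<le> ?z $ e" using v w st by (simp add: car_flow_polytope_iff)
  ultimately show "?z \<in> car_flow_polytope a \<epsilon>" unfolding car_flow_polytope_iff by blast
qed

lemma vec_in_car_flow_polytope:
  assumes c: "(x, y) \<in> cells"
  shows "vec (x, y) \<in> car_flow_polytope a \<epsilon>"
  unfolding car_flow_polytope_iff
proof (intro conjI allI impI)
  note b = cells_height[OF c]
  show "0 \<le> vec (x, y) $ e" for e by (simp add: vec_def route_vec_def)
  have en: "(\<Sum>z\<le>N k. vec (x, y) $ arc (entry z)) = (if x \<le> N k then 1 else 0)" if "k \<le> a" for k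
  proof -
    have "(\<Sum>z\<le>N k. vec (x, y) $ arc (entry z)) = (\<Sum>z\<le>N k. if x = z then 1 else 0)"
      using vec_entry[OF c] N_mono[OF that] by (intro sum.cong) auto
    then show ?thesis by simp
  qed
  show "(\<Sum>x'\<le>N a. vec (x, y) $ arc (entry x')) = 1" using en[of a] b by simp
  fix k assume k: "k \<le> a"
  have "(\<Sum>z\<le>k. vec (x, y) $ arc (exit z)) = (\<Sum>z\<le>k. if y = z then 1 else 0)"
    using vec_exit[OF c] k by (intro sum.cong) auto
  then show "(\<Sum>z\<le>k. vec (x, y) $ arc (exit z)) + (if k < a then vec (x, y) $ arc (spine k) else 0)
      = (\<Sum>x'\<le>N k. vec (x, y) $ arc (entry x'))"
    using en[OF k] vec_spine[OF c, of k] b N_mono[of y k] by auto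
qed

text \<open>For a flow, the cut equations and nonnegativity on the spine give the condition for a
  transport. The combination it yields has the same first and last edges as the flow, and the cut
  equations then determine the spine.\<close>

lemma car_flow_polytope_eq: "car_flow_polytope a \<epsilon> = P"
proof
  show sub: "P \<subseteq> car_flow_polytope a \<epsilon>"
  proof (rule hull_minimal)
    show "vec ` cells \<subseteq> car_flow_polytope a \<epsilon>" using vec_in_car_flow_polytope by (auto simp del: cells_iff)
  qed (rule convex_car_flow_polytope)
  show "car_flow_polytope a \<epsilon> \<subseteq> P"
  proof
    fix z assume zP: "z \<in> car_flow_polytope a \<epsilon>"
    then have z: "\<And>e. 0 \<le> z $ e" "(\<Sum>x\<le>N a. z $ arc (entry x)) = 1"
      "\<And>k. k \<le> a \<Longrightarrow> (\<Sum>y\<le>k. z $ arc (exit y)) + (if k < a then z $ arc (spine k) else 0) = (\<Sum>x\<le>N k. z $ arc (entry x))"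
      by (auto simp: car_flow_polytope_iff)
    have "\<exists>f. (\<forall>p. 0 \<le> f p) \<and> noncrossing {p. f p \<noteq> 0} \<and>
      (\<forall>x\<le>N a. (\<Sum>y\<le>a. f (x, y)) = z $ arc (entry x)) \<and> (\<forall>y\<le>a. (\<Sum>x\<le>N a. f (x, y)) = z $ arc (exit y))"
    proof (rule noncrossing_transport_exists)
      show "(\<Sum>x\<le>N a. z $ arc (entry x)) = (\<Sum>y\<le>a. z $ arc (exit y))" using z(3)[of a] by simp
      fix k assume "k \<le> a"
      then show "(\<Sum>y\<le>k. z $ arc (exit y)) \<le> (\<Sum>x\<le>N k. z $ arc (entry x))"
        using z(3)[of k] z(1)[of "arc (spine k)"] by (auto split: if_splits)
    qed (use z in auto)
    then obtain f where f: "\<And>p. 0 \<le> f p" "noncrossing {p. f p \<noteq> 0}"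
      "\<And>x. x \<le> N a \<Longrightarrow> (\<Sum>y\<le>a. f (x, y)) = z $ arc (entry x)" "\<And>y. y \<le> a \<Longrightarrow> (\<Sum>x\<le>N a. f (x, y)) = z $ arc (exit y)"
      by blast
    have f0: "f p = 0" if "p \<notin> cells" for p using f(2) that unfolding noncrossing_def by blast
    have "(\<Sum>p\<in>cells. f p) = 1" using z(2) f(3) by (subst sum_cells[OF f0]) auto
    then have cP: "comb f \<in> P" using in_hull_iff[of cells "comb f"] f(1) f0 by blast
    have en: "comb f $ arc (entry x) = z $ arc (entry x)" if "x \<le> N a" for x
      using u_comb[OF f0 that] f(3)[OF that] by (simp add: inner_axis')
    have ex: "comb f $ arc (exit y) = z $ arc (exit y)" if "y \<le> a" for y
      using w_comb[OF f0 that] f(4)[OF that] by (simp add: inner_axis')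
    have sp: "comb f $ arc (spine k) = z $ arc (spine k)" if "k < a" for k
    proof -
      have "comb f \<in> car_flow_polytope a \<epsilon>" using cP sub by blast
      then have "(\<Sum>y\<le>k. comb f $ arc (exit y)) + comb f $ arc (spine k) = (\<Sum>x\<le>N k. comb f $ arc (entry x))"
        using that unfolding car_flow_polytope_iff by (elim conjE allE[of _ k]) simp
      moreover have "(\<Sum>y\<le>k. comb f $ arc (exit y)) = (\<Sum>y\<le>k. z $ arc (exit y))"
        using ex that by (intro sum.cong) auto
      moreover have "(\<Sum>x\<le>N k. comb f $ arc (entry x)) = (\<Sum>x\<le>N k. z $ arc (entry x))"
        using en that N_mono[of k a] by (intro sum.cong) auto
      ultimately show ?thesis using z(3)[of k] that by simp
    qed
    have "comb f $ e = z $ e" for e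
      by (cases e rule: arc_cases) (simp_all add: en ex sp)
    then have "comb f = z" by (simp add: vec_eq_iff)
    then show "z \<in> P" using cP by simp
  qed
qed

section \<open>The dual graph and the Hasse diagram\<close>

lemma triangulation_eq: "length_framed_triangulation a \<epsilon> = tri"
  unfolding framed_triangulation_eq tri_def ..

lemma adjacent_iff_rotates:
  assumes "maximal C" "maximal D"
  shows "adjacent C D \<longleftrightarrow> rotates (east_count C) (east_count D) \<or> rotates (east_count D) (east_count C)"
  using adjacent_seq_rot[OF assms] seq_rot_adjacent[OF assms] seq_rot_adjacent[OF assms(2,1)] adjacent_sym
  unfolding rotates_def by blast

text \<open>A simplex goes to the path with the row counts of its maximal set. Arcs match because
  sharing a facet, swapping one cell and rotating in one of the two directions are equivalent; the
  dual graph contains both orientations, hence the symmetric closure.\<close>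

lemma dual_graph_iso:
  "digraph_iso (with_proj (dual_graph tri)) (with_proj (mk_symmetric (with_proj (tamari_hasse (nu_path a \<nu>)))))"
proof -
  let ?p = "nu_path a \<nu>"
  let ?H = "mk_symmetric (with_proj (tamari_hasse ?p))"
  define hull_of where "hull_of C = convex hull (vec ` C)" for C
  define path where "path C = inv_into paths east_at (east_count C)" for C
  define f where "f = path \<circ> inv_into {C. maximal C} hull_of"
  have hull: "bij_betw hull_of {C. maximal C} tri"
    unfolding bij_betw_def tri_def hull_of_def
    using hull_eq_iff maximalD by (auto intro!: inj_onI)
  have "bij_betw (inv_into paths east_at \<circ> east_count) {C. maximal C} paths"
    using bij_betw_trans[OF bij_betw_east_count bij_betw_inv_into[OF bij_betw_east_at]] .
  then have path: "bij_betw path {C. maximal C} paths"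
    by (simp add: path_def[abs_def] comp_def)
  have f: "bij_betw f tri paths"
    unfolding f_def by (rule bij_betw_trans[OF bij_betw_inv_into[OF hull] path])
  have f_hull: "f (hull_of C) = path C" if "maximal C" for C
    using bij_betw_inv_into_left[OF hull, of C] that by (simp add: f_def)
  have east: "east_at (path C) = east_count C" if "maximal C" for C
    unfolding path_def
    using bij_betw_inv_into_right[OF bij_betw_east_at, of "east_count C"] dyck_seq_east_count[OF that] by simp
  have pathD: "path C \<in> paths" if "maximal C" for C
    using bij_betwE[OF path] that by blast
  have H: "parcs ?H = {(m, m'). rotation ?p m m' \<or> rotation ?p m' m}" "pverts ?H = paths"
    unfolding mk_symmetric_def with_proj_simps parcs_tamari_hasse
    by (auto simp: tamari_hasse_def hasse_diagram_def)
  have arcs: "(hull_of C, hull_of D) \<in> parcs (dual_graph tri) \<longleftrightarrow> (path C, path D) \<in> parcs ?H"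
    if "maximal C" "maximal D" for C D
  proof -
    have "(hull_of C, hull_of D) \<in> parcs (dual_graph tri) \<longleftrightarrow> adjacent C D"
      using common_facet_iff[OF that] that unfolding dual_graph_def hull_of_def tri_def by auto
    also have "\<dots> \<longleftrightarrow> (path C, path D) \<in> parcs ?H"
      unfolding adjacent_iff_rotates[OF that] H(1)
      using rotation_iff_rotates[OF pathD[OF that(1)] pathD[OF that(2)]]
        rotation_iff_rotates[OF pathD[OF that(2)] pathD[OF that(1)]] east that by simp
    finally show ?thesis .
  qed
  have T: "pverts (dual_graph tri) = tri" "parcs (dual_graph tri) \<subseteq> tri \<times> tri"
    by (auto simp: dual_graph_def)
  have tri_hull: "S \<in> tri \<longleftrightarrow> (\<exists>C. maximal C \<and> S = hull_of C)" for S
    by (auto simp: tri_def hull_of_def)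
  have Hsub: "parcs ?H \<subseteq> paths \<times> paths"
    unfolding H using rotation_dyck_paths by auto
  have img: "parcs ?H = map_prod f f ` parcs (dual_graph tri)"
  proof (intro equalityI subsetI)
    fix q assume q: "q \<in> parcs ?H"
    then obtain C D where "maximal C" "maximal D" "q = (path C, path D)"
      using Hsub bij_betw_imp_surj_on[OF path] by blast
    then show "q \<in> map_prod f f ` parcs (dual_graph tri)"
      using arcs q f_hull by (intro image_eqI[of _ _ "(hull_of C, hull_of D)"]) auto
  next
    fix q assume "q \<in> map_prod f f ` parcs (dual_graph tri)"
    then obtain S S' where S: "(S, S') \<in> parcs (dual_graph tri)" "q = (f S, f S')" by auto
    then have "S \<in> tri" "S' \<in> tri" using T(2) by auto
    then obtain C D where "maximal C" "S = hull_of C" "maximal D" "S' = hull_of D"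
      unfolding tri_hull by (elim exE conjE)
    then show "q \<in> parcs ?H" using S arcs f_hull by auto
  qed
  define hom where "hom = \<lparr>iso_verts = f, iso_arcs = map_prod f f, iso_head = snd, iso_tail = fst\<rparr>"
  have inj: "inj_on f tri" using f by (simp add: bij_betw_def)
  have "pre_digraph.digraph_isomorphism (with_proj (dual_graph tri)) hom"
    unfolding pre_digraph.digraph_isomorphism_def
  proof (intro conjI)
    show "wf_digraph (with_proj (dual_graph tri))" by unfold_locales (use T in auto)
    show "inj_on (iso_verts hom) (verts (with_proj (dual_graph tri)))"
      using inj T(1) by (simp add: hom_def)
    have "inj_on (map_prod f f) (tri \<times> tri)" using inj by (simp add: map_prod_inj_on)
    then show "inj_on (iso_arcs hom) (arcs (with_proj (dual_graph tri)))"
      using inj_on_subset[OF _ T(2)] by (simp add: hom_def)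
  qed (simp add: hom_def split_beta)
  moreover have "with_proj ?H = app_iso hom (with_proj (dual_graph tri))"
    unfolding app_iso_def with_proj_def[of ?H] with_proj_def[of "dual_graph tri"]
    using img H(2) T(1) bij_betw_imp_surj_on[OF f] by (simp add: hom_def)
  ultimately show ?thesis unfolding digraph_iso_def by blast
qed

end

theorem theorem1p2:
  fixes a b :: nat and \<nu> :: "nat \<Rightarrow> nat" and \<epsilon> :: "'e::finite \<Rightarrow> edge"
  assumes "a \<ge> 1"
    and "endpoint (nu_path a \<nu>) = (b, a)"
    and "bij_betw \<epsilon> UNIV (car_edges a \<nu>)"
  shows "regular_triangulation (car_flow_polytope a \<epsilon>) (length_framed_triangulation a \<epsilon>) \<and>
    unimodular_triangulation (car_flow_polytope a \<epsilon>) (length_framed_triangulation a \<epsilon>) \<and>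
    digraph_iso (with_proj (dual_graph (length_framed_triangulation a \<epsilon>)))
      (with_proj (mk_symmetric (with_proj (tamari_hasse (nu_path a \<nu>)))))"
proof -
  interpret caracol_graph a \<nu> \<epsilon> by unfold_locales (rule assms(3))
  show ?thesis
    unfolding triangulation_eq car_flow_polytope_eq
    using regular_triangulation_tri unimodular_triangulation_tri dual_graph_iso by blast
qed

end
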